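(* The following holds both in continuous time and in discrete time. (1) Let $\Sigma$ be an LSS. For any minimal LSS $\Sigma_m$ which is equivalent to $\Sigma$, $\gamma(\Sigma_m)\le\gamma(\Sigma)$. (2) If $\Sigma_1$ and $\Sigma_2$ are two minimal and equivalent LSSs, then $\gamma(\Sigma_1)=\gamma(\Sigma_2)$.
   Context: Let $Q=\{1,\ldots,D\}$, $D\ge1$. A linear switched system (LSS) is a tuple $\Sigma=(n,Q,\{(A_q,B_q,C_q)\mid q\in Q\})$ with $A_q\in\mathbb{R}^{n\times n}$, $B_q\in\mathbb{R}^{n\times m}$, $C_q\in\mathbb{R}^{p\times n}$; $n=\dim\Sigma$. In continuous time, with $T=[0,\infty)$, inputs are $u\in\mathcal{U}=L_2(T,\mathbb{R}^m)$, switching signals are $q\in\mathcal{Q}=PC(T,Q)$ (piecewise continuous: finitely many discontinuities on each compact interval, with one-sided limits), states are absolutely continuous functions. In discrete time, $\mathcal{U}=l_2(\mathbb{N},\mathbb{R}^m)$ and $\mathcal{Q}$ is the set of infinite sequences in $Q$. The input-output map $Y^\Sigma$ sends $(u,q)\in\mathcal{U}\times\mathcal{Q}$ to $y$, where $\delta x(t)=A_{q(t)}x(t)+B_{q(t)}u(t)$ (a.e. in continuous time), $x(0)=0$, $y(t)=C_{q(t)}x(t)$, with $\delta x=\dot x$ in continuous time and $\delta x(t)=x(t+1)$ in discrete time. Two LSSs (with the same $Q,m,p$) are equivalent if they have the same input-output map. $\Sigma$ is minimal if $\dim\Sigma\le\dim\Sigma'$ for every LSS $\Sigma'$ equivalent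 to $\Sigma$. For $\gamma>0$, $\mathbf{G}_\gamma(\Sigma)$ is the set of all positive definite $P\in\mathbb{R}^{n\times n}$ such that for all $q\in Q$, $$\begin{bmatrix} A_q^TP+PA_q+C_q^TC_q & PB_q \\ B_q^TP & -\gamma^2I \end{bmatrix}<0\ \text{(continuous time)},\qquad \begin{bmatrix} A_q^TPA_q+C_q^TC_q-P & A_q^TPB_q \\ B_q^TPA_q & B_q^TPB_q-\gamma^2I \end{bmatrix}<0\ \text{(discrete time)}.$$ Define $\gamma(\Sigma)=\inf\{\gamma>0\mid\mathbf{G}_\gamma(\Sigma)\ne\emptyset\}$ (with $\inf\emptyset=+\infty$). *)

theory Defs
  imports "HOL-Analysis.Analysis" "Jordan_Normal_Form.Matrix"
begin

no_notation inner (infix \<open>\<bullet>\<close> 70)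
no_notation vec_nth (infixl \<open>$\<close> 90)
hide_const (open) Finite_Cartesian_Product.vec Finite_Cartesian_Product.mat

section \<open>Linear switched systems\<close>

text \<open>
  State dimensions are compared between different systems, so they are natural numbers and all
  matrices and vectors are those of \<open>Jordan_Normal_Form\<close>, which carry their dimensions.
  Throughout, \<open>D\<close>, \<open>m\<close>, \<open>p\<close> are the numbers of modes, inputs and outputs. Dimension \<open>0\<close> is
  allowed: it is the minimal dimension of a realization of the zero map.
\<close>

abbreviation modes :: "nat \<Rightarrow> nat set" where
  "modes D \<equiv> {1..D}"

record lss =
  lss_dim :: nat
  lss_A :: "nat \<Rightarrow> real mat"
  lss_B :: "nat \<Rightarrow> real mat"
  lss_C :: "nat \<Rightarrow> real mat"

definition is_lss :: "nat \<Rightarrow> nat \<Rightarrow> nat \<Rightarrow> lss \<Rightarrow> bool" where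
  "is_lss D m p S \<longleftrightarrow> (\<forall>q\<in>modes D.
     lss_A S q \<in> carrier_mat (lss_dim S) (lss_dim S) \<and>
     lss_B S q \<in> carrier_mat (lss_dim S) m \<and>
     lss_C S q \<in> carrier_mat p (lss_dim S))"


section \<open>Continuous time\<close>

definition ct_inputs :: "nat \<Rightarrow> (real \<Rightarrow> real vec) set" where
  "ct_inputs m = {u.
     (\<forall>t\<ge>0. u t \<in> carrier_vec m) \<and>
     (\<forall>i<m. (\<lambda>t. u t $ i) \<in> borel_measurable (lebesgue_on {0..})) \<and>
     integrable (lebesgue_on {0..}) (\<lambda>t. u t \<bullet> u t)}"

text \<open>Limits and continuity of mode-valued functions refer to the discrete topology on \<open>nat\<close>.
  The value at a discontinuity is not prescribed.\<close>

definition ct_switching :: "nat \<Rightarrow> (real \<Rightarrow> nat) set" where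
  "ct_switching D = {q.
     (\<forall>t\<ge>0. q t \<in> modes D) \<and>
     (\<forall>b\<ge>0. finite {t \<in> {0..b}. \<not> continuous (at t within {0..}) q}) \<and>
     (\<forall>t\<ge>0. \<exists>l. (q \<longlongrightarrow> l) (at_right t)) \<and>
     (\<forall>t>0. \<exists>l. (q \<longlongrightarrow> l) (at_left t))}"

definition abs_continuous_on_interval :: "(real \<Rightarrow> real) \<Rightarrow> real \<Rightarrow> real \<Rightarrow> bool" where
  "abs_continuous_on_interval f a b \<longleftrightarrow> (\<forall>\<epsilon>>0. \<exists>\<delta>>0. \<forall>(N::nat) l r.
     (\<forall>i<N. a \<le> l i \<and> l i \<le> r i \<and> r i \<le> b) \<and>
     disjoint_family_on (\<lambda>i. {l i<..<r i}) {..<N} \<and>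
     (\<Sum>i<N. r i - l i) < \<delta>
     \<longrightarrow> (\<Sum>i<N. \<bar>f (r i) - f (l i)\<bar>) < \<epsilon>)"

text \<open>On the unbounded time axis, absolute continuity is required on every compact interval:
  trajectories of unstable systems are not absolutely continuous in the global sense.\<close>

definition ct_solution ::
    "lss \<Rightarrow> (real \<Rightarrow> real vec) \<Rightarrow> (real \<Rightarrow> nat) \<Rightarrow> (real \<Rightarrow> real vec) \<Rightarrow> bool" where
  "ct_solution S u q x \<longleftrightarrow>
     (\<forall>t\<ge>0. x t \<in> carrier_vec (lss_dim S)) \<and>
     (\<forall>b\<ge>0. \<forall>i<lss_dim S. abs_continuous_on_interval (\<lambda>t. x t $ i) 0 b) \<and>
     x 0 = 0\<^sub>v (lss_dim S) \<and>
     (AE t in lebesgue_on {0..}. \<forall>i<lss_dim S.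
        ((\<lambda>s. x s $ i) has_real_derivative
          (lss_A S (q t) *\<^sub>v x t + lss_B S (q t) *\<^sub>v u t) $ i) (at t within {0..}))"

definition ct_io_map ::
    "nat \<Rightarrow> nat \<Rightarrow> lss \<Rightarrow> (real \<Rightarrow> real vec) \<times> (real \<Rightarrow> nat) \<Rightarrow> real \<Rightarrow> real vec" where
  "ct_io_map D m S = (\<lambda>(u, q)\<in>ct_inputs m \<times> ct_switching D.
     THE y. \<exists>x. ct_solution S u q x \<and> y = (\<lambda>t\<in>{0..}. lss_C S (q t) *\<^sub>v x t))"

definition ct_equivalent :: "nat \<Rightarrow> nat \<Rightarrow> lss \<Rightarrow> lss \<Rightarrow> bool" where
  "ct_equivalent D m S S' \<longleftrightarrow> ct_io_map D m S = ct_io_map D m S'"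

definition ct_minimal :: "nat \<Rightarrow> nat \<Rightarrow> nat \<Rightarrow> lss \<Rightarrow> bool" where
  "ct_minimal D m p S \<longleftrightarrow> is_lss D m p S \<and>
     (\<forall>S'. is_lss D m p S' \<and> ct_equivalent D m S' S \<longrightarrow> lss_dim S \<le> lss_dim S')"


section \<open>Discrete time\<close>

definition dt_inputs :: "nat \<Rightarrow> (nat \<Rightarrow> real vec) set" where
  "dt_inputs m = {u. (\<forall>t. u t \<in> carrier_vec m) \<and> summable (\<lambda>t. u t \<bullet> u t)}"

definition dt_switching :: "nat \<Rightarrow> (nat \<Rightarrow> nat) set" where
  "dt_switching D = {q. \<forall>t. q t \<in> modes D}"

primrec dt_state :: "lss \<Rightarrow> (nat \<Rightarrow> real vec) \<Rightarrow> (nat \<Rightarrow> nat) \<Rightarrow> nat \<Rightarrow> real vec" where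
  "dt_state S u q 0 = 0\<^sub>v (lss_dim S)"
| "dt_state S u q (Suc t) = lss_A S (q t) *\<^sub>v dt_state S u q t + lss_B S (q t) *\<^sub>v u t"

definition dt_io_map ::
    "nat \<Rightarrow> nat \<Rightarrow> lss \<Rightarrow> (nat \<Rightarrow> real vec) \<times> (nat \<Rightarrow> nat) \<Rightarrow> nat \<Rightarrow> real vec" where
  "dt_io_map D m S = (\<lambda>(u, q)\<in>dt_inputs m \<times> dt_switching D.
     \<lambda>t. lss_C S (q t) *\<^sub>v dt_state S u q t)"

definition dt_equivalent :: "nat \<Rightarrow> nat \<Rightarrow> lss \<Rightarrow> lss \<Rightarrow> bool" where
  "dt_equivalent D m S S' \<longleftrightarrow> dt_io_map D m S = dt_io_map D m S'"

definition dt_minimal :: "nat \<Rightarrow> nat \<Rightarrow> nat \<Rightarrow> lss \<Rightarrow> bool" where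
  "dt_minimal D m p S \<longleftrightarrow> is_lss D m p S \<and>
     (\<forall>S'. is_lss D m p S' \<and> dt_equivalent D m S' S \<longrightarrow> lss_dim S \<le> lss_dim S')"


section \<open>Linear matrix inequalities and the gain bound\<close>

definition pos_def_mat :: "nat \<Rightarrow> real mat \<Rightarrow> bool" where
  "pos_def_mat k P \<longleftrightarrow> P \<in> carrier_mat k k \<and> P\<^sup>T = P \<and>
     (\<forall>v\<in>carrier_vec k. v \<noteq> 0\<^sub>v k \<longrightarrow> v \<bullet> (P *\<^sub>v v) > 0)"

definition neg_def_mat :: "nat \<Rightarrow> real mat \<Rightarrow> bool" where
  "neg_def_mat k P \<longleftrightarrow> P \<in> carrier_mat k k \<and> P\<^sup>T = P \<and>
     (\<forall>v\<in>carrier_vec k. v \<noteq> 0\<^sub>v k \<longrightarrow> v \<bullet> (P *\<^sub>v v) < 0)"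

definition ct_G :: "nat \<Rightarrow> nat \<Rightarrow> real \<Rightarrow> lss \<Rightarrow> real mat set" where
  "ct_G D m \<gamma> S = {P. pos_def_mat (lss_dim S) P \<and> (\<forall>q\<in>modes D.
     let A = lss_A S q; B = lss_B S q; C = lss_C S q in
     neg_def_mat (lss_dim S + m)
       (four_block_mat
          (A\<^sup>T * P + P * A + C\<^sup>T * C)  (P * B)
          (B\<^sup>T * P)                    ((- (\<gamma>\<^sup>2)) \<cdot>\<^sub>m 1\<^sub>m m)))}"

definition dt_G :: "nat \<Rightarrow> nat \<Rightarrow> real \<Rightarrow> lss \<Rightarrow> real mat set" where
  "dt_G D m \<gamma> S = {P. pos_def_mat (lss_dim S) P \<and> (\<forall>q\<in>modes D.
     let A = lss_A S q; B = lss_B S q; C = lss_C S q in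
     neg_def_mat (lss_dim S + m)
       (four_block_mat
          (A\<^sup>T * P * A + C\<^sup>T * C - P)  (A\<^sup>T * P * B)
          (B\<^sup>T * P * A)                (B\<^sup>T * P * B - \<gamma>\<^sup>2 \<cdot>\<^sub>m 1\<^sub>m m)))}"

definition ct_gamma :: "nat \<Rightarrow> nat \<Rightarrow> lss \<Rightarrow> ereal" where
  "ct_gamma D m S = Inf {ereal \<gamma> | \<gamma>. \<gamma> > 0 \<and> ct_G D m \<gamma> S \<noteq> {}}"

definition dt_gamma :: "nat \<Rightarrow> nat \<Rightarrow> lss \<Rightarrow> ereal" where
  "dt_gamma D m S = Inf {ereal \<gamma> | \<gamma>. \<gamma> > 0 \<and> dt_G D m \<gamma> S \<noteq> {}}"

end

theory Submission
  imports Defs "Jordan_Normal_Form.Determinant"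
begin

text \<open>
  Let \<open>P\<close> solve the matrix inequalities of a system \<open>S\<close> for some \<open>\<gamma>\<close>. It makes \<open>x \<bullet> (P *\<^sub>v x)\<close> a
  storage function: along \<open>S\<close>, in every mode, stored energy grows by strictly less than the
  supply \<open>\<gamma>^2 * |u|^2 - |y|^2\<close>. An equivalent minimal system \<open>S'\<close> inherits a storage function
  for the same \<open>\<gamma>\<close>, namely the least energy of those states of \<open>S\<close> that correspond to a given
  state of \<open>S'\<close>. Hence the infimum defining the gain bound of \<open>S'\<close> runs over at least as many
  values. The equality for two minimal systems follows by applying this in both directions.

  Correspondence of states means membership in the linear span \<open>W\<close> of all pairs of states that the two
  systems reach at the same time under the same control. This span is invariant under the joint
  dynamics and contains the joint input directions: a functional that vanishes on all jointly reachable
  pairs also vanishes on their continuations in any mode with any constant input, hence on the next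
  states in discrete time and on the velocities in continuous time
  (\<open>biannihilator_simulation\<close>, \<open>dt_equivalent_simulation\<close>, \<open>ct_equivalent_simulation\<close>). Equivalence
  of the systems says that corresponding states have the same output in every mode, since the mode at
  the observation time can be chosen freely.

  Minimality makes \<open>W\<close> as good as the graph of a map onto the states of \<open>S'\<close>: the states of \<open>S'\<close> that
  occur in \<open>W\<close> form a subspace to which \<open>S'\<close> could be restricted, and the states that correspond to zero
  form a subspace by which \<open>S'\<close> could be divided, both without changing the input-output map
  (\<open>irreducible_imp_onto_and_injective\<close>). So the first subspace is everything and the second one is
  zero. The state of least energy that corresponds to \<open>z\<close> then depends linearly and injectively on
  \<open>z\<close>, and orthogonality of the minimizers to the states that correspond to zero carries the dissipation
  inequality over (\<open>orthogonal_section\<close>, \<open>G_transfer\<close>).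

  In continuous time this argument rests on existence and uniqueness of solutions for square
  integrable inputs and piecewise constant modes. Solutions in the sense of absolutely continuous
  functions are the solutions of an integral equation
  (\<open>fundamental_theorem_abs_continuous\<close>, \<open>abs_continuous_indefinite_integral\<close>,
  \<open>indefinite_integral_AE_derivative\<close>), which the Picard series solves.
\<close>

section \<open>Subspaces and linear relations of real vectors\<close>

lemma mult_unit_vec_eq_col:
  fixes M :: "'a::comm_ring_1 mat"
  assumes "M \<in> carrier_mat r c" "j < c"
  shows "M *\<^sub>v unit_vec c j = col M j"
  using assms by (intro eq_vecI) auto

lemma mat_eq_by_mult_vec:
  fixes M N :: "'a::comm_ring_1 mat"
  assumes "M \<in> carrier_mat r c" "N \<in> carrier_mat r c"
    and "\<And>x. x \<in> carrier_vec c \<Longrightarrow> M *\<^sub>v x = N *\<^sub>v x"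
  shows "M = N"
proof (rule mat_col_eqI)
  fix j assume "j < dim_col N"
  then have j: "j < c" using assms(2) by simp
  show "col M j = col N j"
    using assms(3)[OF unit_vec_carrier, of j] mult_unit_vec_eq_col[OF assms(1) j]
      mult_unit_vec_eq_col[OF assms(2) j] by simp
qed (use assms in auto)

text \<open>
  Padding both factors with zeros to square matrices keeps the product equal to the identity, so
  the padded factors commute. If there were fewer columns than rows, their product in the other
  order would have a zero row.
\<close>

lemma right_inverse_dim_le:
  fixes X Y :: "'a::field mat"
  assumes X: "X \<in> carrier_mat k n" and Y: "Y \<in> carrier_mat n k" and XY: "X * Y = 1\<^sub>m k"
  shows "k \<le> n"
proof (rule ccontr)
  assume "\<not> k \<le> n"
  then have nk: "n < k" by simp
  define X' where "X' = mat k k (\<lambda>(i,j). if j < n then X $$ (i,j) else 0)"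
  define Y' where "Y' = mat k k (\<lambda>(i,j). if i < n then Y $$ (i,j) else 0)"
  have c: "X' \<in> carrier_mat k k" "Y' \<in> carrier_mat k k" by (auto simp: X'_def Y'_def)
  have "X' * Y' = 1\<^sub>m k"
  proof (rule eq_matI)
    fix i j assume "i < dim_row (1\<^sub>m k :: 'a mat)" "j < dim_col (1\<^sub>m k :: 'a mat)"
    then have ij: "i < k" "j < k" by auto
    have "(X' * Y') $$ (i,j) = (\<Sum>l<k. if l < n then X $$ (i,l) * Y $$ (l,j) else 0)"
      using ij c by (auto simp: scalar_prod_def X'_def Y'_def atLeast0LessThan intro!: sum.cong)
    also have "\<dots> = (\<Sum>l<n. X $$ (i,l) * Y $$ (l,j))"
      using nk by (intro sum.mono_neutral_cong_right) auto
    also have "\<dots> = (X * Y) $$ (i,j)"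
      using ij X Y by (auto simp: scalar_prod_def atLeast0LessThan)
    finally show "(X' * Y') $$ (i,j) = 1\<^sub>m k $$ (i,j)" using XY by simp
  qed (auto simp: X'_def Y'_def)
  then have "Y' * X' = 1\<^sub>m k" using mat_mult_left_right_inverse[OF c] by simp
  then have "(Y' * X') $$ (n,n) = 1" using nk by simp
  moreover have "(Y' * X') $$ (n,n) = 0"
    using nk c by (auto simp: scalar_prod_def Y'_def)
  ultimately show False by simp
qed

definition subspace_vec :: "nat \<Rightarrow> real vec set \<Rightarrow> bool" where
  "subspace_vec n W \<longleftrightarrow> W \<subseteq> carrier_vec n \<and> 0\<^sub>v n \<in> W \<and>
     (\<forall>x\<in>W. \<forall>y\<in>W. x + y \<in> W) \<and> (\<forall>c. \<forall>x\<in>W. c \<cdot>\<^sub>v x \<in> W)"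

text \<open>
  A linear relation is a subspace of a product. It is kept as a set of pairs, not as a set of
  concatenated vectors, because only the two components are ever acted upon.
\<close>

definition linear_relation :: "nat \<Rightarrow> nat \<Rightarrow> (real vec \<times> real vec) set \<Rightarrow> bool" where
  "linear_relation n k W \<longleftrightarrow> W \<subseteq> carrier_vec n \<times> carrier_vec k \<and> (0\<^sub>v n, 0\<^sub>v k) \<in> W \<and>
     (\<forall>x z y w. (x, z) \<in> W \<and> (y, w) \<in> W \<longrightarrow> (x + y, z + w) \<in> W) \<and>
     (\<forall>c x z. (x, z) \<in> W \<longrightarrow> (c \<cdot>\<^sub>v x, c \<cdot>\<^sub>v z) \<in> W)"

abbreviation mat_of_col_fun :: "nat \<Rightarrow> nat \<Rightarrow> (nat \<Rightarrow> real vec) \<Rightarrow> real mat" where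
  "mat_of_col_fun n k v \<equiv> mat n k (\<lambda>(i, j). v j $ i)"

lemma mat_of_col_fun_mult_vec:
  assumes "c \<in> carrier_vec k"
  shows "mat_of_col_fun n k v *\<^sub>v c = vec n (\<lambda>i. \<Sum>j<k. c $ j * v j $ i)"
  using assms by (intro eq_vecI) (auto simp: scalar_prod_def atLeast0LessThan mult.commute)

lemma linear_relation_minus:
  assumes W: "linear_relation n k W" and "(x, z) \<in> W" "(y, w) \<in> W"
  shows "(x - y, z - w) \<in> W"
proof -
  have c: "x \<in> carrier_vec n" "y \<in> carrier_vec n" "z \<in> carrier_vec k" "w \<in> carrier_vec k"
    using assms unfolding linear_relation_def by auto
  have "(x + (-1) \<cdot>\<^sub>v y, z + (-1) \<cdot>\<^sub>v w) \<in> W"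
    using assms unfolding linear_relation_def by blast
  moreover have "x + (-1) \<cdot>\<^sub>v y = x - y" "z + (-1) \<cdot>\<^sub>v w = z - w" using c by auto
  ultimately show ?thesis by simp
qed

lemma linear_relation_sum:
  fixes l :: nat
  assumes W: "linear_relation n k W" and "\<And>j. j < l \<Longrightarrow> (v j, w j) \<in> W"
  shows "(vec n (\<lambda>i. \<Sum>j<l. c j * v j $ i), vec k (\<lambda>i. \<Sum>j<l. c j * w j $ i)) \<in> W"
  using assms(2)
proof (induction l)
  case 0
  have "vec n (\<lambda>i. 0::real) = 0\<^sub>v n" "vec k (\<lambda>i. 0::real) = 0\<^sub>v k" by auto
  then show ?case using W by (simp add: linear_relation_def)
next
  case (Suc l)
  have c: "v l \<in> carrier_vec n" "w l \<in> carrier_vec k"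
    using Suc.prems[of l] W unfolding linear_relation_def by auto
  have "(c l \<cdot>\<^sub>v v l, c l \<cdot>\<^sub>v w l) \<in> W"
    using Suc.prems[of l] W unfolding linear_relation_def by blast
  moreover have "(vec n (\<lambda>i. \<Sum>j<l. c j * v j $ i), vec k (\<lambda>i. \<Sum>j<l. c j * w j $ i)) \<in> W"
    using Suc by simp
  ultimately have "(vec n (\<lambda>i. \<Sum>j<l. c j * v j $ i) + c l \<cdot>\<^sub>v v l,
      vec k (\<lambda>i. \<Sum>j<l. c j * w j $ i) + c l \<cdot>\<^sub>v w l) \<in> W"
    using W unfolding linear_relation_def by blast
  moreover have "vec n (\<lambda>i. \<Sum>j<l. c j * v j $ i) + c l \<cdot>\<^sub>v v l = vec n (\<lambda>i. \<Sum>j<Suc l. c j * v j $ i)"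
    "vec k (\<lambda>i. \<Sum>j<l. c j * w j $ i) + c l \<cdot>\<^sub>v w l = vec k (\<lambda>i. \<Sum>j<Suc l. c j * w j $ i)"
    using c by auto
  ultimately show ?case by simp
qed

lemma subspace_vec_minus:
  assumes "subspace_vec n W" "x \<in> W" "y \<in> W" shows "x - y \<in> W"
proof -
  have c: "x \<in> carrier_vec n" "y \<in> carrier_vec n" using assms by (auto simp: subspace_vec_def)
  have "x + (-1) \<cdot>\<^sub>v y \<in> W" using assms unfolding subspace_vec_def by blast
  moreover have "x + (-1) \<cdot>\<^sub>v y = x - y" using c by auto
  ultimately show ?thesis by simp
qed

lemma subspace_vec_sum:
  fixes l :: nat
  assumes W: "subspace_vec n W" and v: "\<And>j. j < l \<Longrightarrow> v j \<in> W"
  shows "vec n (\<lambda>i. \<Sum>j<l. c j * v j $ i) \<in> W"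
proof -
  have "linear_relation n n {(x, x) | x. x \<in> W}"
    using W unfolding subspace_vec_def linear_relation_def by auto
  from linear_relation_sum[OF this, of l v v c] v show ?thesis by auto
qed

lemma pos_def_mat_one: "pos_def_mat n (1\<^sub>m n)"
proof -
  have "v \<bullet> v > 0" if "v \<in> carrier_vec n" "v \<noteq> 0\<^sub>v n" for v :: "real vec"
    using that conjugate_square_greater_0_vec[of v n] by (simp add: scalar_prod_def conjugate_vec_def)
  then show ?thesis by (simp add: pos_def_mat_def)
qed

lemma pos_def_mat_sym:
  assumes "pos_def_mat n P" "x \<in> carrier_vec n" "y \<in> carrier_vec n"
  shows "x \<bullet> (P *\<^sub>v y) = y \<bullet> (P *\<^sub>v x)"
proof -
  have P: "P \<in> carrier_mat n n" "P\<^sup>T = P" using assms by (auto simp: pos_def_mat_def)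
  have "x \<bullet> (P *\<^sub>v y) = (P\<^sup>T *\<^sub>v x) \<bullet> y"
    using transpose_vec_mult_scalar[OF P(1) assms(3,2)] by simp
  also have "\<dots> = y \<bullet> (P *\<^sub>v x)" unfolding P(2) using P assms by (intro comm_scalar_prod[of _ n]) auto
  finally show ?thesis .
qed

lemma pos_def_mat_nonneg:
  assumes "pos_def_mat n P" "x \<in> carrier_vec n"
  shows "x \<bullet> (P *\<^sub>v x) \<ge> 0"
proof (cases "x = 0\<^sub>v n")
  case True
  then show ?thesis using assms by (auto simp: pos_def_mat_def)
next
  case False
  then show ?thesis using assms by (auto simp: pos_def_mat_def less_imp_le)
qed

lemma scalar_prod_mat_of_col_fun:
  assumes "\<And>j. j < k \<Longrightarrow> v j \<in> carrier_vec n" "x \<in> carrier_vec n" "i < k"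
  shows "((mat_of_col_fun n k v)\<^sup>T *\<^sub>v x) $ i = v i \<bullet> x"
proof -
  have "row (mat_of_col_fun n k v)\<^sup>T i = v i"
    using assms(1)[of i] assms(3) by (intro eq_vecI) auto
  then show ?thesis using assms by simp
qed

text \<open>
  The columns of the matrix are a largest family in the subspace that is orthonormal for the inner
  product given by the positive definite matrix. Its size is bounded because orthonormality makes
  it right invertible, and it spans because the residual of the orthogonal projection of a
  vector outside its range could be normalized and added to the family. Weighting the inner product
  is needed below to split off the part of a state that is orthogonal in energy; the identity weight
  gives ordinary bases.
\<close>

lemma orthonormal_basis:
  assumes P: "pos_def_mat n P" and W: "subspace_vec n W"
  obtains k V where "k \<le> n" "V \<in> carrier_mat n k" "V\<^sup>T * (P * V) = 1\<^sub>m k"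
    "\<And>c. c \<in> carrier_vec k \<Longrightarrow> V *\<^sub>v c \<in> W"
    "\<And>w. w \<in> W \<Longrightarrow> V *\<^sub>v (V\<^sup>T *\<^sub>v (P *\<^sub>v w)) = w"
proof -
  have Pc: "P \<in> carrier_mat n n" using P by (simp add: pos_def_mat_def)
  have WC: "\<And>x. x \<in> W \<Longrightarrow> x \<in> carrier_vec n" using W by (auto simp: subspace_vec_def)
  define good where "good k \<longleftrightarrow> (\<exists>v. (\<forall>i<k::nat. v i \<in> W) \<and>
     (\<forall>i<k. \<forall>j<k. v i \<bullet> (P *\<^sub>v v j) = (if i = j then 1 else 0)))" for k
  have ortho: "(mat_of_col_fun n k v)\<^sup>T * (P * mat_of_col_fun n k v) = 1\<^sub>m k"
    if v: "\<And>i. i < k \<Longrightarrow> v i \<in> W" "\<And>i j. i < k \<Longrightarrow> j < k \<Longrightarrow> v i \<bullet> (P *\<^sub>v v j) = (if i = j then 1 else 0)"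
    for k :: nat and v
  proof (rule eq_matI)
    let ?V = "mat_of_col_fun n k v"
    fix i j assume "i < dim_row (1\<^sub>m k :: real mat)" "j < dim_col (1\<^sub>m k :: real mat)"
    then have ij: "i < k" "j < k" by auto
    have cj: "col ?V j = v j" and ci: "col ?V i = v i"
      using ij WC[OF v(1), of i] WC[OF v(1), of j] by (auto intro!: eq_vecI)
    have "(?V\<^sup>T * (P * ?V)) $$ (i,j) = col ?V i \<bullet> (P *\<^sub>v col ?V j)"
      using ij Pc by (simp add: col_mult2[OF Pc, of ?V k])
    then show "(?V\<^sup>T * (P * ?V)) $$ (i,j) = 1\<^sub>m k $$ (i,j)" using v ij ci cj by simp
  qed (use Pc in auto)
  have bound: "k \<le> n" if g: "good k" for k
  proof -
    obtain v where v: "\<And>i. i < k \<Longrightarrow> v i \<in> W" "\<And>i j. i < k \<Longrightarrow> j < k \<Longrightarrow> v i \<bullet> (P *\<^sub>v v j) = (if i = j then 1 else 0)"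
      using g unfolding good_def by blast
    show ?thesis
      by (rule right_inverse_dim_le[OF _ _ ortho[OF v]]) (use Pc in auto)
  qed
  have "good 0" by (simp add: good_def)
  then obtain k where k: "good k" and max: "\<And>k'. good k' \<Longrightarrow> k' \<le> k"
    using GreatestI_nat[of good 0 n] Greatest_le_nat[of good _ n] bound by blast
  obtain v where v: "\<And>i. i < k \<Longrightarrow> v i \<in> W" "\<And>i j. i < k \<Longrightarrow> j < k \<Longrightarrow> v i \<bullet> (P *\<^sub>v v j) = (if i = j then 1 else 0)"
    using k unfolding good_def by blast
  define V where "V = mat_of_col_fun n k v"
  have Vc: "V \<in> carrier_mat n k" by (simp add: V_def)
  have VV: "V\<^sup>T * (P * V) = 1\<^sub>m k" unfolding V_def by (rule ortho) (use v in auto)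
  have range: "V *\<^sub>v c \<in> W" if "c \<in> carrier_vec k" for c
    unfolding V_def mat_of_col_fun_mult_vec[OF that] by (rule subspace_vec_sum[OF W v(1)])
  have "V *\<^sub>v (V\<^sup>T *\<^sub>v (P *\<^sub>v w)) = w" if w: "w \<in> W" for w
  proof (rule ccontr)
    assume neq: "V *\<^sub>v (V\<^sup>T *\<^sub>v (P *\<^sub>v w)) \<noteq> w"
    have wc: "w \<in> carrier_vec n" using w WC by auto
    \<comment> \<open>Gram-Schmidt step: subtract the projection and normalize\<close>
    define r where "r = V *\<^sub>v (V\<^sup>T *\<^sub>v (P *\<^sub>v w))"
    have rW: "r \<in> W" unfolding r_def using Vc Pc wc by (intro range) auto
    have rc: "r \<in> carrier_vec n" using rW WC by auto
    define d where "d = w - r"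
    have dW: "d \<in> W" unfolding d_def by (rule subspace_vec_minus[OF W w rW])
    have dc: "d \<in> carrier_vec n" using dW WC by auto
    have "d \<noteq> 0\<^sub>v n"
    proof
      assume "d = 0\<^sub>v n"
      then have "w $ i = r $ i" if "i < n" for i using that wc rc unfolding d_def
        by (metis index_minus_vec(1) index_zero_vec(1) carrier_vecD right_minus_eq)
      then have "r = w" using wc rc by (intro eq_vecI) auto
      then show False using neq r_def by simp
    qed
    define s where "s = d \<bullet> (P *\<^sub>v d)"
    have s: "s > 0" using P dc \<open>d \<noteq> 0\<^sub>v n\<close> by (auto simp: s_def pos_def_mat_def)
    have orth: "v i \<bullet> (P *\<^sub>v d) = 0" if i: "i < k" for i
    proof -
      have vi: "v i \<in> carrier_vec n" using v(1)[OF i] WC by auto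
      have "V\<^sup>T *\<^sub>v (P *\<^sub>v r) = (V\<^sup>T * (P * V)) *\<^sub>v (V\<^sup>T *\<^sub>v (P *\<^sub>v w))"
        unfolding r_def using Vc Pc wc
        by (simp add: assoc_mult_mat_vec[of _ k n _ k] assoc_mult_mat_vec[of _ n n _ k])
      also have "\<dots> = V\<^sup>T *\<^sub>v (P *\<^sub>v w)"
        unfolding VV using Vc Pc wc by (intro one_mult_mat_vec) auto
      finally have "(V\<^sup>T *\<^sub>v (P *\<^sub>v r)) $ i = (V\<^sup>T *\<^sub>v (P *\<^sub>v w)) $ i" by simp
      then have "v i \<bullet> (P *\<^sub>v r) = v i \<bullet> (P *\<^sub>v w)"
        unfolding V_def using scalar_prod_mat_of_col_fun[of k v n, OF WC[OF v(1)] _ i] Pc rc wc by auto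
      then show ?thesis unfolding d_def using Pc rc wc vi
        by (simp add: mult_minus_distrib_mat_vec[OF Pc] scalar_prod_minus_distrib[of _ n])
    qed
    define e where "e = (1 / sqrt s) \<cdot>\<^sub>v d"
    have ec: "e \<in> carrier_vec n" using dc by (simp add: e_def)
    have eW: "e \<in> W" using dW W by (simp add: e_def subspace_vec_def)
    have Pe: "P *\<^sub>v e = (1 / sqrt s) \<cdot>\<^sub>v (P *\<^sub>v d)" unfolding e_def by (rule mult_mat_vec[OF Pc dc])
    have ve: "v i \<bullet> (P *\<^sub>v e) = 0" if "i < k" for i
      using orth[OF that] WC[OF v(1)[OF that]] Pc dc unfolding Pe by simp
    have ev: "e \<bullet> (P *\<^sub>v v i) = 0" if "i < k" for i
      using ve[OF that] pos_def_mat_sym[OF P ec WC[OF v(1)[OF that]]] by simp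
    have ee: "e \<bullet> (P *\<^sub>v e) = 1" unfolding Pe using dc Pc s
      by (simp add: e_def s_def[symmetric] field_simps)
    have "good (Suc k)" unfolding good_def
      by (rule exI[of _ "v(k := e)"]) (use v ve ev ee eW in \<open>auto simp: less_Suc_eq\<close>)
    from max[OF this] show False by simp
  qed
  then show ?thesis using that[of k V] bound[OF k] Vc VV range by simp
qed

text \<open>
  A basis with as many vectors as the dimension is a square, hence two-sided, inverse.
\<close>

lemma orthonormal_basis_full:
  fixes P V :: "real mat"
  assumes P: "P \<in> carrier_mat n n" and V: "V \<in> carrier_mat n n" "V\<^sup>T * (P * V) = 1\<^sub>m n"
    and "\<And>c. c \<in> carrier_vec n \<Longrightarrow> V *\<^sub>v c \<in> W" and x: "x \<in> carrier_vec n"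
  shows "x \<in> W"
proof -
  have c: "V\<^sup>T * P \<in> carrier_mat n n" using P V by simp
  have "(V\<^sup>T * P) * V = 1\<^sub>m n" using P V by (simp add: assoc_mult_mat[of _ n n _ n _ n])
  then have "V * (V\<^sup>T * P) = 1\<^sub>m n" using mat_mult_left_right_inverse[OF c V(1)] by simp
  then have "(V * (V\<^sup>T * P)) *\<^sub>v x = x" using x by (simp only: one_mult_mat_vec)
  then have "V *\<^sub>v ((V\<^sup>T * P) *\<^sub>v x) = x"
    by (simp only: assoc_mult_mat_vec[OF V(1) c x])
  then show ?thesis using assms(4)[of "(V\<^sup>T * P) *\<^sub>v x"] c x by simp
qed

section \<open>Morphisms, restriction and quotient of switched systems\<close>

text \<open>
  The matrix maps trajectories of the first system to trajectories of the second one with the same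
  output. Injective morphisms are restrictions to invariant subspaces, surjective ones are
  quotients by unobservable subspaces.
\<close>

definition lss_morphism :: "nat \<Rightarrow> real mat \<Rightarrow> lss \<Rightarrow> lss \<Rightarrow> bool" where
  "lss_morphism D M S' S \<longleftrightarrow> M \<in> carrier_mat (lss_dim S) (lss_dim S') \<and>
     (\<forall>q\<in>modes D. lss_A S q * M = M * lss_A S' q \<and> lss_B S q = M * lss_B S' q \<and>
        lss_C S' q = lss_C S q * M)"

lemma lss_morphismD:
  assumes S: "is_lss D m p S" and S': "is_lss D m p S'" and M: "lss_morphism D M S' S" and q: "q \<in> modes D"
    and x: "x \<in> carrier_vec (lss_dim S')" and u: "u \<in> carrier_vec m"
  shows "lss_A S q *\<^sub>v (M *\<^sub>v x) + lss_B S q *\<^sub>v u = M *\<^sub>v (lss_A S' q *\<^sub>v x + lss_B S' q *\<^sub>v u)"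
    and "lss_C S q *\<^sub>v (M *\<^sub>v x) = lss_C S' q *\<^sub>v x"
proof -
  define n n' where "n = lss_dim S" and "n' = lss_dim S'"
  have c: "lss_A S q \<in> carrier_mat n n" "lss_B S q \<in> carrier_mat n m" "lss_C S q \<in> carrier_mat p n"
    and c': "lss_A S' q \<in> carrier_mat n' n'" "lss_B S' q \<in> carrier_mat n' m" "lss_C S' q \<in> carrier_mat p n'"
    using S S' q by (auto simp: is_lss_def n_def n'_def)
  have Mc: "M \<in> carrier_mat n n'" and xc: "x \<in> carrier_vec n'" using M x by (auto simp: lss_morphism_def n_def n'_def)
  have e: "lss_A S q * M = M * lss_A S' q" "lss_B S q = M * lss_B S' q" "lss_C S' q = lss_C S q * M"
    using M q by (auto simp: lss_morphism_def)
  have "lss_A S q *\<^sub>v (M *\<^sub>v x) = (M * lss_A S' q) *\<^sub>v x"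
    using assoc_mult_mat_vec[OF c(1) Mc xc] e(1) by simp
  also have "\<dots> = M *\<^sub>v (lss_A S' q *\<^sub>v x)" by (rule assoc_mult_mat_vec[OF Mc c'(1) xc])
  finally have A: "lss_A S q *\<^sub>v (M *\<^sub>v x) = M *\<^sub>v (lss_A S' q *\<^sub>v x)" .
  have B: "lss_B S q *\<^sub>v u = M *\<^sub>v (lss_B S' q *\<^sub>v u)"
    unfolding e(2) by (rule assoc_mult_mat_vec[OF Mc c'(2) u])
  show "lss_A S q *\<^sub>v (M *\<^sub>v x) + lss_B S q *\<^sub>v u = M *\<^sub>v (lss_A S' q *\<^sub>v x + lss_B S' q *\<^sub>v u)"
    unfolding A B by (rule mult_add_distrib_mat_vec[OF Mc, symmetric]) (use c' xc u in auto)
  show "lss_C S q *\<^sub>v (M *\<^sub>v x) = lss_C S' q *\<^sub>v x"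
    unfolding e(3) by (rule assoc_mult_mat_vec[OF c(3) Mc xc, symmetric])
qed

text \<open>
  The states of the smaller system are coordinates with respect to an orthonormal basis of the
  invariant subspace. A basis of full size would span the vector that was assumed to lie
  outside.
\<close>

lemma restriction_to_invariant_subspace:
  assumes S: "is_lss D m p S" and U: "subspace_vec (lss_dim S) U"
    and A: "\<And>q z. q \<in> modes D \<Longrightarrow> z \<in> U \<Longrightarrow> lss_A S q *\<^sub>v z \<in> U"
    and B: "\<And>q v. q \<in> modes D \<Longrightarrow> v \<in> carrier_vec m \<Longrightarrow> lss_B S q *\<^sub>v v \<in> U"
    and x: "x \<in> carrier_vec (lss_dim S)" "x \<notin> U"
  obtains S' M where "is_lss D m p S'" "lss_dim S' < lss_dim S" "lss_morphism D M S' S"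
proof -
  define n where "n = lss_dim S"
  have Sc: "lss_A S q \<in> carrier_mat n n" "lss_B S q \<in> carrier_mat n m" "lss_C S q \<in> carrier_mat p n"
    if "q \<in> modes D" for q using S that by (auto simp: is_lss_def n_def)
  obtain k V where k: "k \<le> n" and V: "V \<in> carrier_mat n k" and VV: "V\<^sup>T * (1\<^sub>m n * V) = 1\<^sub>m k"
    and range: "\<And>c. c \<in> carrier_vec k \<Longrightarrow> V *\<^sub>v c \<in> U"
    and proj: "\<And>w. w \<in> U \<Longrightarrow> V *\<^sub>v (V\<^sup>T *\<^sub>v (1\<^sub>m n *\<^sub>v w)) = w"
    using orthonormal_basis[OF pos_def_mat_one U[folded n_def]] by metis
  have UC: "\<And>w. w \<in> U \<Longrightarrow> w \<in> carrier_vec n" using U by (auto simp: subspace_vec_def n_def)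
  have proj': "V *\<^sub>v (V\<^sup>T *\<^sub>v w) = w" if "w \<in> U" for w using proj[OF that] UC[OF that] by simp
  have "k \<noteq> n"
  proof
    assume "k = n"
    then have "x \<in> U" using orthonormal_basis_full[of "1\<^sub>m n" n V U x] V VV range x(1) by (auto simp: n_def)
    then show False using x by simp
  qed
  define S' where "S' = \<lparr>lss_dim = k, lss_A = \<lambda>q. V\<^sup>T * (lss_A S q * V), lss_B = \<lambda>q. V\<^sup>T * lss_B S q,
     lss_C = \<lambda>q. lss_C S q * V\<rparr>"
  have "is_lss D m p S'" using Sc V by (auto simp: is_lss_def S'_def intro!: mult_carrier_mat[of _ p n])
  moreover have "lss_dim S' < lss_dim S" using k \<open>k \<noteq> n\<close> by (simp add: S'_def n_def)
  moreover have "lss_morphism D V S' S" unfolding lss_morphism_def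
  proof (intro conjI ballI)
    show "V \<in> carrier_mat (lss_dim S) (lss_dim S')" using V by (simp add: S'_def n_def)
    fix q assume q: "q \<in> modes D"
    note c = Sc[OF q]
    show "lss_A S q * V = V * lss_A S' q"
    proof (rule mat_eq_by_mult_vec[of _ n k])
      fix y :: "real vec" assume y: "y \<in> carrier_vec k"
      have "(V * lss_A S' q) *\<^sub>v y = V *\<^sub>v (V\<^sup>T *\<^sub>v (lss_A S q *\<^sub>v (V *\<^sub>v y)))"
        using c V y by (simp add: S'_def assoc_mult_mat_vec[of _ n k _ k] assoc_mult_mat_vec[of _ k n _ k] assoc_mult_mat_vec[of _ n n _ k])
      also have "\<dots> = lss_A S q *\<^sub>v (V *\<^sub>v y)" using proj' A[OF q range[OF y]] by simp
      finally show "(lss_A S q * V) *\<^sub>v y = (V * lss_A S' q) *\<^sub>v y"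
        using c V y by (simp add: assoc_mult_mat_vec[of _ n n _ k])
    qed (use c V in \<open>auto simp: S'_def\<close>)
    show "lss_B S q = V * lss_B S' q"
    proof (rule mat_eq_by_mult_vec[of _ n m])
      fix y :: "real vec" assume y: "y \<in> carrier_vec m"
      have "(V * lss_B S' q) *\<^sub>v y = V *\<^sub>v (V\<^sup>T *\<^sub>v (lss_B S q *\<^sub>v y))"
        using c V y by (simp add: S'_def assoc_mult_mat_vec[of _ n k _ m] assoc_mult_mat_vec[of _ k n _ m])
      also have "\<dots> = lss_B S q *\<^sub>v y" using proj' B[OF q y] by simp
      finally show "lss_B S q *\<^sub>v y = (V * lss_B S' q) *\<^sub>v y" by simp
    qed (use c V in \<open>auto simp: S'_def\<close>)
    show "lss_C S' q = lss_C S q * V" by (simp add: S'_def)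
  qed
  ultimately show ?thesis using that by blast
qed

text \<open>
  The quotient is realized on the orthogonal complement of the unobservable subspace: the
  transpose of a basis of the complement is the quotient map and the basis itself is a section of
  it. A matrix that vanishes on the subspace factors through this projection, which gives both the
  intertwining of the state matrices and the output matrix.
\<close>

lemma quotient_by_unobservable_subspace:
  assumes S: "is_lss D m p S" and U: "subspace_vec (lss_dim S) U"
    and A: "\<And>q z. q \<in> modes D \<Longrightarrow> z \<in> U \<Longrightarrow> lss_A S q *\<^sub>v z \<in> U"
    and C: "\<And>q z. q \<in> modes D \<Longrightarrow> z \<in> U \<Longrightarrow> lss_C S q *\<^sub>v z = 0\<^sub>v p"
    and x: "x \<in> U" "x \<noteq> 0\<^sub>v (lss_dim S)"
  obtains S' M where "is_lss D m p S'" "lss_dim S' < lss_dim S" "lss_morphism D M S S'"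
proof -
  define n where "n = lss_dim S"
  have Sc: "lss_A S q \<in> carrier_mat n n" "lss_B S q \<in> carrier_mat n m" "lss_C S q \<in> carrier_mat p n"
    if "q \<in> modes D" for q using S that by (auto simp: is_lss_def n_def)
  have UC: "\<And>w. w \<in> U \<Longrightarrow> w \<in> carrier_vec n" using U by (auto simp: subspace_vec_def n_def)
  obtain l V where V: "V \<in> carrier_mat n l"
    and range: "\<And>c. c \<in> carrier_vec l \<Longrightarrow> V *\<^sub>v c \<in> U"
    and proj: "\<And>w. w \<in> U \<Longrightarrow> V *\<^sub>v (V\<^sup>T *\<^sub>v (1\<^sub>m n *\<^sub>v w)) = w"
    using orthonormal_basis[OF pos_def_mat_one U[folded n_def]] by metis
  define U' where "U' = {y \<in> carrier_vec n. \<forall>u\<in>U. u \<bullet> y = 0}"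
  have U': "subspace_vec n U'"
    using UC by (auto simp: subspace_vec_def U'_def scalar_prod_add_distrib[of _ n])
  obtain k T where k: "k \<le> n" and T: "T \<in> carrier_mat n k" and TT: "T\<^sup>T * (1\<^sub>m n * T) = 1\<^sub>m k"
    and range': "\<And>c. c \<in> carrier_vec k \<Longrightarrow> T *\<^sub>v c \<in> U'"
    and proj': "\<And>w. w \<in> U' \<Longrightarrow> T *\<^sub>v (T\<^sup>T *\<^sub>v (1\<^sub>m n *\<^sub>v w)) = w"
    using orthonormal_basis[OF pos_def_mat_one U'] by metis
  have "k \<noteq> n"
  proof
    assume "k = n"
    then have "x \<in> U'" using orthonormal_basis_full[of "1\<^sub>m n" n T U' x] T TT range' UC x(1) by auto
    then have "x \<bullet> x = 0" using x by (simp add: U'_def)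
    then show False using pos_def_mat_one[of n] UC[OF x(1)] x(2) by (auto simp: pos_def_mat_def n_def)
  qed
  have TU: "T\<^sup>T *\<^sub>v u = 0\<^sub>v k" if u: "u \<in> U" for u
  proof (rule eq_vecI)
    fix i assume "i < dim_vec (0\<^sub>v k :: real vec)"
    then have i: "i < k" by simp
    have "col T i = T *\<^sub>v unit_vec k i" using mult_unit_vec_eq_col[OF T i] by simp
    then have "col T i \<in> U'" using range'[of "unit_vec k i"] by simp
    then have "u \<bullet> col T i = 0" using u by (simp add: U'_def)
    then have "col T i \<bullet> u = 0" using comm_scalar_prod[of u n "col T i"] UC[OF u] T by auto
    then show "(T\<^sup>T *\<^sub>v u) $ i = 0\<^sub>v k $ i" using i T by simp
  qed (use T in simp)
  \<comment> \<open>the difference is the orthogonal projection of \<open>y\<close> onto \<open>U\<close>\<close>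
  have diff: "y - T *\<^sub>v (T\<^sup>T *\<^sub>v y) \<in> U" if y: "y \<in> carrier_vec n" for y
  proof -
    define r where "r = V *\<^sub>v (V\<^sup>T *\<^sub>v y)"
    have rU: "r \<in> U" unfolding r_def using V y by (intro range) auto
    have rc: "r \<in> carrier_vec n" using rU UC by auto
    have "u \<bullet> (y - r) = 0" if u: "u \<in> U" for u
    proof -
      have uc: "u \<in> carrier_vec n" using u UC by auto
      have "u \<bullet> r = (V\<^sup>T *\<^sub>v u) \<bullet> (V\<^sup>T *\<^sub>v y)"
        unfolding r_def using transpose_vec_mult_scalar[OF V, of "V\<^sup>T *\<^sub>v y" u] V y uc by simp
      also have "\<dots> = (V *\<^sub>v (V\<^sup>T *\<^sub>v u)) \<bullet> y"
        using transpose_vec_mult_scalar[of "V\<^sup>T" l n y "V\<^sup>T *\<^sub>v u"] V y uc by simp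
      also have "\<dots> = u \<bullet> y" using proj[OF u] uc by simp
      finally show ?thesis using uc y rc by (simp add: scalar_prod_minus_distrib[of _ n])
    qed
    then have "y - r \<in> U'" using y rc by (simp add: U'_def)
    then have "T *\<^sub>v (T\<^sup>T *\<^sub>v (y - r)) = y - r" using proj'[of "y - r"] y rc by simp
    moreover have "T\<^sup>T *\<^sub>v (y - r) = T\<^sup>T *\<^sub>v y"
      using mult_minus_distrib_mat_vec[of "T\<^sup>T" k n y r] TU[OF rU] T y rc by simp
    ultimately have "y - T *\<^sub>v (T\<^sup>T *\<^sub>v y) = y - (y - r)" by simp
    also have "\<dots> = r" using y rc by auto
    finally show ?thesis using rU by simp
  qed
  have factor: "M *\<^sub>v y = M *\<^sub>v (T *\<^sub>v (T\<^sup>T *\<^sub>v y))"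
    if M: "M \<in> carrier_mat r n" and y: "y \<in> carrier_vec n" and "\<And>u. u \<in> U \<Longrightarrow> M *\<^sub>v u = 0\<^sub>v r" for M y r
  proof -
    have c: "T *\<^sub>v (T\<^sup>T *\<^sub>v y) \<in> carrier_vec n" using T y by auto
    have "M *\<^sub>v y - M *\<^sub>v (T *\<^sub>v (T\<^sup>T *\<^sub>v y)) = 0\<^sub>v r"
      using that(3)[OF diff[OF y]] mult_minus_distrib_mat_vec[OF M y c] by simp
    then have "(M *\<^sub>v y) $ i = (M *\<^sub>v (T *\<^sub>v (T\<^sup>T *\<^sub>v y))) $ i" if "i < r" for i
      using that M c y
      by (metis index_minus_vec(1) index_zero_vec(1) carrier_matD(1) dim_mult_mat_vec right_minus_eq)
    then show ?thesis using M by (intro eq_vecI) auto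
  qed
  define S' where "S' = \<lparr>lss_dim = k, lss_A = \<lambda>q. T\<^sup>T * (lss_A S q * T), lss_B = \<lambda>q. T\<^sup>T * lss_B S q,
     lss_C = \<lambda>q. lss_C S q * T\<rparr>"
  have "is_lss D m p S'" using Sc T by (auto simp: is_lss_def S'_def intro!: mult_carrier_mat[of _ p n])
  moreover have "lss_dim S' < lss_dim S" using k \<open>k \<noteq> n\<close> by (simp add: S'_def n_def)
  moreover have "lss_morphism D T\<^sup>T S S'" unfolding lss_morphism_def
  proof (intro conjI ballI)
    show "T\<^sup>T \<in> carrier_mat (lss_dim S') (lss_dim S)" using T by (simp add: S'_def n_def)
    fix q assume q: "q \<in> modes D"
    note c = Sc[OF q]
    have "T\<^sup>T * lss_A S q = (T\<^sup>T * (lss_A S q * T)) * T\<^sup>T"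
    proof (rule mat_eq_by_mult_vec[of _ k n])
      fix y :: "real vec" assume y: "y \<in> carrier_vec n"
      have "(T\<^sup>T * lss_A S q) *\<^sub>v y = (T\<^sup>T * lss_A S q) *\<^sub>v (T *\<^sub>v (T\<^sup>T *\<^sub>v y))"
        using c T y TU A[OF q] UC by (intro factor) (auto simp: assoc_mult_mat_vec[of _ k n _ n])
      then show "(T\<^sup>T * lss_A S q) *\<^sub>v y = ((T\<^sup>T * (lss_A S q * T)) * T\<^sup>T) *\<^sub>v y"
        using c T y by (simp add: assoc_mult_mat_vec[of _ k n _ n] assoc_mult_mat_vec[of _ k n _ k]
            assoc_mult_mat_vec[of _ k k _ n] assoc_mult_mat_vec[of _ n n _ k])
    qed (use c T in auto)
    then show "lss_A S' q * T\<^sup>T = T\<^sup>T * lss_A S q" by (simp add: S'_def)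
    show "lss_B S' q = T\<^sup>T * lss_B S q" by (simp add: S'_def)
    have "lss_C S q = (lss_C S q * T) * T\<^sup>T"
    proof (rule mat_eq_by_mult_vec[of _ p n])
      fix y :: "real vec" assume y: "y \<in> carrier_vec n"
      have "lss_C S q *\<^sub>v y = lss_C S q *\<^sub>v (T *\<^sub>v (T\<^sup>T *\<^sub>v y))"
        using c T y C[OF q] by (intro factor) auto
      then show "lss_C S q *\<^sub>v y = ((lss_C S q * T) * T\<^sup>T) *\<^sub>v y"
        using assoc_mult_mat_vec[of "lss_C S q * T" p k "T\<^sup>T" n y] assoc_mult_mat_vec[of "lss_C S q" p n T k "T\<^sup>T *\<^sub>v y"]
          c T y by (simp only: mult_carrier_mat[of _ p n] transpose_carrier_mat mult_mat_vec_carrier[of _ k n])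
    qed (use c T in auto)
    then show "lss_C S q = lss_C S' q * T\<^sup>T" by (simp add: S'_def)
  qed
  ultimately show ?thesis using that by blast
qed

section \<open>The matrix inequalities as dissipation inequalities\<close>

lemma neg_def_four_block_iff:
  assumes F: "F11 \<in> carrier_mat n n" "F12 \<in> carrier_mat n m" "F21 \<in> carrier_mat m n" "F22 \<in> carrier_mat m m"
    and sym: "F11\<^sup>T = F11" "F12\<^sup>T = F21" "F22\<^sup>T = F22"
  shows "neg_def_mat (n + m) (four_block_mat F11 F12 F21 F22) \<longleftrightarrow>
    (\<forall>x\<in>carrier_vec n. \<forall>u\<in>carrier_vec m. x \<noteq> 0\<^sub>v n \<or> u \<noteq> 0\<^sub>v m \<longrightarrow>
       x \<bullet> (F11 *\<^sub>v x) + 2 * (x \<bullet> (F12 *\<^sub>v u)) + u \<bullet> (F22 *\<^sub>v u) < 0)"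
proof -
  let ?F = "four_block_mat F11 F12 F21 F22"
  have "F21\<^sup>T = F12" using sym(2) transpose_transpose by blast
  then have Fs: "?F\<^sup>T = ?F" using transpose_four_block_mat[OF F] sym by simp
  have quad: "(x @\<^sub>v u) \<bullet> (?F *\<^sub>v (x @\<^sub>v u)) =
      x \<bullet> (F11 *\<^sub>v x) + 2 * (x \<bullet> (F12 *\<^sub>v u)) + u \<bullet> (F22 *\<^sub>v u)"
    if xu: "x \<in> carrier_vec n" "u \<in> carrier_vec m" for x u :: "real vec"
  proof -
    have "u \<bullet> (F21 *\<^sub>v x) = (F12\<^sup>T *\<^sub>v x) \<bullet> u"
      unfolding sym(2) using F xu by (intro comm_scalar_prod[of _ m]) auto
    also have "\<dots> = x \<bullet> (F12 *\<^sub>v u)" by (rule transpose_vec_mult_scalar[OF F(2) xu(2,1)])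
    finally have cross: "u \<bullet> (F21 *\<^sub>v x) = x \<bullet> (F12 *\<^sub>v u)" .
    have "(x @\<^sub>v u) \<bullet> (?F *\<^sub>v (x @\<^sub>v u)) =
        x \<bullet> (F11 *\<^sub>v x + F12 *\<^sub>v u) + u \<bullet> (F21 *\<^sub>v x + F22 *\<^sub>v u)"
      unfolding four_block_mat_mult_vec[OF F xu] using F xu by (intro scalar_prod_append[of _ n _ m]) auto
    then show ?thesis using F xu cross
      by (simp add: scalar_prod_add_distrib[of _ n] scalar_prod_add_distrib[of _ m])
  qed
  have app: "x @\<^sub>v u = 0\<^sub>v (n + m) \<longleftrightarrow> x = 0\<^sub>v n \<and> u = 0\<^sub>v m"
    if xu: "x \<in> carrier_vec n" "u \<in> carrier_vec m" for x u :: "real vec"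
  proof -
    have "(0\<^sub>v (n + m) :: real vec) = 0\<^sub>v n @\<^sub>v 0\<^sub>v m" by (intro eq_vecI) auto
    then show ?thesis using append_vec_eq[OF xu(1), of "0\<^sub>v n"] by simp
  qed
  have "neg_def_mat (n + m) ?F \<longleftrightarrow>
      (\<forall>v\<in>carrier_vec (n + m). v \<noteq> 0\<^sub>v (n + m) \<longrightarrow> v \<bullet> (?F *\<^sub>v v) < 0)"
    using Fs F by (simp add: neg_def_mat_def)
  also have "\<dots> \<longleftrightarrow> (\<forall>x\<in>carrier_vec n. \<forall>u\<in>carrier_vec m. x @\<^sub>v u \<noteq> 0\<^sub>v (n + m) \<longrightarrow>
      (x @\<^sub>v u) \<bullet> (?F *\<^sub>v (x @\<^sub>v u)) < 0)" by (rule all_vec_append)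
  finally show ?thesis using quad app by auto
qed

lemma scalar_prod_transpose_mult:
  fixes A :: "real mat"
  assumes "A \<in> carrier_mat r c" "x \<in> carrier_vec c" "y \<in> carrier_vec r"
  shows "x \<bullet> (A\<^sup>T *\<^sub>v y) = (A *\<^sub>v x) \<bullet> y"
  using transpose_vec_mult_scalar[OF assms] comm_scalar_prod[of "A\<^sup>T *\<^sub>v y" c x]
    comm_scalar_prod[of "A *\<^sub>v x" r y] assms by auto

lemma smult_one_mat_mult_vec:
  fixes c :: real
  assumes "u \<in> carrier_vec m"
  shows "(c \<cdot>\<^sub>m 1\<^sub>m m) *\<^sub>v u = c \<cdot>\<^sub>v u"
  using assms by (intro eq_vecI) auto

text \<open>
  With the storage function \<open>x \<bullet> (P *\<^sub>v x)\<close>, this is its derivative along the system minus the supply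
  \<open>\<gamma>^2 * |u|^2 - |y|^2\<close>.
\<close>

definition ct_dissipation :: "lss \<Rightarrow> real \<Rightarrow> real mat \<Rightarrow> nat \<Rightarrow> real vec \<Rightarrow> real vec \<Rightarrow> real" where
  "ct_dissipation S \<gamma> P q x u = 2 * (x \<bullet> (P *\<^sub>v (lss_A S q *\<^sub>v x + lss_B S q *\<^sub>v u)))
     + (lss_C S q *\<^sub>v x) \<bullet> (lss_C S q *\<^sub>v x) - \<gamma>\<^sup>2 * (u \<bullet> u)"

text \<open>
  The discrete-time counterpart, with the increment of the storage function over one step.
\<close>

definition dt_dissipation :: "lss \<Rightarrow> real \<Rightarrow> real mat \<Rightarrow> nat \<Rightarrow> real vec \<Rightarrow> real vec \<Rightarrow> real" where
  "dt_dissipation S \<gamma> P q x u =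
     (lss_A S q *\<^sub>v x + lss_B S q *\<^sub>v u) \<bullet> (P *\<^sub>v (lss_A S q *\<^sub>v x + lss_B S q *\<^sub>v u)) - x \<bullet> (P *\<^sub>v x)
     + (lss_C S q *\<^sub>v x) \<bullet> (lss_C S q *\<^sub>v x) - \<gamma>\<^sup>2 * (u \<bullet> u)"

text \<open>
  The block matrix is the matrix of the quadratic form on pairs of state and input, so its
  negative definiteness is strict dissipation. In this form the inequality can be evaluated along
  related states without block matrix algebra.
\<close>

lemma ct_G_iff_dissipation:
  assumes S: "is_lss D m p S"
  shows "P \<in> ct_G D m \<gamma> S \<longleftrightarrow> pos_def_mat (lss_dim S) P \<and>
    (\<forall>q\<in>modes D. \<forall>x\<in>carrier_vec (lss_dim S). \<forall>u\<in>carrier_vec m.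
       x \<noteq> 0\<^sub>v (lss_dim S) \<or> u \<noteq> 0\<^sub>v m \<longrightarrow> ct_dissipation S \<gamma> P q x u < 0)"
proof (cases "pos_def_mat (lss_dim S) P")
  case False
  then show ?thesis by (simp add: ct_G_def)
next
  case True
  define n where "n = lss_dim S"
  have P: "P \<in> carrier_mat n n" "P\<^sup>T = P" using True by (auto simp: pos_def_mat_def n_def)
  have "neg_def_mat (n + m) (four_block_mat
          ((lss_A S q)\<^sup>T * P + P * lss_A S q + (lss_C S q)\<^sup>T * lss_C S q) (P * lss_B S q)
          ((lss_B S q)\<^sup>T * P) ((- (\<gamma>\<^sup>2)) \<cdot>\<^sub>m 1\<^sub>m m)) \<longleftrightarrow>
      (\<forall>x\<in>carrier_vec n. \<forall>u\<in>carrier_vec m. x \<noteq> 0\<^sub>v n \<or> u \<noteq> 0\<^sub>v m \<longrightarrow> ct_dissipation S \<gamma> P q x u < 0)"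
    (is "neg_def_mat _ (four_block_mat ?F11 ?F12 ?F21 ?F22) \<longleftrightarrow> _") if q: "q \<in> modes D" for q
  proof -
    define A B C where "A = lss_A S q" and "B = lss_B S q" and "C = lss_C S q"
    have c: "A \<in> carrier_mat n n" "B \<in> carrier_mat n m" "C \<in> carrier_mat p n"
      using S q by (auto simp: is_lss_def n_def A_def B_def C_def)
    have "x \<bullet> (?F11 *\<^sub>v x) + 2 * (x \<bullet> (?F12 *\<^sub>v u)) + u \<bullet> (?F22 *\<^sub>v u) = ct_dissipation S \<gamma> P q x u"
      if xu: "x \<in> carrier_vec n" "u \<in> carrier_vec m" for x u :: "real vec"
    proof -
      have "x \<bullet> ((A\<^sup>T * P) *\<^sub>v x) = (A *\<^sub>v x) \<bullet> (P *\<^sub>v x)"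
        using scalar_prod_transpose_mult[OF c(1) xu(1), of "P *\<^sub>v x"] assoc_mult_mat_vec[of "A\<^sup>T" n n P n x] P c xu by simp
      also have "\<dots> = x \<bullet> (P *\<^sub>v (A *\<^sub>v x))" using pos_def_mat_sym[OF True] c xu by (simp add: n_def)
      finally have 1: "x \<bullet> ((A\<^sup>T * P) *\<^sub>v x) = x \<bullet> (P *\<^sub>v (A *\<^sub>v x))" .
      have 2: "x \<bullet> ((C\<^sup>T * C) *\<^sub>v x) = (C *\<^sub>v x) \<bullet> (C *\<^sub>v x)"
        using scalar_prod_transpose_mult[OF c(3) xu(1), of "C *\<^sub>v x"] assoc_mult_mat_vec[of "C\<^sup>T" n p C n x] c xu by simp
      have 3: "x \<bullet> ((A\<^sup>T * P + P * A + C\<^sup>T * C) *\<^sub>v x) = 2 * (x \<bullet> (P *\<^sub>v (A *\<^sub>v x))) + (C *\<^sub>v x) \<bullet> (C *\<^sub>v x)"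
      proof -
        have m: "A\<^sup>T * P \<in> carrier_mat n n" "P * A \<in> carrier_mat n n" "C\<^sup>T * C \<in> carrier_mat n n"
          using P c by auto
        have "(A\<^sup>T * P + P * A + C\<^sup>T * C) *\<^sub>v x = (A\<^sup>T * P) *\<^sub>v x + (P * A) *\<^sub>v x + (C\<^sup>T * C) *\<^sub>v x"
          using m xu by (simp only: add_mult_distrib_mat_vec[of _ n n] add_carrier_mat)
        then have "x \<bullet> ((A\<^sup>T * P + P * A + C\<^sup>T * C) *\<^sub>v x) =
            x \<bullet> ((A\<^sup>T * P) *\<^sub>v x) + x \<bullet> ((P * A) *\<^sub>v x) + x \<bullet> ((C\<^sup>T * C) *\<^sub>v x)"
          using m xu by (simp only: scalar_prod_add_distrib[of _ n] add_carrier_vec mult_mat_vec_carrier)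
        then show ?thesis using 1 2 assoc_mult_mat_vec[OF P(1) c(1) xu(1)] by (simp only:)
      qed
      have 4: "P *\<^sub>v (A *\<^sub>v x + B *\<^sub>v u) = P *\<^sub>v (A *\<^sub>v x) + P *\<^sub>v (B *\<^sub>v u)"
        using P c xu by (intro mult_add_distrib_mat_vec) auto
      have 5: "x \<bullet> (P *\<^sub>v (A *\<^sub>v x + B *\<^sub>v u)) = x \<bullet> (P *\<^sub>v (A *\<^sub>v x)) + x \<bullet> (P *\<^sub>v (B *\<^sub>v u))"
        unfolding 4 using P c xu by (intro scalar_prod_add_distrib[of _ n]) auto
      have 6: "x \<bullet> ((P * B) *\<^sub>v u) = x \<bullet> (P *\<^sub>v (B *\<^sub>v u))"
        using assoc_mult_mat_vec[OF P(1) c(2) xu(2)] by simp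
      have 7: "u \<bullet> (((- (\<gamma>\<^sup>2)) \<cdot>\<^sub>m 1\<^sub>m m) *\<^sub>v u) = - (\<gamma>\<^sup>2) * (u \<bullet> u)"
        using smult_one_mat_mult_vec[OF xu(2), of "- (\<gamma>\<^sup>2)"] xu(2) by simp
      show ?thesis unfolding ct_dissipation_def A_def[symmetric] B_def[symmetric] C_def[symmetric]
        unfolding 3 5 6 7 by simp
    qed
    note quad = this
    have cF: "?F11 \<in> carrier_mat n n" "?F12 \<in> carrier_mat n m" "?F21 \<in> carrier_mat m n" "?F22 \<in> carrier_mat m m"
      using c P by (auto simp: A_def B_def C_def)
    have "(A\<^sup>T * P)\<^sup>T = P * A" "(P * A)\<^sup>T = A\<^sup>T * P" "(C\<^sup>T * C)\<^sup>T = C\<^sup>T * C" "(P * B)\<^sup>T = B\<^sup>T * P"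
      using c P transpose_mult[of "A\<^sup>T" n n P n] transpose_mult[of P n n A n] transpose_mult[of P n n B m]
         transpose_mult[of "C\<^sup>T" n p C n] by auto
    then have sym: "?F11\<^sup>T = ?F11" "?F12\<^sup>T = ?F21" "?F22\<^sup>T = ?F22"
      unfolding A_def[symmetric] B_def[symmetric] C_def[symmetric] using c P
      by (auto simp: transpose_add[of _ n n] comm_add_mat[of "P * A" n n])
    show ?thesis unfolding neg_def_four_block_iff[OF cF sym] using quad by simp
  qed
  then show ?thesis using True by (simp add: ct_G_def Let_def n_def)
qed

lemma dt_G_iff_dissipation:
  assumes S: "is_lss D m p S"
  shows "P \<in> dt_G D m \<gamma> S \<longleftrightarrow> pos_def_mat (lss_dim S) P \<and>
    (\<forall>q\<in>modes D. \<forall>x\<in>carrier_vec (lss_dim S). \<forall>u\<in>carrier_vec m.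
       x \<noteq> 0\<^sub>v (lss_dim S) \<or> u \<noteq> 0\<^sub>v m \<longrightarrow> dt_dissipation S \<gamma> P q x u < 0)"
proof (cases "pos_def_mat (lss_dim S) P")
  case False
  then show ?thesis by (simp add: dt_G_def)
next
  case True
  define n where "n = lss_dim S"
  have P: "P \<in> carrier_mat n n" "P\<^sup>T = P" using True by (auto simp: pos_def_mat_def n_def)
  have "neg_def_mat (n + m) (four_block_mat
          ((lss_A S q)\<^sup>T * P * lss_A S q + (lss_C S q)\<^sup>T * lss_C S q - P) ((lss_A S q)\<^sup>T * P * lss_B S q)
          ((lss_B S q)\<^sup>T * P * lss_A S q) ((lss_B S q)\<^sup>T * P * lss_B S q - \<gamma>\<^sup>2 \<cdot>\<^sub>m 1\<^sub>m m)) \<longleftrightarrow>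
      (\<forall>x\<in>carrier_vec n. \<forall>u\<in>carrier_vec m. x \<noteq> 0\<^sub>v n \<or> u \<noteq> 0\<^sub>v m \<longrightarrow> dt_dissipation S \<gamma> P q x u < 0)"
    (is "neg_def_mat _ (four_block_mat ?F11 ?F12 ?F21 ?F22) \<longleftrightarrow> _") if q: "q \<in> modes D" for q
  proof -
    define A B C where "A = lss_A S q" and "B = lss_B S q" and "C = lss_C S q"
    have c: "A \<in> carrier_mat n n" "B \<in> carrier_mat n m" "C \<in> carrier_mat p n"
      using S q by (auto simp: is_lss_def n_def A_def B_def C_def)
    have congr: "y \<bullet> ((X\<^sup>T * P * Y) *\<^sub>v z) = (X *\<^sub>v y) \<bullet> (P *\<^sub>v (Y *\<^sub>v z))"
      if "X \<in> carrier_mat n k" "Y \<in> carrier_mat n l" "y \<in> carrier_vec k" "z \<in> carrier_vec l" for X Y y z k l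
      using that P assoc_mult_mat_vec[of "X\<^sup>T * P" k n Y l z] assoc_mult_mat_vec[of "X\<^sup>T" k n P n "Y *\<^sub>v z"]
        scalar_prod_transpose_mult[of X n k y "P *\<^sub>v (Y *\<^sub>v z)"] by auto
    have "x \<bullet> (?F11 *\<^sub>v x) + 2 * (x \<bullet> (?F12 *\<^sub>v u)) + u \<bullet> (?F22 *\<^sub>v u) = dt_dissipation S \<gamma> P q x u"
      if xu: "x \<in> carrier_vec n" "u \<in> carrier_vec m" for x u :: "real vec"
    proof -
      have AB: "A *\<^sub>v x \<in> carrier_vec n" "B *\<^sub>v u \<in> carrier_vec n" using c xu by auto
      have 1: "x \<bullet> ((A\<^sup>T * P * A + C\<^sup>T * C - P) *\<^sub>v x) =
          (A *\<^sub>v x) \<bullet> (P *\<^sub>v (A *\<^sub>v x)) + (C *\<^sub>v x) \<bullet> (C *\<^sub>v x) - x \<bullet> (P *\<^sub>v x)"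
      proof -
        have m: "A\<^sup>T * P * A \<in> carrier_mat n n" "C\<^sup>T * C \<in> carrier_mat n n" using P c by auto
        have "x \<bullet> ((C\<^sup>T * C) *\<^sub>v x) = (C *\<^sub>v x) \<bullet> (C *\<^sub>v x)"
          using scalar_prod_transpose_mult[OF c(3) xu(1), of "C *\<^sub>v x"] assoc_mult_mat_vec[of "C\<^sup>T" n p C n x] c xu by simp
        moreover have "(A\<^sup>T * P * A + C\<^sup>T * C - P) *\<^sub>v x = (A\<^sup>T * P * A) *\<^sub>v x + (C\<^sup>T * C) *\<^sub>v x - P *\<^sub>v x"
          using m xu P by (simp only: add_mult_distrib_mat_vec[of _ n n] minus_mult_distrib_mat_vec[of _ n n] add_carrier_mat)
        then have "x \<bullet> ((A\<^sup>T * P * A + C\<^sup>T * C - P) *\<^sub>v x) =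
            x \<bullet> ((A\<^sup>T * P * A) *\<^sub>v x) + x \<bullet> ((C\<^sup>T * C) *\<^sub>v x) - x \<bullet> (P *\<^sub>v x)"
          using m xu P by (simp only: scalar_prod_add_distrib[of _ n] scalar_prod_minus_distrib[of _ n] add_carrier_vec mult_mat_vec_carrier)
        ultimately show ?thesis using congr[OF c(1) c(1) xu(1) xu(1)] by simp
      qed
      have 2: "u \<bullet> ((B\<^sup>T * P * B - \<gamma>\<^sup>2 \<cdot>\<^sub>m 1\<^sub>m m) *\<^sub>v u) = (B *\<^sub>v u) \<bullet> (P *\<^sub>v (B *\<^sub>v u)) - \<gamma>\<^sup>2 * (u \<bullet> u)"
      proof -
        have m: "B\<^sup>T * P * B \<in> carrier_mat m m" "\<gamma>\<^sup>2 \<cdot>\<^sub>m 1\<^sub>m m \<in> carrier_mat m m" using P c by auto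
        have "(B\<^sup>T * P * B - \<gamma>\<^sup>2 \<cdot>\<^sub>m 1\<^sub>m m) *\<^sub>v u = (B\<^sup>T * P * B) *\<^sub>v u - \<gamma>\<^sup>2 \<cdot>\<^sub>v u"
          using minus_mult_distrib_mat_vec[OF m xu(2)] smult_one_mat_mult_vec[OF xu(2)] by simp
        then have "u \<bullet> ((B\<^sup>T * P * B - \<gamma>\<^sup>2 \<cdot>\<^sub>m 1\<^sub>m m) *\<^sub>v u) = u \<bullet> ((B\<^sup>T * P * B) *\<^sub>v u) - u \<bullet> (\<gamma>\<^sup>2 \<cdot>\<^sub>v u)"
          using scalar_prod_minus_distrib[of u m "(B\<^sup>T * P * B) *\<^sub>v u" "\<gamma>\<^sup>2 \<cdot>\<^sub>v u"] m xu
            mult_mat_vec_carrier[OF m(1) xu(2)] by simp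
        then show ?thesis using congr[OF c(2) c(2) xu(2) xu(2)] xu(2) by simp
      qed
      have 3: "x \<bullet> ((A\<^sup>T * P * B) *\<^sub>v u) = (A *\<^sub>v x) \<bullet> (P *\<^sub>v (B *\<^sub>v u))" by (rule congr[OF c(1,2) xu])
      have 4: "(A *\<^sub>v x + B *\<^sub>v u) \<bullet> (P *\<^sub>v (A *\<^sub>v x + B *\<^sub>v u)) =
          (A *\<^sub>v x) \<bullet> (P *\<^sub>v (A *\<^sub>v x)) + 2 * ((A *\<^sub>v x) \<bullet> (P *\<^sub>v (B *\<^sub>v u))) + (B *\<^sub>v u) \<bullet> (P *\<^sub>v (B *\<^sub>v u))"
        using AB P pos_def_mat_sym[OF True[folded n_def] AB]
        by (simp add: mult_add_distrib_mat_vec[of P n n] scalar_prod_add_distrib[of _ n] add_scalar_prod_distrib[of _ n])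
      show ?thesis unfolding dt_dissipation_def A_def[symmetric] B_def[symmetric] C_def[symmetric]
        unfolding 1 2 3 4 by simp
    qed
    note quad = this
    have cF: "?F11 \<in> carrier_mat n n" "?F12 \<in> carrier_mat n m" "?F21 \<in> carrier_mat m n" "?F22 \<in> carrier_mat m m"
      using c P by (auto simp: A_def B_def C_def)
    have congrT: "(X\<^sup>T * P * Y)\<^sup>T = Y\<^sup>T * P * X" if "X \<in> carrier_mat n k" "Y \<in> carrier_mat n l" for X Y k l
      using that P transpose_mult[of "X\<^sup>T * P" k n Y l] transpose_mult[of "X\<^sup>T" k n P n]
        assoc_mult_mat[of "Y\<^sup>T" l n P n X k] by auto
    have CT: "(C\<^sup>T * C)\<^sup>T = C\<^sup>T * C" using c transpose_mult[of "C\<^sup>T" n p C n] by auto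
    have minusT: "(X - Y)\<^sup>T = X\<^sup>T - Y\<^sup>T" if "X \<in> carrier_mat k k" "Y \<in> carrier_mat k k" for X Y :: "real mat" and k
      using that by (intro eq_matI) auto
    have "(\<gamma>\<^sup>2 \<cdot>\<^sub>m 1\<^sub>m m)\<^sup>T = \<gamma>\<^sup>2 \<cdot>\<^sub>m 1\<^sub>m m" by (intro eq_matI) auto
    then have sym: "?F11\<^sup>T = ?F11" "?F12\<^sup>T = ?F21" "?F22\<^sup>T = ?F22"
      unfolding A_def[symmetric] B_def[symmetric] C_def[symmetric]
      using c P CT congrT[OF c(1,1)] congrT[OF c(1,2)] congrT[OF c(2,2)]
        minusT[of "A\<^sup>T * P * A + C\<^sup>T * C" n P] minusT[of "B\<^sup>T * P * B" m "\<gamma>\<^sup>2 \<cdot>\<^sub>m 1\<^sub>m m"]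
        transpose_add[of "A\<^sup>T * P * A" n n "C\<^sup>T * C"] by auto
    show ?thesis unfolding neg_def_four_block_iff[OF cF sym] using quad by simp
  qed
  then show ?thesis using True by (simp add: dt_G_def Let_def n_def)
qed

section \<open>Transfer of the matrix inequalities along a relation\<close>

text \<open>
  The graph of a morphism is an instance. Relations are needed because the states of two equivalent
  systems that are reached by the same control determine each other only on the reachable part and
  up to unobservable states.
\<close>

definition simulation_relation :: "nat \<Rightarrow> nat \<Rightarrow> lss \<Rightarrow> lss \<Rightarrow> (real vec \<times> real vec) set \<Rightarrow> bool" where
  "simulation_relation D m S S' W \<longleftrightarrow> linear_relation (lss_dim S) (lss_dim S') W \<and>
     (\<forall>q\<in>modes D.
        (\<forall>x z. (x, z) \<in> W \<longrightarrow> (lss_A S q *\<^sub>v x, lss_A S' q *\<^sub>v z) \<in> W \<and> lss_C S q *\<^sub>v x = lss_C S' q *\<^sub>v z) \<and>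
        (\<forall>v\<in>carrier_vec m. (lss_B S q *\<^sub>v v, lss_B S' q *\<^sub>v v) \<in> W))"

text \<open>
  Among all states related to \<open>z\<close>, the section picks the one of least energy for \<open>P\<close>: an arbitrary
  linear choice is corrected by its orthogonal projection onto the states related to zero.
\<close>

lemma orthogonal_section:
  assumes W: "linear_relation n k W" and P: "pos_def_mat n P"
    and onto: "\<And>z. z \<in> carrier_vec k \<Longrightarrow> \<exists>x. (x, z) \<in> W"
  obtains L where "L \<in> carrier_mat n k" "\<And>z. z \<in> carrier_vec k \<Longrightarrow> (L *\<^sub>v z, z) \<in> W"
    "\<And>z x. z \<in> carrier_vec k \<Longrightarrow> (x, 0\<^sub>v k) \<in> W \<Longrightarrow> x \<bullet> (P *\<^sub>v (L *\<^sub>v z)) = 0"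
proof -
  have Pc: "P \<in> carrier_mat n n" using P by (simp add: pos_def_mat_def)
  have WC: "x \<in> carrier_vec n" "z \<in> carrier_vec k" if "(x, z) \<in> W" for x z
    using that W by (auto simp: linear_relation_def)
  \<comment> \<open>the freedom in choosing a state related to a given \<open>z\<close>\<close>
  define N where "N = {x. (x, 0\<^sub>v k) \<in> W}"
  have add0: "(0\<^sub>v k + 0\<^sub>v k :: real vec) = 0\<^sub>v k" "c \<cdot>\<^sub>v 0\<^sub>v k = (0\<^sub>v k :: real vec)" for c by auto
  have N: "subspace_vec n N" unfolding subspace_vec_def
  proof (intro conjI ballI allI)
    show "N \<subseteq> carrier_vec n" using WC by (auto simp: N_def)
    show "0\<^sub>v n \<in> N" using W by (simp add: N_def linear_relation_def)
    show "x + y \<in> N" if "x \<in> N" "y \<in> N" for x y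
    proof -
      have "(x + y, 0\<^sub>v k + 0\<^sub>v k) \<in> W" using W that unfolding linear_relation_def N_def by blast
      then show ?thesis by (simp add: N_def)
    qed
    show "c \<cdot>\<^sub>v x \<in> N" if "x \<in> N" for c x
    proof -
      have "(c \<cdot>\<^sub>v x, c \<cdot>\<^sub>v 0\<^sub>v k) \<in> W" using W that unfolding linear_relation_def N_def by blast
      then show ?thesis using add0(2)[of c] by (simp add: N_def)
    qed
  qed
  obtain l V where V: "V \<in> carrier_mat n l" and range: "\<And>c. c \<in> carrier_vec l \<Longrightarrow> V *\<^sub>v c \<in> N"
    and proj: "\<And>w. w \<in> N \<Longrightarrow> V *\<^sub>v (V\<^sup>T *\<^sub>v (P *\<^sub>v w)) = w"
    using orthonormal_basis[OF P N] by metis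
  obtain e where e: "\<And>j. j < k \<Longrightarrow> (e j, unit_vec k j) \<in> W" using onto[OF unit_vec_carrier] by metis
  define L0 where "L0 = mat_of_col_fun n k e"
  have L0: "(L0 *\<^sub>v z, z) \<in> W" if z: "z \<in> carrier_vec k" for z
  proof -
    have "z = vec k (\<lambda>i. \<Sum>j<k. z $ j * unit_vec k j $ i)"
      using z by (intro eq_vecI) (auto simp: if_distrib[of "(*) _"] cong: if_cong)
    moreover have "(vec n (\<lambda>i. \<Sum>j<k. z $ j * e j $ i), vec k (\<lambda>i. \<Sum>j<k. z $ j * unit_vec k j $ i)) \<in> W"
      using e by (intro linear_relation_sum[OF W]) auto
    ultimately show ?thesis unfolding L0_def using mat_of_col_fun_mult_vec[OF z, of n e] by simp
  qed
  have L0c: "L0 \<in> carrier_mat n k" by (simp add: L0_def)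
  define L where "L = L0 - V * (V\<^sup>T * (P * L0))"
  have Lc: "L \<in> carrier_mat n k" using L0c V Pc unfolding L_def
    by (intro minus_carrier_mat mult_carrier_mat[of _ n l] mult_carrier_mat[of _ l n] mult_carrier_mat[of _ n n]) auto
  have Lz: "L *\<^sub>v z = L0 *\<^sub>v z - V *\<^sub>v (V\<^sup>T *\<^sub>v (P *\<^sub>v (L0 *\<^sub>v z)))" if z: "z \<in> carrier_vec k" for z
  proof -
    have "(V * (V\<^sup>T * (P * L0))) *\<^sub>v z = V *\<^sub>v (V\<^sup>T *\<^sub>v (P *\<^sub>v (L0 *\<^sub>v z)))"
      using V Pc L0c z by (simp add: assoc_mult_mat_vec[of _ n l _ k] assoc_mult_mat_vec[of _ l n _ k]
          assoc_mult_mat_vec[of _ n n _ k])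
    then show ?thesis unfolding L_def
      using minus_mult_distrib_mat_vec[of L0 n k "V * (V\<^sup>T * (P * L0))" z] V Pc L0c z by simp
  qed
  show ?thesis
  proof (rule that[OF Lc])
    fix z :: "real vec" assume z: "z \<in> carrier_vec k"
    define y where "y = L0 *\<^sub>v z"
    have y: "(y, z) \<in> W" "y \<in> carrier_vec n" using L0[OF z] WC by (auto simp: y_def)
    define r where "r = V *\<^sub>v (V\<^sup>T *\<^sub>v (P *\<^sub>v y))"
    have rN: "r \<in> N" unfolding r_def using V Pc y by (intro range) auto
    then have r: "(r, 0\<^sub>v k) \<in> W" "r \<in> carrier_vec n" using WC by (auto simp: N_def)
    have L: "L *\<^sub>v z = y - r" using Lz[OF z] by (simp add: y_def r_def)
    show "(L *\<^sub>v z, z) \<in> W" using linear_relation_minus[OF W y(1) r(1)] z by (simp add: L)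
    fix x assume "(x, 0\<^sub>v k) \<in> W"
    then have x: "x \<in> N" "x \<in> carrier_vec n" using WC by (auto simp: N_def)
    have "x \<bullet> (P *\<^sub>v r) = (P *\<^sub>v x) \<bullet> r"
      using pos_def_mat_sym[OF P x(2) r(2)] comm_scalar_prod[of r n "P *\<^sub>v x"] Pc x r by auto
    also have "\<dots> = (V\<^sup>T *\<^sub>v (P *\<^sub>v x)) \<bullet> (V\<^sup>T *\<^sub>v (P *\<^sub>v y))"
      unfolding r_def using transpose_vec_mult_scalar[OF V, of "V\<^sup>T *\<^sub>v (P *\<^sub>v y)" "P *\<^sub>v x"] V Pc x y by simp
    also have "\<dots> = (V *\<^sub>v (V\<^sup>T *\<^sub>v (P *\<^sub>v x))) \<bullet> (P *\<^sub>v y)"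
      using scalar_prod_transpose_mult[OF V, of "V\<^sup>T *\<^sub>v (P *\<^sub>v x)" "P *\<^sub>v y"] V Pc x y by simp
    also have "\<dots> = x \<bullet> (P *\<^sub>v y)" using proj[OF x(1)] by simp
    finally show "x \<bullet> (P *\<^sub>v (L *\<^sub>v z)) = 0" unfolding L
      using Pc x y r by (simp add: mult_minus_distrib_mat_vec[OF Pc] scalar_prod_minus_distrib[of _ n])
  qed
qed

lemma congruence_quadratic:
  fixes L P :: "real mat"
  assumes "L \<in> carrier_mat n k" "P \<in> carrier_mat n n" "y \<in> carrier_vec k" "z \<in> carrier_vec k"
  shows "y \<bullet> ((L\<^sup>T * (P * L)) *\<^sub>v z) = (L *\<^sub>v y) \<bullet> (P *\<^sub>v (L *\<^sub>v z))"
  using assms assoc_mult_mat_vec[of "L\<^sup>T" k n "P * L" k z] assoc_mult_mat_vec[of P n n L k z]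
    scalar_prod_transpose_mult[of L n k y "P *\<^sub>v (L *\<^sub>v z)"] by auto

lemma congruence_pos_def:
  assumes P: "pos_def_mat n P" and L: "L \<in> carrier_mat n k"
    and inj: "\<And>z. z \<in> carrier_vec k \<Longrightarrow> L *\<^sub>v z = 0\<^sub>v n \<Longrightarrow> z = 0\<^sub>v k"
  shows "pos_def_mat k (L\<^sup>T * (P * L))"
proof -
  have Pc: "P \<in> carrier_mat n n" "P\<^sup>T = P" using P by (auto simp: pos_def_mat_def)
  have "(L\<^sup>T * (P * L))\<^sup>T = L\<^sup>T * (P * L)"
    using L Pc transpose_mult[of "L\<^sup>T" k n "P * L" k] transpose_mult[of P n n L k]
      assoc_mult_mat[of "L\<^sup>T" k n P n L k] by auto
  moreover have "v \<bullet> ((L\<^sup>T * (P * L)) *\<^sub>v v) > 0" if v: "v \<in> carrier_vec k" "v \<noteq> 0\<^sub>v k" for v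
  proof -
    have "L *\<^sub>v v \<in> carrier_vec n" using L v by auto
    moreover have "L *\<^sub>v v \<noteq> 0\<^sub>v n" using inj v by auto
    ultimately show ?thesis using P unfolding congruence_quadratic[OF L Pc(1) v(1) v(1)] pos_def_mat_def by blast
  qed
  ultimately show ?thesis using L Pc by (simp add: pos_def_mat_def)
qed

text \<open>
  The storage function of the second system at \<open>z\<close> is the least energy of a state related to \<open>z\<close>.
  If \<open>x\<close> is the minimizer for \<open>z\<close>, the successor (or the velocity) of \<open>x\<close> is related to that of
  \<open>z\<close> and thus differs from the minimizer by a vector that is orthogonal to all minimizers. Dropping
  this vector does not change the mixed product that occurs in continuous time, and it does not
  increase the energy that occurs in discrete time. Outputs of related states agree. Hence the
  dissipation inequality passes from one system to the other. Strictness survives since a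
  minimizer vanishes only for \<open>z = 0\<close>, which is where the injectivity hypothesis enters.
\<close>

lemma G_transfer:
  assumes S: "is_lss D m p S" and S': "is_lss D m p S'" and W: "simulation_relation D m S S' W"
    and onto: "\<And>z. z \<in> carrier_vec (lss_dim S') \<Longrightarrow> \<exists>x. (x, z) \<in> W"
    and inj: "\<And>z. (0\<^sub>v (lss_dim S), z) \<in> W \<Longrightarrow> z = 0\<^sub>v (lss_dim S')"
  shows "ct_G D m \<gamma> S \<noteq> {} \<Longrightarrow> ct_G D m \<gamma> S' \<noteq> {}"
    and "dt_G D m \<gamma> S \<noteq> {} \<Longrightarrow> dt_G D m \<gamma> S' \<noteq> {}"
proof -
  define n k where "n = lss_dim S" and "k = lss_dim S'"
  have lin: "linear_relation n k W" using W by (simp add: simulation_relation_def n_def k_def)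
  have core: "\<exists>P'. pos_def_mat k P' \<and> (\<forall>q\<in>modes D. \<forall>z\<in>carrier_vec k. \<forall>u\<in>carrier_vec m.
      z \<noteq> 0\<^sub>v k \<or> u \<noteq> 0\<^sub>v m \<longrightarrow> (\<exists>x\<in>carrier_vec n. (x \<noteq> 0\<^sub>v n \<or> u \<noteq> 0\<^sub>v m) \<and>
        ct_dissipation S' \<gamma> P' q z u = ct_dissipation S \<gamma> P q x u \<and>
        dt_dissipation S' \<gamma> P' q z u \<le> dt_dissipation S \<gamma> P q x u))"
    if P: "pos_def_mat n P" for P
  proof -
    have Pc: "P \<in> carrier_mat n n" using P by (simp add: pos_def_mat_def)
    obtain L where L: "L \<in> carrier_mat n k" and LW: "\<And>z. z \<in> carrier_vec k \<Longrightarrow> (L *\<^sub>v z, z) \<in> W"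
      and orth: "\<And>z x. z \<in> carrier_vec k \<Longrightarrow> (x, 0\<^sub>v k) \<in> W \<Longrightarrow> x \<bullet> (P *\<^sub>v (L *\<^sub>v z)) = 0"
      using orthogonal_section[OF lin P onto[folded k_def]] by metis
    have Linj: "z = 0\<^sub>v k" if "z \<in> carrier_vec k" "L *\<^sub>v z = 0\<^sub>v n" for z
      using inj LW[OF that(1)] that(2) by (simp add: n_def k_def)
    let ?P = "L\<^sup>T * (P * L)"
    have "\<exists>x\<in>carrier_vec n. (x \<noteq> 0\<^sub>v n \<or> u \<noteq> 0\<^sub>v m) \<and>
        ct_dissipation S' \<gamma> ?P q z u = ct_dissipation S \<gamma> P q x u \<and>
        dt_dissipation S' \<gamma> ?P q z u \<le> dt_dissipation S \<gamma> P q x u"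
      if q: "q \<in> modes D" and zu: "z \<in> carrier_vec k" "u \<in> carrier_vec m" "z \<noteq> 0\<^sub>v k \<or> u \<noteq> 0\<^sub>v m" for q z u
    proof (intro bexI[of _ "L *\<^sub>v z"] conjI)
      define x where "x = L *\<^sub>v z"
      define x' where "x' = lss_A S q *\<^sub>v x + lss_B S q *\<^sub>v u"
      define z' where "z' = lss_A S' q *\<^sub>v z + lss_B S' q *\<^sub>v u"
      show xc: "L *\<^sub>v z \<in> carrier_vec n" using L zu by auto
      show "L *\<^sub>v z \<noteq> 0\<^sub>v n \<or> u \<noteq> 0\<^sub>v m" using Linj zu by auto
      have xz: "(x, z) \<in> W" using LW zu by (simp add: x_def)
      have "(lss_A S q *\<^sub>v x, lss_A S' q *\<^sub>v z) \<in> W" "(lss_B S q *\<^sub>v u, lss_B S' q *\<^sub>v u) \<in> W"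
        using W q xz zu by (auto simp: simulation_relation_def)
      then have x'z': "(x', z') \<in> W" using lin unfolding linear_relation_def x'_def z'_def by blast
      then have c': "x' \<in> carrier_vec n" "z' \<in> carrier_vec k" using lin by (auto simp: linear_relation_def)
      define d where "d = L *\<^sub>v z' - x'"
      have "(d, z' - z') \<in> W" unfolding d_def by (rule linear_relation_minus[OF lin LW[OF c'(2)] x'z'])
      moreover have "z' - z' = 0\<^sub>v k" using c' by simp
      ultimately have d: "(d, 0\<^sub>v k) \<in> W" by simp
      then have dc: "d \<in> carrier_vec n" using lin by (auto simp: linear_relation_def)
      have Lc: "L *\<^sub>v z' \<in> carrier_vec n" using L c' by auto
      have x'eq: "x' = L *\<^sub>v z' - d" using c' Lc by (auto simp: d_def)
      have Px': "P *\<^sub>v x' = P *\<^sub>v (L *\<^sub>v z') - P *\<^sub>v d"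
        unfolding x'eq by (rule mult_minus_distrib_mat_vec[OF Pc Lc dc])
      \<comment> \<open>minimizers are orthogonal to the correction \<open>d\<close>, which is related to zero\<close>
      have yd: "(L *\<^sub>v y) \<bullet> (P *\<^sub>v d) = 0" if "y \<in> carrier_vec k" for y
        using orth[OF that d] pos_def_mat_sym[OF P dc, of "L *\<^sub>v y"] L that by auto
      have C: "lss_C S q *\<^sub>v x = lss_C S' q *\<^sub>v z" using W q xz by (auto simp: simulation_relation_def)
      have "z \<bullet> (?P *\<^sub>v z') = x \<bullet> (P *\<^sub>v (L *\<^sub>v z'))"
        using congruence_quadratic[OF L Pc zu(1) c'(2)] by (simp add: x_def)
      also have "\<dots> = x \<bullet> (P *\<^sub>v x')"
        unfolding Px' using yd[OF zu(1)] xc Pc Lc dc by (simp add: x_def scalar_prod_minus_distrib[of _ n])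
      finally have ct: "z \<bullet> (?P *\<^sub>v z') = x \<bullet> (P *\<^sub>v x')" .
      show "ct_dissipation S' \<gamma> ?P q z u = ct_dissipation S \<gamma> P q (L *\<^sub>v z) u"
        unfolding ct_dissipation_def x_def[symmetric] x'_def[symmetric] z'_def[symmetric] ct C ..
      have "x' \<bullet> (P *\<^sub>v x') = (L *\<^sub>v z') \<bullet> (P *\<^sub>v (L *\<^sub>v z')) + d \<bullet> (P *\<^sub>v d)"
        unfolding Px' unfolding x'eq using yd[OF c'(2)] orth[OF c'(2) d] Lc dc Pc
        by (simp add: scalar_prod_minus_distrib[of _ n] minus_scalar_prod_distrib[of _ n])
      moreover have "d \<bullet> (P *\<^sub>v d) \<ge> 0" by (rule pos_def_mat_nonneg[OF P dc])
      ultimately have "z' \<bullet> (?P *\<^sub>v z') \<le> x' \<bullet> (P *\<^sub>v x')"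
        unfolding congruence_quadratic[OF L Pc c'(2) c'(2)] by simp
      moreover have "z \<bullet> (?P *\<^sub>v z) = x \<bullet> (P *\<^sub>v x)"
        unfolding congruence_quadratic[OF L Pc zu(1) zu(1)] x_def ..
      ultimately show "dt_dissipation S' \<gamma> ?P q z u \<le> dt_dissipation S \<gamma> P q (L *\<^sub>v z) u"
        unfolding dt_dissipation_def x_def[symmetric] x'_def[symmetric] z'_def[symmetric] C by simp
    qed
    then show ?thesis using congruence_pos_def[OF P L Linj] by blast
  qed
  show "ct_G D m \<gamma> S' \<noteq> {}" if ne: "ct_G D m \<gamma> S \<noteq> {}"
  proof -
    obtain P where P: "P \<in> ct_G D m \<gamma> S" using ne by blast
    note Pd = P[unfolded ct_G_iff_dissipation[OF S], folded n_def]
    obtain P' where P': "pos_def_mat k P'" and le: "\<forall>q\<in>modes D. \<forall>z\<in>carrier_vec k. \<forall>u\<in>carrier_vec m.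
      z \<noteq> 0\<^sub>v k \<or> u \<noteq> 0\<^sub>v m \<longrightarrow> (\<exists>x\<in>carrier_vec n. (x \<noteq> 0\<^sub>v n \<or> u \<noteq> 0\<^sub>v m) \<and>
        ct_dissipation S' \<gamma> P' q z u = ct_dissipation S \<gamma> P q x u \<and>
        dt_dissipation S' \<gamma> P' q z u \<le> dt_dissipation S \<gamma> P q x u)"
      using core[OF conjunct1[OF Pd]] by (elim exE conjE)
    have "P' \<in> ct_G D m \<gamma> S'" unfolding ct_G_iff_dissipation[OF S'] k_def[symmetric]
    proof (intro conjI ballI impI P')
      fix q and z u :: "real vec" assume a: "q \<in> modes D" "z \<in> carrier_vec k" "u \<in> carrier_vec m" "z \<noteq> 0\<^sub>v k \<or> u \<noteq> 0\<^sub>v m"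
      from le[rule_format, OF a] obtain x where x: "x \<in> carrier_vec n" "x \<noteq> 0\<^sub>v n \<or> u \<noteq> 0\<^sub>v m"
        "ct_dissipation S' \<gamma> P' q z u = ct_dissipation S \<gamma> P q x u" by blast
      moreover have "ct_dissipation S \<gamma> P q x u < 0" using conjunct2[OF Pd, rule_format, OF a(1)] x a by blast
      ultimately show "ct_dissipation S' \<gamma> P' q z u < 0" by simp
    qed
    then show ?thesis by blast
  qed
  show "dt_G D m \<gamma> S' \<noteq> {}" if ne: "dt_G D m \<gamma> S \<noteq> {}"
  proof -
    obtain P where P: "P \<in> dt_G D m \<gamma> S" using ne by blast
    note Pd = P[unfolded dt_G_iff_dissipation[OF S], folded n_def]
    obtain P' where P': "pos_def_mat k P'" and le: "\<forall>q\<in>modes D. \<forall>z\<in>carrier_vec k. \<forall>u\<in>carrier_vec m.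
      z \<noteq> 0\<^sub>v k \<or> u \<noteq> 0\<^sub>v m \<longrightarrow> (\<exists>x\<in>carrier_vec n. (x \<noteq> 0\<^sub>v n \<or> u \<noteq> 0\<^sub>v m) \<and>
        ct_dissipation S' \<gamma> P' q z u = ct_dissipation S \<gamma> P q x u \<and>
        dt_dissipation S' \<gamma> P' q z u \<le> dt_dissipation S \<gamma> P q x u)"
      using core[OF conjunct1[OF Pd]] by (elim exE conjE)
    have "P' \<in> dt_G D m \<gamma> S'" unfolding dt_G_iff_dissipation[OF S'] k_def[symmetric]
    proof (intro conjI ballI impI P')
      fix q and z u :: "real vec" assume a: "q \<in> modes D" "z \<in> carrier_vec k" "u \<in> carrier_vec m" "z \<noteq> 0\<^sub>v k \<or> u \<noteq> 0\<^sub>v m"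
      from le[rule_format, OF a] obtain x where x: "x \<in> carrier_vec n" "x \<noteq> 0\<^sub>v n \<or> u \<noteq> 0\<^sub>v m"
        "dt_dissipation S' \<gamma> P' q z u \<le> dt_dissipation S \<gamma> P q x u" by blast
      moreover have "dt_dissipation S \<gamma> P q x u < 0" using conjunct2[OF Pd, rule_format, OF a(1)] x a by blast
      ultimately show "dt_dissipation S' \<gamma> P' q z u < 0" by simp
    qed
    then show ?thesis by blast
  qed
qed

section \<open>The relation spanned by jointly reachable states\<close>

lemma mult_mat_zero_vec:
  fixes M :: "real mat"
  assumes "M \<in> carrier_mat r c" shows "M *\<^sub>v 0\<^sub>v c = 0\<^sub>v r"
  using assms by (intro eq_vecI) auto

definition annihilates :: "real vec \<Rightarrow> real vec \<Rightarrow> (real vec \<times> real vec) set \<Rightarrow> bool" where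
  "annihilates l k R \<longleftrightarrow> (\<forall>(x, z)\<in>R. l \<bullet> x + k \<bullet> z = 0)"

text \<open>
  This is the linear span of \<open>R\<close>, described by the functionals that vanish on \<open>R\<close>. With this
  description, closure of the span under a linear map is a statement about functionals on \<open>R\<close>
  alone, and no spanning family is needed.
\<close>

definition biannihilator :: "nat \<Rightarrow> nat \<Rightarrow> (real vec \<times> real vec) set \<Rightarrow> (real vec \<times> real vec) set" where
  "biannihilator n n' R = {(x, z) \<in> carrier_vec n \<times> carrier_vec n'.
     \<forall>l\<in>carrier_vec n. \<forall>k\<in>carrier_vec n'. annihilates l k R \<longrightarrow> l \<bullet> x + k \<bullet> z = 0}"

lemma biannihilator_linear: "linear_relation n n' (biannihilator n n' R)"
  unfolding linear_relation_def
proof (intro conjI allI impI)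
  show "biannihilator n n' R \<subseteq> carrier_vec n \<times> carrier_vec n'" by (auto simp: biannihilator_def)
  show "(0\<^sub>v n, 0\<^sub>v n') \<in> biannihilator n n' R" by (auto simp: biannihilator_def)
next
  fix x z y w assume a: "(x, z) \<in> biannihilator n n' R \<and> (y, w) \<in> biannihilator n n' R"
  have "l \<bullet> (x + y) + k \<bullet> (z + w) = 0"
    if l: "l \<in> carrier_vec n" "k \<in> carrier_vec n'" "annihilates l k R" for l k
  proof -
    have "l \<bullet> (x + y) = l \<bullet> x + l \<bullet> y" "k \<bullet> (z + w) = k \<bullet> z + k \<bullet> w"
      using a l by (auto simp: biannihilator_def intro: scalar_prod_add_distrib)
    moreover have "l \<bullet> x + k \<bullet> z = 0" "l \<bullet> y + k \<bullet> w = 0" using a l by (auto simp: biannihilator_def)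
    ultimately show ?thesis by simp
  qed
  then show "(x + y, z + w) \<in> biannihilator n n' R" using a by (auto simp: biannihilator_def)
next
  fix c x z assume a: "(x, z) \<in> biannihilator n n' R"
  have "l \<bullet> (c \<cdot>\<^sub>v x) + k \<bullet> (c \<cdot>\<^sub>v z) = 0"
    if l: "l \<in> carrier_vec n" "k \<in> carrier_vec n'" "annihilates l k R" for l k
  proof -
    have "l \<bullet> (c \<cdot>\<^sub>v x) = c * (l \<bullet> x)" "k \<bullet> (c \<cdot>\<^sub>v z) = c * (k \<bullet> z)"
      using a l by (auto simp: biannihilator_def intro!: scalar_prod_smult_distrib)
    moreover have "l \<bullet> x + k \<bullet> z = 0" using a l by (auto simp: biannihilator_def)
    ultimately show ?thesis by (simp add: distrib_left[symmetric])
  qed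
  then show "(c \<cdot>\<^sub>v x, c \<cdot>\<^sub>v z) \<in> biannihilator n n' R" using a by (auto simp: biannihilator_def)
qed

text \<open>
  The hypothesis on the one-step states says that every functional which vanishes on \<open>R\<close> still
  vanishes after a step of the two systems. Taking the zero input, its pullback along the state
  matrices vanishes on \<open>R\<close>, which makes the span invariant; starting from the zero state, it shows
  that the span contains the input directions. The output condition passes to the span because it is
  the vanishing of functionals, one for each row of the output matrices.
\<close>

lemma biannihilator_simulation:
  assumes S: "is_lss D m p S" and S': "is_lss D m p S'"
    and R: "R \<subseteq> carrier_vec (lss_dim S) \<times> carrier_vec (lss_dim S')"
    and step: "\<And>l k q x z v. annihilates l k R \<Longrightarrow> l \<in> carrier_vec (lss_dim S) \<Longrightarrow> k \<in> carrier_vec (lss_dim S') \<Longrightarrow>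
      q \<in> modes D \<Longrightarrow> (x, z) \<in> R \<Longrightarrow> v \<in> carrier_vec m \<Longrightarrow>
      l \<bullet> (lss_A S q *\<^sub>v x + lss_B S q *\<^sub>v v) + k \<bullet> (lss_A S' q *\<^sub>v z + lss_B S' q *\<^sub>v v) = 0"
    and zero: "(0\<^sub>v (lss_dim S), 0\<^sub>v (lss_dim S')) \<in> R"
    and outputs_agree: "\<And>q x z. q \<in> modes D \<Longrightarrow> (x, z) \<in> R \<Longrightarrow> lss_C S q *\<^sub>v x = lss_C S' q *\<^sub>v z"
  shows "simulation_relation D m S S' (biannihilator (lss_dim S) (lss_dim S') R)"
proof -
  define n n' where "n = lss_dim S" and "n' = lss_dim S'"
  let ?W = "biannihilator n n' R"
  have main: "(\<forall>x z. (x, z) \<in> ?W \<longrightarrow> (lss_A S q *\<^sub>v x, lss_A S' q *\<^sub>v z) \<in> ?W \<and> lss_C S q *\<^sub>v x = lss_C S' q *\<^sub>v z) \<and>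
      (\<forall>v\<in>carrier_vec m. (lss_B S q *\<^sub>v v, lss_B S' q *\<^sub>v v) \<in> ?W)" if q: "q \<in> modes D" for q
  proof -
    have c: "lss_A S q \<in> carrier_mat n n" "lss_B S q \<in> carrier_mat n m" "lss_C S q \<in> carrier_mat p n"
      and c': "lss_A S' q \<in> carrier_mat n' n'" "lss_B S' q \<in> carrier_mat n' m" "lss_C S' q \<in> carrier_mat p n'"
      using S S' q by (auto simp: is_lss_def n_def n'_def)
    have B: "(lss_B S q *\<^sub>v v, lss_B S' q *\<^sub>v v) \<in> ?W" if v: "v \<in> carrier_vec m" for v
    proof -
      have b: "lss_B S q *\<^sub>v v \<in> carrier_vec n" "lss_B S' q *\<^sub>v v \<in> carrier_vec n'" using c c' v by auto
      have "l \<bullet> (lss_B S q *\<^sub>v v) + k \<bullet> (lss_B S' q *\<^sub>v v) = 0"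
        if "annihilates l k R" "l \<in> carrier_vec n" "k \<in> carrier_vec n'" for l k
        using step[OF that(1) _ _ q zero v, folded n_def n'_def] that b c c' by (simp add: mult_mat_zero_vec)
      then show ?thesis using b by (auto simp: biannihilator_def)
    qed
    have A: "(lss_A S q *\<^sub>v x, lss_A S' q *\<^sub>v z) \<in> ?W" if xz: "(x, z) \<in> ?W" for x z
    proof -
      have xzc: "x \<in> carrier_vec n" "z \<in> carrier_vec n'" using xz by (auto simp: biannihilator_def)
      have a: "lss_A S q *\<^sub>v x \<in> carrier_vec n" "lss_A S' q *\<^sub>v z \<in> carrier_vec n'" using c c' xzc by auto
      have "l \<bullet> (lss_A S q *\<^sub>v x) + k \<bullet> (lss_A S' q *\<^sub>v z) = 0"
        if lk: "annihilates l k R" "l \<in> carrier_vec n" "k \<in> carrier_vec n'" for l k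
      proof -
        have tr: "l \<bullet> (lss_A S q *\<^sub>v y) = ((lss_A S q)\<^sup>T *\<^sub>v l) \<bullet> y" if "y \<in> carrier_vec n" for y
          using transpose_vec_mult_scalar[OF c(1) that lk(2)] by simp
        have tr': "k \<bullet> (lss_A S' q *\<^sub>v y) = ((lss_A S' q)\<^sup>T *\<^sub>v k) \<bullet> y" if "y \<in> carrier_vec n'" for y
          using transpose_vec_mult_scalar[OF c'(1) that lk(3)] by simp
        have "annihilates ((lss_A S q)\<^sup>T *\<^sub>v l) ((lss_A S' q)\<^sup>T *\<^sub>v k) R"
          unfolding annihilates_def
        proof (clarify)
          fix y w assume yw: "(y, w) \<in> R"
          then have yc: "y \<in> carrier_vec n" "w \<in> carrier_vec n'" using R by (auto simp: n_def n'_def)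
          have "lss_A S q *\<^sub>v y \<in> carrier_vec n" "lss_A S' q *\<^sub>v w \<in> carrier_vec n'" using c c' yc by auto
          then show "((lss_A S q)\<^sup>T *\<^sub>v l) \<bullet> y + ((lss_A S' q)\<^sup>T *\<^sub>v k) \<bullet> w = 0"
            using step[OF lk(1) _ _ q yw zero_carrier_vec, folded n_def n'_def] lk c c' tr[OF yc(1)] tr'[OF yc(2)]
            by (simp add: mult_mat_zero_vec)
        qed
        moreover have "(lss_A S q)\<^sup>T *\<^sub>v l \<in> carrier_vec n" "(lss_A S' q)\<^sup>T *\<^sub>v k \<in> carrier_vec n'"
          using c c' lk by auto
        ultimately show ?thesis using xz tr[OF xzc(1)] tr'[OF xzc(2)] by (auto simp: biannihilator_def)
      qed
      then show ?thesis using a by (auto simp: biannihilator_def)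
    qed
    have C: "lss_C S q *\<^sub>v x = lss_C S' q *\<^sub>v z" if xz: "(x, z) \<in> ?W" for x z
    proof (rule eq_vecI)
      have xzc: "x \<in> carrier_vec n" "z \<in> carrier_vec n'" using xz by (auto simp: biannihilator_def)
      fix i assume "i < dim_vec (lss_C S' q *\<^sub>v z)"
      then have i: "i < p" using c' by simp
      have rc: "row (lss_C S q) i \<in> carrier_vec n" "row (lss_C S' q) i \<in> carrier_vec n'"
        using c c' i row_carrier_vec by blast+
      have eq: "row (lss_C S q) i \<bullet> y + (- row (lss_C S' q) i) \<bullet> w = (lss_C S q *\<^sub>v y) $ i - (lss_C S' q *\<^sub>v w) $ i"
        if "y \<in> carrier_vec n" "w \<in> carrier_vec n'" for y w using c c' i rc that by simp
      have "annihilates (row (lss_C S q) i) (- row (lss_C S' q) i) R"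
        unfolding annihilates_def using eq outputs_agree[OF q] R by (fastforce simp: n_def n'_def)
      then show "(lss_C S q *\<^sub>v x) $ i = (lss_C S' q *\<^sub>v z) $ i"
        using xz rc eq[OF xzc] by (auto simp: biannihilator_def)
    qed (use c c' in auto)
    show ?thesis using A B C by blast
  qed
  then show ?thesis using biannihilator_linear[of n n' R] unfolding simulation_relation_def n_def n'_def by blast
qed

text \<open>
  The states of the second system that occur in the relation form an invariant subspace that contains
  the input directions, so if they were not everything, the system could be restricted. The states
  related to zero form an invariant subspace with zero output, so if there were a nonzero one, the
  system could be replaced by a quotient.
\<close>

lemma irreducible_imp_onto_and_injective:
  assumes S': "is_lss D m p S'" and W: "simulation_relation D m S S' W"
    and S: "is_lss D m p S"
    and irred: "\<And>T M. is_lss D m p T \<Longrightarrow> lss_morphism D M T S' \<or> lss_morphism D M S' T \<Longrightarrow> lss_dim S' \<le> lss_dim T"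
  shows "z \<in> carrier_vec (lss_dim S') \<Longrightarrow> \<exists>x. (x, z) \<in> W"
    and "(0\<^sub>v (lss_dim S), z) \<in> W \<Longrightarrow> z = 0\<^sub>v (lss_dim S')"
proof -
  have lin: "linear_relation (lss_dim S) (lss_dim S') W" using W by (simp add: simulation_relation_def)
  show "\<exists>x. (x, z) \<in> W" if z: "z \<in> carrier_vec (lss_dim S')"
  proof (rule ccontr)
    assume no: "\<nexists>x. (x, z) \<in> W"
    let ?U = "{z. \<exists>x. (x, z) \<in> W}"
    have U: "subspace_vec (lss_dim S') ?U"
      unfolding subspace_vec_def
    proof (intro conjI ballI allI)
      show "?U \<subseteq> carrier_vec (lss_dim S')" using lin unfolding linear_relation_def by blast
      show "0\<^sub>v (lss_dim S') \<in> ?U" using lin unfolding linear_relation_def by blast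
      show "x + y \<in> ?U" if "x \<in> ?U" "y \<in> ?U" for x y
        using that lin unfolding linear_relation_def by blast
      show "c \<cdot>\<^sub>v x \<in> ?U" if "x \<in> ?U" for x c
        using that lin unfolding linear_relation_def by blast
    qed
    have A: "lss_A S' q *\<^sub>v y \<in> ?U"
      if "q \<in> modes D" "y \<in> ?U" for q y
      using W that unfolding simulation_relation_def by blast
    have B: "lss_B S' q *\<^sub>v v \<in> ?U"
      if "q \<in> modes D" "v \<in> carrier_vec m" for q v
      using W that unfolding simulation_relation_def by blast
    obtain T M where "is_lss D m p T" "lss_dim T < lss_dim S'" "lss_morphism D M T S'"
      by (rule restriction_to_invariant_subspace[OF S' U A B z]) (use no in auto)
    then show False using irred[of T M] by simp
  qed
  show "z = 0\<^sub>v (lss_dim S')" if z: "(0\<^sub>v (lss_dim S), z) \<in> W"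
  proof (rule ccontr)
    assume nz: "z \<noteq> 0\<^sub>v (lss_dim S')"
    have z0: "(0\<^sub>v (lss_dim S) + 0\<^sub>v (lss_dim S) :: real vec) = 0\<^sub>v (lss_dim S)"
      "c \<cdot>\<^sub>v 0\<^sub>v (lss_dim S) = (0\<^sub>v (lss_dim S) :: real vec)" for c by auto
    let ?U = "{z. (0\<^sub>v (lss_dim S), z) \<in> W}"
    have U: "subspace_vec (lss_dim S') ?U"
      unfolding subspace_vec_def
    proof (intro conjI ballI allI)
      show "?U \<subseteq> carrier_vec (lss_dim S')" using lin unfolding linear_relation_def by blast
      show "0\<^sub>v (lss_dim S') \<in> ?U" using lin unfolding linear_relation_def by blast
      show "x + y \<in> ?U" if "x \<in> ?U" "y \<in> ?U" for x y
      proof -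
        have "(0\<^sub>v (lss_dim S) + 0\<^sub>v (lss_dim S), x + y) \<in> W"
          using that lin unfolding linear_relation_def by blast
        then show ?thesis unfolding z0(1) by simp
      qed
      show "c \<cdot>\<^sub>v x \<in> ?U" if "x \<in> ?U" for x c
      proof -
        have "(c \<cdot>\<^sub>v 0\<^sub>v (lss_dim S), c \<cdot>\<^sub>v x) \<in> W"
          using that lin unfolding linear_relation_def by blast
        then show ?thesis unfolding z0(2) by simp
      qed
    qed
    have c: "lss_A S q *\<^sub>v 0\<^sub>v (lss_dim S) = 0\<^sub>v (lss_dim S)" "lss_C S q *\<^sub>v 0\<^sub>v (lss_dim S) = 0\<^sub>v p"
      if "q \<in> modes D" for q using S that by (auto simp: is_lss_def intro!: mult_mat_zero_vec)
    have A: "lss_A S' q *\<^sub>v y \<in> ?U" if "q \<in> modes D" "y \<in> ?U" for q y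
    proof -
      have "(lss_A S q *\<^sub>v 0\<^sub>v (lss_dim S), lss_A S' q *\<^sub>v y) \<in> W"
        using W that unfolding simulation_relation_def by blast
      then show ?thesis unfolding c(1)[OF that(1)] by simp
    qed
    have C: "lss_C S' q *\<^sub>v y = 0\<^sub>v p" if "q \<in> modes D" "y \<in> ?U" for q y
    proof -
      have "lss_C S q *\<^sub>v 0\<^sub>v (lss_dim S) = lss_C S' q *\<^sub>v y"
        using W that unfolding simulation_relation_def by blast
      then show ?thesis unfolding c(2)[OF that(1)] by simp
    qed
    obtain T M where "is_lss D m p T" "lss_dim T < lss_dim S'" "lss_morphism D M S' T"
      by (rule quotient_by_unobservable_subspace[OF S' U A C, of z]) (use z nz in auto)
    then show False using irred[of T M] by simp
  qed
qed

lemma gamma_le_by_simulation: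
  assumes S: "is_lss D m p S" and S': "is_lss D m p S'" and W: "simulation_relation D m S S' W"
    and irred: "\<And>T M. is_lss D m p T \<Longrightarrow> lss_morphism D M T S' \<or> lss_morphism D M S' T \<Longrightarrow> lss_dim S' \<le> lss_dim T"
  shows "ct_gamma D m S' \<le> ct_gamma D m S" "dt_gamma D m S' \<le> dt_gamma D m S"
proof -
  have onto: "\<exists>x. (x, z) \<in> W" if "z \<in> carrier_vec (lss_dim S')" for z
    by (rule irreducible_imp_onto_and_injective(1)[OF S' W S _ that]) (rule irred)
  have inj: "z = 0\<^sub>v (lss_dim S')" if "(0\<^sub>v (lss_dim S), z) \<in> W" for z
    by (rule irreducible_imp_onto_and_injective(2)[OF S' W S _ that]) (rule irred)
  note G = G_transfer[OF S S' W onto inj]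
  show "ct_gamma D m S' \<le> ct_gamma D m S" unfolding ct_gamma_def
    by (rule Inf_superset_mono) (use G(1) in auto)
  show "dt_gamma D m S' \<le> dt_gamma D m S" unfolding dt_gamma_def
    by (rule Inf_superset_mono) (use G(2) in auto)
qed

section \<open>Discrete time\<close>

lemma dt_state_carrier:
  assumes "is_lss D m p S" "q \<in> dt_switching D" "\<And>t. u t \<in> carrier_vec m"
  shows "dt_state S u q t \<in> carrier_vec (lss_dim S)"
proof (induction t)
  case (Suc t)
  have "q t \<in> modes D" using assms by (simp add: dt_switching_def)
  then have "lss_A S (q t) \<in> carrier_mat (lss_dim S) (lss_dim S)" "lss_B S (q t) \<in> carrier_mat (lss_dim S) m"
    using assms by (auto simp: is_lss_def)
  then show ?case using Suc assms(3)[of t] by simp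
qed simp

lemma dt_morphism_equivalent:
  assumes S: "is_lss D m p S" and S': "is_lss D m p S'" and M: "lss_morphism D M S' S"
  shows "dt_equivalent D m S' S"
proof -
  have out: "lss_C S (q t) *\<^sub>v dt_state S u q t = lss_C S' (q t) *\<^sub>v dt_state S' u q t"
    if u: "u \<in> dt_inputs m" and q: "q \<in> dt_switching D" for u q t
  proof -
    have uc: "\<And>t. u t \<in> carrier_vec m" and qm: "\<And>t. q t \<in> modes D"
      using u q by (auto simp: dt_inputs_def dt_switching_def)
    have Mc: "M \<in> carrier_mat (lss_dim S) (lss_dim S')" using M by (simp add: lss_morphism_def)
    have "dt_state S u q t = M *\<^sub>v dt_state S' u q t"
    proof (induction t)
      case (Suc t)
      then show ?case
        using lss_morphismD(1)[OF S S' M qm dt_state_carrier[OF S' q uc] uc] by simp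
    qed (use mult_mat_zero_vec[OF Mc] in simp)
    then show ?thesis using lss_morphismD(2)[OF S S' M qm dt_state_carrier[OF S' q uc] uc] by simp
  qed
  show ?thesis unfolding dt_equivalent_def dt_io_map_def
    by (rule restrict_ext) (use out in auto)
qed

text \<open>
  The relation is the span of the pairs of states that the two systems reach under the same control.
  Any control can be cut off at any time and continued with a prescribed mode and input value, so
  reachable pairs are closed under steps. The prescribed mode also makes the equal outputs of the two
  systems available for every output matrix at every reachable pair.
\<close>

lemma dt_equivalent_simulation:
  assumes S: "is_lss D m p S" and S': "is_lss D m p S'" and eq: "dt_equivalent D m S S'" and D: "D \<ge> 1"
  shows "\<exists>W. simulation_relation D m S S' W"
proof -
  define R where "R = {(dt_state S u q t, dt_state S' u q t) | u q t. u \<in> dt_inputs m \<and> q \<in> dt_switching D}"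
  have continue: "\<exists>u' q'. u' \<in> dt_inputs m \<and> q' \<in> dt_switching D \<and> u' t = v \<and> q' t = q0 \<and>
      dt_state S u' q' t = dt_state S u q t \<and> dt_state S' u' q' t = dt_state S' u q t"
    if u: "u \<in> dt_inputs m" and q: "q \<in> dt_switching D" and q0: "q0 \<in> modes D" and v: "v \<in> carrier_vec m" for u q t q0 v
  proof -
    define u' where "u' s = (if s < t then u s else if s = t then v else 0\<^sub>v m)" for s
    define q' where "q' s = (if s < t then q s else q0)" for s
    \<comment> \<open>stopping the input after time \<open>t\<close> keeps it square summable\<close>
    have "summable (\<lambda>s. u' s \<bullet> u' s)"
      by (rule summable_finite[of "{..t}"]) (auto simp: u'_def)
    then have "u' \<in> dt_inputs m" using u v by (auto simp: dt_inputs_def u'_def)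
    moreover have "q' \<in> dt_switching D" using q q0 by (auto simp: dt_switching_def q'_def)
    moreover have "s \<le> t \<Longrightarrow> dt_state T u' q' s = dt_state T u q s" for s T
      by (induction s) (auto simp: u'_def q'_def)
    ultimately show ?thesis by (intro exI[of _ u'] exI[of _ q']) (auto simp: u'_def q'_def)
  qed
  have "simulation_relation D m S S' (biannihilator (lss_dim S) (lss_dim S') R)"
  proof (rule biannihilator_simulation[OF S S'])
    show "R \<subseteq> carrier_vec (lss_dim S) \<times> carrier_vec (lss_dim S')"
      using dt_state_carrier[OF S] dt_state_carrier[OF S'] by (auto simp: R_def dt_inputs_def)
    have "(\<lambda>t. 0\<^sub>v m) \<in> dt_inputs m" "(\<lambda>t. 1) \<in> dt_switching D"
      using D by (auto simp: dt_inputs_def dt_switching_def)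
    then show "(0\<^sub>v (lss_dim S), 0\<^sub>v (lss_dim S')) \<in> R" unfolding R_def
      by (intro CollectI exI[of _ "\<lambda>t. 0\<^sub>v m"] exI[of _ "\<lambda>t. 1"] exI[of _ 0]) simp
  next
    fix l k x z v :: "real vec" and q0
    assume ann: "annihilates l k R" and q0: "q0 \<in> modes D" and xz: "(x, z) \<in> R" and v: "v \<in> carrier_vec m"
    obtain u q t where uq: "u \<in> dt_inputs m" "q \<in> dt_switching D" and x: "x = dt_state S u q t" "z = dt_state S' u q t"
      using xz by (auto simp: R_def)
    obtain u' q' where u': "u' \<in> dt_inputs m" "q' \<in> dt_switching D" "u' t = v" "q' t = q0"
      "dt_state S u' q' t = x" "dt_state S' u' q' t = z" using continue[OF uq q0 v, of t] x by blast
    have "(dt_state S u' q' (Suc t), dt_state S' u' q' (Suc t)) \<in> R" using u'(1,2) unfolding R_def by blast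
    then show "l \<bullet> (lss_A S q0 *\<^sub>v x + lss_B S q0 *\<^sub>v v) + k \<bullet> (lss_A S' q0 *\<^sub>v z + lss_B S' q0 *\<^sub>v v) = 0"
      using ann u' by (auto simp: annihilates_def)
  next
    fix q0 and x z :: "real vec" assume q0: "q0 \<in> modes D" and xz: "(x, z) \<in> R"
    obtain u q t where uq: "u \<in> dt_inputs m" "q \<in> dt_switching D" and x: "x = dt_state S u q t" "z = dt_state S' u q t"
      using xz by (auto simp: R_def)
    obtain u' q' where u': "u' \<in> dt_inputs m" "q' \<in> dt_switching D" "q' t = q0"
      "dt_state S u' q' t = x" "dt_state S' u' q' t = z" using continue[OF uq q0 zero_carrier_vec, of t] x by blast
    have "dt_io_map D m S (u', q') t = dt_io_map D m S' (u', q') t" using eq by (simp add: dt_equivalent_def)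
    then show "lss_C S q0 *\<^sub>v x = lss_C S' q0 *\<^sub>v z" using u' by (simp add: dt_io_map_def)
  qed
  then show ?thesis by blast
qed

lemma dt_minimal_gamma_le:
  assumes D: "D \<ge> 1" and S: "is_lss D m p S" and Sm: "dt_minimal D m p Sm" and eq: "dt_equivalent D m Sm S"
  shows "dt_gamma D m Sm \<le> dt_gamma D m S"
proof -
  have Sm': "is_lss D m p Sm" using Sm by (simp add: dt_minimal_def)
  have "dt_equivalent D m S Sm" using eq by (simp add: dt_equivalent_def)
  then obtain W where W: "simulation_relation D m S Sm W" using dt_equivalent_simulation[OF S Sm' _ D] by blast
  have "lss_dim Sm \<le> lss_dim T" if T: "is_lss D m p T" and M: "lss_morphism D M T Sm \<or> lss_morphism D M Sm T" for T M
  proof -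
    have "dt_equivalent D m T Sm"
      using M dt_morphism_equivalent[OF Sm' T] dt_morphism_equivalent[OF T Sm'] by (auto simp: dt_equivalent_def)
    then show ?thesis using Sm T by (simp add: dt_minimal_def)
  qed
  then show ?thesis by (rule gamma_le_by_simulation(2)[OF S Sm' W])
qed

section \<open>Absolute continuity and indefinite integrals\<close>

lemma sum_integral_disjoint_intervals_le:
  fixes l r :: "nat \<Rightarrow> real" and h :: "real \<Rightarrow> real"
  assumes sub: "\<And>i. i < N \<Longrightarrow> {l i..r i} \<subseteq> T"
    and disj: "disjoint_family_on (\<lambda>i. {l i<..<r i}) {..<N}"
    and int: "\<And>i. i < N \<Longrightarrow> h integrable_on {l i..r i}" "h integrable_on T"
    and nonneg: "\<And>t. t \<in> T \<Longrightarrow> 0 \<le> h t"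
  shows "(\<Sum>i<N. integral {l i..r i} h) \<le> integral T h"
proof -
  have neg: "negligible ({l i..r i} \<inter> {l j..r j})" if ij: "i < N" "j < N" "i \<noteq> j" for i j
  proof (rule negligible_subset)
    show "negligible {l i, r i, l j, r j}" by (rule negligible_finite) simp
    have "{l i<..<r i} \<inter> {l j<..<r j} = {}" using disj ij by (auto simp: disjoint_family_on_def)
    then show "{l i..r i} \<inter> {l j..r j} \<subseteq> {l i, r i, l j, r j}"
      by (force simp: set_eq_iff less_le)
  qed
  have "(h has_integral (\<Sum>i<N. integral {l i..r i} h)) (\<Union>i<N. {l i..r i})"
    using int(1) neg by (intro has_integral_UN) (auto simp: pairwise_def integrable_integral)
  then show ?thesis
    by (rule has_integral_subset_le[rotated]) (use sub int(2) nonneg in \<open>auto simp: integrable_integral\<close>)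
qed

text \<open>
  The integrand is split into a part bounded by a constant and a remainder of small integral. The
  first part contributes at most the constant times the total length of the intervals, the second one
  at most its integral.
\<close>

lemma abs_continuous_indefinite_integral:
  fixes f :: "real \<Rightarrow> real"
  assumes f: "f absolutely_integrable_on {a..b}"
  shows "abs_continuous_on_interval (\<lambda>t. integral {a..t} f) a b"
  unfolding abs_continuous_on_interval_def
proof (intro allI impI)
  fix \<epsilon> :: real assume \<epsilon>: "\<epsilon> > 0"
  have meas: "f \<in> borel_measurable (lebesgue_on {a..b})" and absint: "(\<lambda>t. \<bar>f t\<bar>) integrable_on {a..b}"
    using f absolutely_integrable_measurable_real'[of "{a..b}" f] by auto
  have fint: "f integrable_on {a..b}" using f by (simp add: absolutely_integrable_on_def)
  \<comment> \<open>truncation at height \<open>k\<close>; the excess \<open>h k\<close> has small integral for large \<open>k\<close>\<close>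
  define g where "g k t = min \<bar>f t\<bar> (real k)" for k :: nat and t
  define h where "h k t = \<bar>f t\<bar> - g k t" for k :: nat and t
  have gint: "g k integrable_on {a..b}" for k
  proof (rule measurable_bounded_by_integrable_imp_integrable[OF _ absint])
    show "g k \<in> borel_measurable (lebesgue_on {a..b})"
      unfolding g_def using meas by (intro borel_measurable_min borel_measurable_abs) auto
  qed (auto simp: g_def)
  have hint: "h k integrable_on {a..b}" for k
    unfolding h_def using absint gint by (intro integrable_diff) auto
  have "(\<lambda>k. integral {a..b} (h k)) \<longlonglongrightarrow> integral {a..b} (\<lambda>t. 0)"
  proof (rule dominated_convergence(2)[OF hint absint])
    show "norm (h k t) \<le> \<bar>f t\<bar>" for k t by (auto simp: h_def g_def min_def)
    show "(\<lambda>k. h k t) \<longlonglongrightarrow> 0" for t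
    proof (rule tendsto_eventually)
      obtain k0 :: nat where "\<bar>f t\<bar> \<le> real k0" using real_arch_simple by blast
      then show "\<forall>\<^sub>F k in sequentially. h k t = 0"
        by (intro eventually_sequentiallyI[of k0]) (auto simp: h_def g_def min_def)
    qed
  qed
  then have "\<forall>\<^sub>F k in sequentially. integral {a..b} (h k) < \<epsilon> / 2"
    using \<epsilon> by (intro order_tendstoD) auto
  then obtain k where k: "integral {a..b} (h k) < \<epsilon> / 2" using eventually_sequentially by auto
  define \<delta> where "\<delta> = \<epsilon> / (2 * (real k + 1))"
  have "\<delta> > 0" using \<epsilon> by (simp add: \<delta>_def)
  moreover have "(\<Sum>i<N. \<bar>integral {a..r i} f - integral {a..l i} f\<bar>) < \<epsilon>"
    if fam: "\<forall>i<N. a \<le> l i \<and> l i \<le> r i \<and> r i \<le> b" and disj: "disjoint_family_on (\<lambda>i. {l i<..<r i}) {..<N}"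
      and small: "(\<Sum>i<N. r i - l i) < \<delta>" for N :: nat and l r :: "nat \<Rightarrow> real"
  proof -
    have each: "\<bar>integral {a..r i} f - integral {a..l i} f\<bar> \<le> real k * (r i - l i) + integral {l i..r i} (h k)"
      if i: "i < N" for i
    proof -
      have le: "a \<le> l i" "l i \<le> r i" "r i \<le> b" using fam i by auto
      then have sub: "{a..r i} \<subseteq> {a..b}" "{l i..r i} \<subseteq> {a..b}" by auto
      note I = integrable_on_subinterval[OF _ sub(1)] integrable_on_subinterval[OF _ sub(2)]
      have kint: "(\<lambda>t. real k + h k t) integrable_on {l i..r i}"
        by (intro integrable_add I(2) hint integrable_const_ivl)
      have "integral {a..r i} f - integral {a..l i} f = integral {l i..r i} f"
        using Henstock_Kurzweil_Integration.integral_combine[OF le(1,2) I(1)[OF fint]] by simp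
      also have "\<bar>\<dots>\<bar> \<le> integral {l i..r i} (\<lambda>t. real k + h k t)"
        unfolding real_norm_def[symmetric]
        by (rule Henstock_Kurzweil_Integration.integral_norm_bound_integral[OF I(2)[OF fint] kint])
           (auto simp: h_def g_def min_def)
      also have "\<dots> = real k * (r i - l i) + integral {l i..r i} (h k)"
        using le Henstock_Kurzweil_Integration.integral_add[OF integrable_const_ivl[of "real k"] I(2)[OF hint[of k]]] by simp
      finally show ?thesis .
    qed
    have "(\<Sum>i<N. \<bar>integral {a..r i} f - integral {a..l i} f\<bar>) \<le>
        (\<Sum>i<N. real k * (r i - l i) + integral {l i..r i} (h k))"
      using each by (intro sum_mono) auto
    also have "\<dots> = real k * (\<Sum>i<N. r i - l i) + (\<Sum>i<N. integral {l i..r i} (h k))"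
      by (simp add: sum.distrib sum_distrib_left)
    also have "(\<Sum>i<N. integral {l i..r i} (h k)) \<le> integral {a..b} (h k)"
    proof (rule sum_integral_disjoint_intervals_le[OF _ disj _ hint])
      show sub: "{l i..r i} \<subseteq> {a..b}" if "i < N" for i using fam that by auto
      show "h k integrable_on {l i..r i}" if "i < N" for i
        by (rule integrable_on_subinterval[OF hint sub[OF that]])
    qed (auto simp: h_def g_def)
    also have "real k * (\<Sum>i<N. r i - l i) \<le> (real k + 1) * \<delta>"
    proof (rule mult_mono)
      show "0 \<le> (\<Sum>i<N. r i - l i)" using fam by (intro sum_nonneg) auto
    qed (use small in auto)
    also have "(real k + 1) * \<delta> = \<epsilon> / 2" by (simp add: \<delta>_def field_simps)
    finally show ?thesis using k by simp
  qed
  ultimately show "\<exists>\<delta>>0. \<forall>(N::nat) l r.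
     (\<forall>i<N. a \<le> l i \<and> l i \<le> r i \<and> r i \<le> b) \<and>
     disjoint_family_on (\<lambda>i. {l i<..<r i}) {..<N} \<and>
     (\<Sum>i<N. r i - l i) < \<delta>
     \<longrightarrow> (\<Sum>i<N. \<bar>integral {a..r i} f - integral {a..l i} f\<bar>) < \<epsilon>" by blast
qed

text \<open>
  Absolute continuity speaks of enumerated families of intervals. Here it is applied to a finite
  family with arbitrary index set whose total length is controlled by a set of small measure that
  covers it.
\<close>

lemma abs_continuous_diff_bound:
  assumes fin: "finite I"
    and F: "\<forall>(N::nat) l r. (\<forall>i<N. a \<le> l i \<and> l i \<le> r i \<and> r i \<le> b) \<and>
       disjoint_family_on (\<lambda>i. {l i<..<r i}) {..<N} \<and> (\<Sum>i<N. r i - l i) < \<delta>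
       \<longrightarrow> (\<Sum>i<N. \<bar>F (r i) - F (l i)\<bar>) < (\<epsilon>::real)"
    and lr: "\<And>i. i \<in> I \<Longrightarrow> a \<le> l i \<and> l i \<le> r i \<and> r i \<le> (b::real)"
    and disj: "disjoint_family_on (\<lambda>i. {l i<..<r i}) I"
    and cover: "\<And>i. i \<in> I \<Longrightarrow> {l i..r i} \<subseteq> G" and G: "G \<in> lmeasurable" "measure lebesgue G < \<delta>"
  shows "(\<Sum>i\<in>I. \<bar>F (r i) - F (l i)\<bar>) < \<epsilon>"
proof -
  obtain e where e: "bij_betw e {..<card I} I"
    using ex_bij_betw_nat_finite[OF fin] by (auto simp: atLeast0LessThan)
  let ?N = "card I"
  have eI: "e i \<in> I" if "i < ?N" for i using e that by (auto simp: bij_betw_def)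
  have d: "disjoint_family_on (\<lambda>i. {l (e i)<..<r (e i)}) {..<?N}"
    unfolding disjoint_family_on_def
  proof (intro ballI impI)
    fix i j assume ij: "i \<in> {..<?N}" "j \<in> {..<?N}" "i \<noteq> j"
    then have "e i \<noteq> e j" using e by (auto simp: bij_betw_def inj_on_def)
    then show "{l (e i)<..<r (e i)} \<inter> {l (e j)<..<r (e j)} = {}"
      using disj eI ij unfolding disjoint_family_on_def by (metis lessThan_iff)
  qed
  have "(\<Sum>i<?N. r (e i) - l (e i)) = (\<Sum>i<?N. integral {l (e i)..r (e i)} (\<lambda>t. 1))"
    using lr eI by (intro sum.cong) auto
  also have "\<dots> \<le> integral G (\<lambda>t. 1)"
    using cover eI G(1) by (intro sum_integral_disjoint_intervals_le[OF _ d]) (auto simp: integrable_on_const)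
  also have "\<dots> = measure lebesgue G" using lmeasure_integral[OF G(1)] by simp
  finally have "(\<Sum>i<?N. r (e i) - l (e i)) < \<delta>" using G(2) by simp
  then have "(\<Sum>i<?N. \<bar>F (r (e i)) - F (l (e i))\<bar>) < \<epsilon>"
    using F[rule_format, of ?N "\<lambda>i. l (e i)" "\<lambda>i. r (e i)"] d lr eI by simp
  also have "(\<Sum>i<?N. \<bar>F (r (e i)) - F (l (e i))\<bar>) = (\<Sum>i\<in>I. \<bar>F (r i) - F (l i)\<bar>)"
    using sum.reindex_bij_betw[OF e, of "\<lambda>i. \<bar>F (r i) - F (l i)\<bar>"] by simp
  finally show ?thesis .
qed

text \<open>
  The usual gauge argument for the fundamental theorem controls the intervals of a division whose tag
  is a point of differentiability. Tags in the null set are given a gauge inside an open set of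
  small measure that covers the null set, and absolute continuity then bounds the total increment
  over their intervals.
\<close>

lemma fundamental_theorem_abs_continuous:
  fixes F f :: "real \<Rightarrow> real"
  assumes ab: "a \<le> b" and AC: "abs_continuous_on_interval F a b" and N: "negligible N"
    and deriv: "\<And>t. t \<in> {a..b} - N \<Longrightarrow> (F has_real_derivative f t) (at t within {a..b})"
  shows "(f has_integral F b - F a) {a..b}"
proof -
  define g where "g t = (if t \<in> N then 0 else f t)" for t
  have "(g has_integral F b - F a) {a..b}"
    unfolding has_integral_real
  proof (intro allI impI)
    fix e :: real assume e: "e > 0"
    \<comment> \<open>the summand 1 covers the degenerate interval\<close>
    define e1 where "e1 = e / (2 * (b - a + 1))"
    have e1: "e1 > 0" using e ab by (simp add: e1_def)
    obtain \<delta> where \<delta>: "\<delta> > 0" and F: "\<forall>(N::nat) l r. (\<forall>i<N. a \<le> l i \<and> l i \<le> r i \<and> r i \<le> b) \<and>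
       disjoint_family_on (\<lambda>i. {l i<..<r i}) {..<N} \<and> (\<Sum>i<N. r i - l i) < \<delta>
       \<longrightarrow> (\<Sum>i<N. \<bar>F (r i) - F (l i)\<bar>) < e / 2"
      using AC[unfolded abs_continuous_on_interval_def, rule_format, of "e / 2"] e by auto
    obtain G where G: "open G" "N \<subseteq> G" "G - N \<in> lmeasurable" "emeasure lebesgue (G - N) < ennreal \<delta>"
      using sets_lebesgue_outer_open[OF negligible_imp_sets[OF N] \<delta>] by metis
    have GN: "G = (G - N) \<union> N" using G by auto
    have Gl: "G \<in> lmeasurable" using G(3) negligible_imp_measurable[OF N] by (subst GN) (rule fmeasurable.Un)
    have Gm: "measure lebesgue G < \<delta>"
    proof -
      have "measure lebesgue G \<le> measure lebesgue (G - N) + measure lebesgue N"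
        by (subst GN) (rule measure_Un_le, use G(3) negligible_imp_sets[OF N] in auto)
      also have "\<dots> = measure lebesgue (G - N)" using negligible_imp_measure0[OF N] by simp
      also have "\<dots> < \<delta>" using G(4) \<delta> unfolding emeasure_eq_measure2[OF G(3)] by (simp add: ennreal_less_iff)
      finally show ?thesis .
    qed
    have "\<exists>d>0. (x \<in> N \<longrightarrow> ball x d \<subseteq> G) \<and> (x \<in> {a..b} - N \<longrightarrow>
         (\<forall>y\<in>{a..b}. \<bar>y - x\<bar> < d \<longrightarrow> \<bar>F y - F x - (y - x) * f x\<bar> \<le> e1 * \<bar>y - x\<bar>))" for x
    proof (cases "x \<in> N")
      case True
      then have "x \<in> G" using G(2) by auto
      then obtain d where "d > 0" "ball x d \<subseteq> G" using G(1) open_contains_ball by blast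
      then show ?thesis using True by auto
    next
      case False
      show ?thesis
      proof (cases "x \<in> {a..b}")
        case True
        have "(*) (f x) = (\<lambda>y. y * f x)" by (rule ext) simp
        then have "(F has_derivative (\<lambda>y. y * f x)) (at x within {a..b})"
          using deriv[of x] False True unfolding has_field_derivative_def by simp
        then have "\<exists>d>0. \<forall>y\<in>{a..b}. norm (y - x) < d \<longrightarrow> norm (F y - F x - (y - x) * f x) \<le> e1 * norm (y - x)"
          using e1 unfolding has_derivative_within_alt by blast
        then show ?thesis using False by auto
      qed (use False in \<open>auto intro: exI[of _ 1]\<close>)
    qed
    then obtain d where d: "\<And>x. d x > 0" "\<And>x. x \<in> N \<Longrightarrow> ball x (d x) \<subseteq> G"
      "\<And>x y. x \<in> {a..b} - N \<Longrightarrow> y \<in> {a..b} \<Longrightarrow> \<bar>y - x\<bar> < d x \<Longrightarrow> \<bar>F y - F x - (y - x) * f x\<bar> \<le> e1 * \<bar>y - x\<bar>"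
      by metis
    show "\<exists>\<gamma>. gauge \<gamma> \<and> (\<forall>\<D>. \<D> tagged_division_of {a..b} \<and> \<gamma> fine \<D> \<longrightarrow>
        norm ((\<Sum>(x, k)\<in>\<D>. measure lborel k *\<^sub>R g x) - (F b - F a)) < e)"
    proof (intro exI[of _ "\<lambda>x. ball x (d x)"] conjI allI impI)
      show "gauge (\<lambda>x. ball x (d x))" using d(1) gauge_ball_dependent by blast
      fix p assume "p tagged_division_of {a..b} \<and> (\<lambda>x. ball x (d x)) fine p"
      then have p: "p tagged_division_of {a..b}" and fine: "(\<lambda>x. ball x (d x)) fine p" by auto
      have finp: "finite p" using p by blast
      have K: "K = {Inf K..Sup K}" "Inf K \<le> Sup K" "a \<le> Inf K" "Sup K \<le> b" "x \<in> K" "K \<subseteq> {a..b}" "K \<subseteq> ball x (d x)"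
        if xK: "(x, K) \<in> p" for x K
      proof -
        obtain u v where uv: "K = {u..v}" using tagged_division_ofD(4)[OF p xK] by auto
        show "x \<in> K" using tagged_division_ofD(2)[OF p xK] .
        then have "u \<le> v" using uv by auto
        then show "K = {Inf K..Sup K}" "Inf K \<le> Sup K" using uv by auto
        show sub: "K \<subseteq> {a..b}" using tagged_division_ofD(3)[OF p xK] .
        then show "a \<le> Inf K" "Sup K \<le> b" using uv \<open>u \<le> v\<close> by auto
        show "K \<subseteq> ball x (d x)" using fine xK by (auto simp: fine_def)
      qed
      define p1 where "p1 = {(x, K) \<in> p. x \<notin> N}"
      define p2 where "p2 = {(x, K) \<in> p. x \<in> N}"
      have pp: "p = p1 \<union> p2" "p1 \<inter> p2 = {}" "finite p1" "finite p2"
        using finp by (auto simp: p1_def p2_def intro: finite_subset[of _ p])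
      let ?t = "\<lambda>(x, K). measure lborel K *\<^sub>R g x - (F (Sup K) - F (Inf K))"
      have "F b - F a = (\<Sum>(x,K)\<in>p. F (Sup K) - F (Inf K))"
        using additive_tagged_division_1[OF ab p, of F] by simp
      then have "(\<Sum>(x, k)\<in>p. measure lborel k *\<^sub>R g x) - (F b - F a) = (\<Sum>z\<in>p. ?t z)"
        by (simp add: sum_subtractf split_def)
      also have "\<dots> = (\<Sum>z\<in>p1. ?t z) + (\<Sum>z\<in>p2. ?t z)"
        using pp by (simp add: sum.union_disjoint)
      finally have split: "norm ((\<Sum>(x, k)\<in>p. measure lborel k *\<^sub>R g x) - (F b - F a)) \<le>
          (\<Sum>z\<in>p1. \<bar>?t z\<bar>) + (\<Sum>z\<in>p2. \<bar>?t z\<bar>)"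
        by (simp only: real_norm_def) (intro order_trans[OF abs_triangle_ineq] add_mono sum_abs)
      have "(\<Sum>z\<in>p1. \<bar>?t z\<bar>) \<le> (\<Sum>(x,K)\<in>p1. e1 * (Sup K - Inf K))"
      proof (rule sum_mono, clarify)
        fix x K assume "(x, K) \<in> p1"
        then have xp: "(x, K) \<in> p" and xN: "x \<notin> N" by (auto simp: p1_def)
        note k = K[OF xp]
        define u v where "u = Inf K" and "v = Sup K"
        have kuv: "K = {u..v}" using k(1) by (simp add: u_def v_def)
        have "u \<le> v" unfolding u_def v_def by (rule k(2))
        then have uv: "u \<le> v" "u \<in> K" "v \<in> K" unfolding kuv by auto
        have x: "x \<in> {a..b} - N" "u \<le> x" "x \<le> v" using k(5,6) xN kuv by auto
        have close: "\<bar>u - x\<bar> < d x" "\<bar>v - x\<bar> < d x"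
          using k(7) uv by (auto simp: subset_iff dist_real_def abs_minus_commute)
        have "\<bar>F u - F x - (u - x) * f x\<bar> \<le> e1 * \<bar>u - x\<bar>" "\<bar>F v - F x - (v - x) * f x\<bar> \<le> e1 * \<bar>v - x\<bar>"
          using d(3)[OF x(1)] k(6) uv close by auto
        moreover have "(v - u) * f x - (F v - F u) = (F u - F x - (u - x) * f x) - (F v - F x - (v - x) * f x)"
          by (simp add: left_diff_distrib)
        ultimately have "\<bar>(v - u) * f x - (F v - F u)\<bar> \<le> e1 * \<bar>u - x\<bar> + e1 * \<bar>v - x\<bar>"
          using abs_triangle_ineq4[of "F u - F x - (u - x) * f x" "F v - F x - (v - x) * f x"] by linarith
        also have "\<dots> = e1 * (v - u)" using x by (simp add: right_diff_distrib)
        finally have "\<bar>(v - u) * f x - (F v - F u)\<bar> \<le> e1 * (v - u)" .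
        then show "\<bar>measure lborel K *\<^sub>R g x - (F (Sup K) - F (Inf K))\<bar> \<le> e1 * (Sup K - Inf K)"
          unfolding u_def[symmetric] v_def[symmetric] using uv(1) xN kuv by (simp add: g_def)
      qed
      also have "\<dots> \<le> (\<Sum>(x,K)\<in>p. e1 * (Sup K - Inf K))"
        using K(2) e1 finp by (intro sum_mono2) (auto simp: p1_def)
      also have "\<dots> = e1 * (b - a)"
        using additive_tagged_division_1[OF ab p, of "\<lambda>x. x"] by (simp add: sum_distrib_left[symmetric] split_def)
      also have "\<dots> < e / 2" using e ab by (simp add: e1_def field_simps)
      finally have 1: "(\<Sum>z\<in>p1. \<bar>?t z\<bar>) < e / 2" .
      have "(\<Sum>z\<in>p2. \<bar>?t z\<bar>) = (\<Sum>z\<in>p2. \<bar>F (Sup (snd z)) - F (Inf (snd z))\<bar>)"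
        by (intro sum.cong) (auto simp: p2_def g_def)
      also have "\<dots> < e / 2"
      proof (rule abs_continuous_diff_bound[OF pp(4) F _ _ _ Gl Gm])
        show "a \<le> Inf (snd z) \<and> Inf (snd z) \<le> Sup (snd z) \<and> Sup (snd z) \<le> b" if "z \<in> p2" for z
          using K[of "fst z" "snd z"] that by (auto simp: p2_def)
        show "{Inf (snd z)..Sup (snd z)} \<subseteq> G" if z: "z \<in> p2" for z
        proof -
          have "(fst z, snd z) \<in> p" "fst z \<in> N" using z by (auto simp: p2_def)
          then show ?thesis using K(1,7)[of "fst z" "snd z"] d(2)[of "fst z"] by auto
        qed
        show "disjoint_family_on (\<lambda>z. {Inf (snd z)<..<Sup (snd z)}) p2"
          unfolding disjoint_family_on_def
        proof (intro ballI impI)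
          fix y z assume "y \<in> p2" "z \<in> p2" "y \<noteq> z"
          then have yz: "(fst y, snd y) \<in> p" "(fst z, snd z) \<in> p" "(fst y, snd y) \<noteq> (fst z, snd z)"
            by (auto simp: p2_def prod_eq_iff)
          have "interior (snd y) = {Inf (snd y)<..<Sup (snd y)}" "interior (snd z) = {Inf (snd z)<..<Sup (snd z)}"
            using arg_cong[OF K(1)[OF yz(1)], of interior] arg_cong[OF K(1)[OF yz(2)], of interior]
            by (simp_all only: interior_atLeastAtMost_real)
          then show "{Inf (snd y)<..<Sup (snd y)} \<inter> {Inf (snd z)<..<Sup (snd z)} = {}"
            using tagged_division_ofD(5)[OF p yz] by simp
        qed
      qed
      finally show "norm ((\<Sum>(x, k)\<in>p. measure lborel k *\<^sub>R g x) - (F b - F a)) < e"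
        using split 1 by linarith
    qed
  qed
  then show ?thesis by (rule has_integral_spike[OF N, rotated]) (auto simp: g_def)
qed

lemma abs_continuous_imp_continuous_on:
  assumes "abs_continuous_on_interval F a b"
  shows "continuous_on {a..b} F"
  unfolding continuous_on_iff
proof (intro ballI allI impI)
  fix x e :: real assume x: "x \<in> {a..b}" and e: "0 < e"
  obtain \<delta> where \<delta>: "\<delta> > 0" and F: "\<forall>(N::nat) l r. (\<forall>i<N. a \<le> l i \<and> l i \<le> r i \<and> r i \<le> b) \<and>
       disjoint_family_on (\<lambda>i. {l i<..<r i}) {..<N} \<and> (\<Sum>i<N. r i - l i) < \<delta>
       \<longrightarrow> (\<Sum>i<N. \<bar>F (r i) - F (l i)\<bar>) < e"
    using assms[unfolded abs_continuous_on_interval_def, rule_format, OF e] by auto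
  have "dist (F y) (F x) < e" if y: "y \<in> {a..b}" "dist y x < \<delta>" for y
  proof -
    have "(\<Sum>i<1::nat. \<bar>F (max x y) - F (min x y)\<bar>) < e"
      by (rule F[rule_format]) (use x y in \<open>auto simp: disjoint_family_on_def dist_real_def\<close>)
    then show ?thesis by (cases "x \<le> y") (auto simp: dist_real_def abs_minus_commute)
  qed
  then show "\<exists>d>0. \<forall>x'\<in>{a..b}. dist x' x < d \<longrightarrow> dist (F x') (F x) < e" using \<delta> by blast
qed

lemma abs_continuous_on_interval_cong:
  assumes f: "abs_continuous_on_interval f a b" and eq: "\<And>t. t \<in> {a..b} \<Longrightarrow> g t = f t"
  shows "abs_continuous_on_interval g a b"
proof -
  have "(\<Sum>i<N. \<bar>g (r i) - g (l i)\<bar>) = (\<Sum>i<N. \<bar>f (r i) - f (l i)\<bar>)"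
    if fam: "\<forall>i<N. a \<le> l i \<and> l i \<le> r i \<and> r i \<le> b" for l r and N :: nat
  proof (rule sum.cong[OF refl])
    fix i assume "i \<in> {..<N}"
    then have "a \<le> l i \<and> l i \<le> r i \<and> r i \<le> b" using fam by simp
    then have "g (r i) = f (r i)" "g (l i) = f (l i)" by (auto intro!: eq)
    then show "\<bar>g (r i) - g (l i)\<bar> = \<bar>f (r i) - f (l i)\<bar>" by simp
  qed
  note same = this
  show ?thesis
    unfolding abs_continuous_on_interval_def
  proof (intro allI impI)
    fix \<epsilon> :: real assume "\<epsilon> > 0"
    then obtain \<delta> where \<delta>: "\<delta> > 0" and F: "\<forall>(N::nat) l r. (\<forall>i<N. a \<le> l i \<and> l i \<le> r i \<and> r i \<le> b) \<and>
         disjoint_family_on (\<lambda>i. {l i<..<r i}) {..<N} \<and> (\<Sum>i<N. r i - l i) < \<delta>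
         \<longrightarrow> (\<Sum>i<N. \<bar>f (r i) - f (l i)\<bar>) < \<epsilon>"
      using f[unfolded abs_continuous_on_interval_def, rule_format, of \<epsilon>] by auto
    show "\<exists>\<delta>>0. \<forall>(N::nat) l r. (\<forall>i<N. a \<le> l i \<and> l i \<le> r i \<and> r i \<le> b) \<and>
         disjoint_family_on (\<lambda>i. {l i<..<r i}) {..<N} \<and> (\<Sum>i<N. r i - l i) < \<delta>
         \<longrightarrow> (\<Sum>i<N. \<bar>g (r i) - g (l i)\<bar>) < \<epsilon>"
    proof (rule exI[of _ \<delta>], rule conjI[OF \<delta>], intro allI impI)
      fix N :: nat and l r assume fam: "(\<forall>i<N. a \<le> l i \<and> l i \<le> r i \<and> r i \<le> b) \<and>
         disjoint_family_on (\<lambda>i. {l i<..<r i}) {..<N} \<and> (\<Sum>i<N. r i - l i) < \<delta>"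
      then have "(\<Sum>i<N. \<bar>f (r i) - f (l i)\<bar>) < \<epsilon>" by (rule F[THEN spec, THEN spec, THEN spec, THEN mp])
      then show "(\<Sum>i<N. \<bar>g (r i) - g (l i)\<bar>) < \<epsilon>" using same[OF conjunct1[OF fam]] by simp
    qed
  qed
qed

text \<open>
  For almost every \<open>x\<close>, the averages over short intervals that begin at \<open>x\<close> converge to the value at
  \<open>x\<close>. Applied to the function and to its reflection, this gives both one-sided derivatives.
\<close>

lemma indefinite_integral_AE_derivative:
  fixes f :: "real \<Rightarrow> real"
  assumes f: "\<And>b. f integrable_on {0..b}"
  obtains N where "negligible N"
    "\<And>t. t \<ge> 0 \<Longrightarrow> t \<notin> N \<Longrightarrow> ((\<lambda>t. integral {0..t} f) has_real_derivative f t) (at t within {0..})"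
proof -
  \<comment> \<open>extended by zero, the function is integrable on every interval of the line\<close>
  define f0 where "f0 t = (if t \<in> {0..} then f t else 0)" for t
  have f0: "f0 integrable_on {a..b}" for a b
  proof -
    have "f integrable_on {max 0 a..b}" by (rule integrable_on_subinterval[OF f[of b]]) auto
    moreover have "{0..} \<inter> {a..b} = {max 0 a..b}" by auto
    ultimately show ?thesis unfolding f0_def by (simp only: integrable_restrict_Int)
  qed
  have f0': "(\<lambda>t. f0 (- t)) integrable_on {a..b}" for a b
    using f0[of "- b" "- a"] Henstock_Kurzweil_Integration.integrable_reflect_real[of f0 "- a" "- b"] by simp
  have pw: "\<exists>N. negligible N \<and> (\<forall>x e. x \<notin> N \<longrightarrow> 0 < e \<longrightarrow> (\<exists>d>0. \<forall>h. 0 < h \<and> h < d \<longrightarrow>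
      \<bar>integral {x..x + h} g / h - g x\<bar> < e))" if g: "\<And>a b. g integrable_on {a..b}" for g :: "real \<Rightarrow> real"
  proof -
    obtain N where "negligible N" "\<And>x e. \<lbrakk>x \<notin> N; 0 < e\<rbrakk> \<Longrightarrow> \<exists>d>0. \<forall>h. 0 < h \<and> h < d \<longrightarrow>
        norm (integral (cbox x (x + h *\<^sub>R One)) g /\<^sub>R h ^ DIM(real) - g x) < e"
      using integrable_ccontinuous_explicit[of g] g by (metis box_real(2))
    then show ?thesis by (intro exI[of _ N]) (auto simp: divide_inverse mult.commute)
  qed
  obtain N1 where N1: "negligible N1" "\<And>x e. x \<notin> N1 \<Longrightarrow> 0 < e \<Longrightarrow> (\<exists>d>0. \<forall>h. 0 < h \<and> h < d \<longrightarrow>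
      \<bar>integral {x..x + h} f0 / h - f0 x\<bar> < e)" using pw[OF f0] by auto
  obtain N2 where N2: "negligible N2" "\<And>x e. x \<notin> N2 \<Longrightarrow> 0 < e \<Longrightarrow> (\<exists>d>0. \<forall>h. 0 < h \<and> h < d \<longrightarrow>
      \<bar>integral {x..x + h} (\<lambda>t. f0 (- t)) / h - f0 (- x)\<bar> < e)" using pw[OF f0'] by auto
  show ?thesis
  proof (rule that[of "N1 \<union> uminus ` N2"])
    have "negligible (uminus ` N2)"
      by (rule negligible_differentiable_image_negligible[OF _ N2(1)])
         (auto intro!: derivative_intros)
    then show "negligible (N1 \<union> uminus ` N2)" using N1(1) by simp
    fix t :: real assume t: "t \<ge> 0" "t \<notin> N1 \<union> uminus ` N2"
    then have t1: "t \<notin> N1" and t2: "- t \<notin> N2" by (auto simp: image_iff)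
    show "((\<lambda>t. integral {0..t} f) has_real_derivative f t) (at t within {0..})"
      unfolding has_field_derivative_iff Lim_within
    proof (intro allI impI)
      fix e :: real assume e: "e > 0"
      obtain d1 where d1: "d1 > 0" "\<And>h. 0 < h \<Longrightarrow> h < d1 \<Longrightarrow> \<bar>integral {t..t + h} f0 / h - f0 t\<bar> < e"
        using N1(2)[OF t1 e] by auto
      obtain d2 where d2: "d2 > 0" "\<And>h. 0 < h \<Longrightarrow> h < d2 \<Longrightarrow> \<bar>integral {- t..- t + h} (\<lambda>t. f0 (- t)) / h - f0 (- (- t))\<bar> < e"
        using N2(2)[OF t2 e] by auto
      have ff0: "integral {a..b} f0 = integral {a..b} f" if "a \<ge> 0" for a b
        using that by (intro Henstock_Kurzweil_Integration.integral_cong) (auto simp: f0_def)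
      have "dist ((integral {0..y} f - integral {0..t} f) / (y - t)) (f t) < e"
        if y: "y \<in> {0..}" "0 < dist y t" "dist y t < min d1 d2" for y
      proof (cases "t < y")
        case True
        have "integral {0..y} f - integral {0..t} f = integral {t..y} f"
          using Henstock_Kurzweil_Integration.integral_combine[of 0 t y f] f[of y] t True by simp
        then show ?thesis using d1(2)[of "y - t"] True y t ff0[of t y]
          by (simp add: dist_real_def f0_def)
      next
        case False
        then have yt: "y < t" using y by auto
        have "integral {0..t} f - integral {0..y} f = integral {y..t} f"
          using Henstock_Kurzweil_Integration.integral_combine[of 0 y t f] f[of t] yt y by simp
        then have "(integral {0..y} f - integral {0..t} f) / (y - t) = integral {y..t} f / (t - y)"
          using yt by (simp add: field_simps)
        moreover have "integral {- t..- t + (t - y)} (\<lambda>t. f0 (- t)) = integral {y..t} f"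
          using Henstock_Kurzweil_Integration.integral_reflect_real[of t y f0] ff0[of y t] y by simp
        ultimately show ?thesis using d2(2)[of "t - y"] yt y t by (simp add: dist_real_def f0_def)
      qed
      then show "\<exists>d>0. \<forall>x\<in>{0..}. 0 < dist x t \<and> dist x t < d \<longrightarrow>
          dist ((integral {0..x} f - integral {0..t} f) / (x - t)) (f t) < e"
        using d1(1) d2(1) by (intro exI[of _ "min d1 d2"]) auto
    qed
  qed
qed

section \<open>Linear integral equations\<close>

locale linear_integral_equation =
  fixes n :: nat and a :: "nat \<Rightarrow> nat \<Rightarrow> real \<Rightarrow> real" and L :: real
  assumes L: "L \<ge> 0"
    and meas: "\<And>i j b. i < n \<Longrightarrow> j < n \<Longrightarrow> a i j \<in> borel_measurable (lebesgue_on {0..b})"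
    and bound: "\<And>i j t. i < n \<Longrightarrow> j < n \<Longrightarrow> t \<ge> 0 \<Longrightarrow> \<bar>a i j t\<bar> \<le> L"
begin

definition homogeneous_rhs :: "(nat \<Rightarrow> real \<Rightarrow> real) \<Rightarrow> nat \<Rightarrow> real \<Rightarrow> real" where
  "homogeneous_rhs y i s = (\<Sum>j<n. a i j s * y j s)"

lemma homogeneous_rhs_absolutely_integrable:
  assumes y: "\<And>j. j < n \<Longrightarrow> continuous_on {0..b} (y j)" and i: "i < n"
  shows "homogeneous_rhs y i absolutely_integrable_on {0..b}"
  unfolding homogeneous_rhs_def[abs_def]
proof (rule absolutely_integrable_sum)
  fix j assume "j \<in> {..<n}"
  then have j: "j < n" by simp
  show "(\<lambda>s. a i j s * y j s) absolutely_integrable_on {0..b}"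
  proof (rule absolutely_integrable_bounded_measurable_product_real)
    show "bounded (a i j ` {0..b})" using bound[OF i j] unfolding bounded_iff by (intro exI[of _ L]) auto
    show "y j absolutely_integrable_on {0..b}" by (rule absolutely_integrable_continuous_real[OF y[OF j]])
  qed (use meas[OF i j] in auto)
qed simp

lemma homogeneous_rhs_integrable:
  assumes "\<And>j. j < n \<Longrightarrow> continuous_on {0..b} (y j)" "i < n" "t \<le> b"
  shows "homogeneous_rhs y i integrable_on {0..t}"
proof -
  have "homogeneous_rhs y i integrable_on {0..b}"
    using homogeneous_rhs_absolutely_integrable[OF assms(1,2)] by (simp add: absolutely_integrable_on_def)
  then show ?thesis by (rule integrable_on_subinterval) (use assms in auto)
qed

text \<open>
  This is the induction step of the Picard estimate: integrating the bound of order \<open>k\<close> gives the one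
  of order \<open>k + 1\<close>. It serves both the uniqueness and the existence of solutions.
\<close>

lemma homogeneous_rhs_integral_bound:
  assumes y: "\<And>j. j < n \<Longrightarrow> continuous_on {0..b} (y j)" and i: "i < n" and t: "t \<in> {0..b}"
    and le: "\<And>j s. j < n \<Longrightarrow> s \<in> {0..b} \<Longrightarrow> \<bar>y j s\<bar> \<le> M * (real n * L * s) ^ k / fact k"
  shows "\<bar>integral {0..t} (homogeneous_rhs y i)\<bar> \<le> M * (real n * L * t) ^ Suc k / fact (Suc k)"
proof -
  define c where "c = real n * L"
  define g where "g s = c * (M * (c * s) ^ k / fact k)" for s
  have "((\<lambda>s. M * (c * s) ^ Suc k / fact (Suc k)) has_vector_derivative g s) (at s within {0..t})" for s
  proof -
    have "((\<lambda>s. (c * s) ^ Suc k) has_real_derivative real (Suc k) * (c * (c * s) ^ k)) (at s within {0..t})"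
      using DERIV_power[OF DERIV_cmult_Id[of c s "{0..t}"], of "Suc k"] by simp
    from DERIV_cdivide[OF DERIV_cmult[OF this, of M], of "fact (Suc k)"]
    have "((\<lambda>s. M * (c * s) ^ Suc k / fact (Suc k)) has_real_derivative
        M * (real (Suc k) * (c * (c * s) ^ k)) / fact (Suc k)) (at s within {0..t})" .
    moreover have "M * (real (Suc k) * (c * (c * s) ^ k)) / fact (Suc k) = g s"
      by (simp add: g_def)
    ultimately show ?thesis by (simp add: has_real_derivative_iff_has_vector_derivative)
  qed
  then have g: "(g has_integral M * (c * t) ^ Suc k / fact (Suc k) - M * (c * 0) ^ Suc k / fact (Suc k)) {0..t}"
    using t by (intro fundamental_theorem_of_calculus) auto
  have "norm (integral {0..t} (homogeneous_rhs y i)) \<le> integral {0..t} g"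
  proof (rule Henstock_Kurzweil_Integration.integral_norm_bound_integral)
    show "homogeneous_rhs y i integrable_on {0..t}" using homogeneous_rhs_integrable[OF y i] t by auto
    show "g integrable_on {0..t}" using g by blast
    fix s assume "s \<in> {0..t}"
    then have s: "s \<in> {0..b}" "s \<ge> 0" using t by auto
    have "norm (homogeneous_rhs y i s) \<le> (\<Sum>j<n. L * (M * (c * s) ^ k / fact k))"
      unfolding homogeneous_rhs_def
    proof (rule sum_norm_le)
      fix j assume "j \<in> {..<n}"
      then have "\<bar>a i j s\<bar> * \<bar>y j s\<bar> \<le> L * (M * (c * s) ^ k / fact k)"
        using bound[OF i _ s(2)] le[OF _ s(1)] L unfolding c_def by (intro mult_mono) auto
      then show "norm (a i j s * y j s) \<le> L * (M * (c * s) ^ k / fact k)" by (simp add: abs_mult)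
    qed
    also have "\<dots> = g s" by (simp add: g_def c_def)
    finally show "norm (homogeneous_rhs y i s) \<le> g s" .
  qed
  then show ?thesis using integral_unique[OF g] by (simp add: c_def)
qed

lemma power_over_fact_tendsto_0: "(\<lambda>k. M * x ^ k / fact k) \<longlonglongrightarrow> (0::real)"
proof -
  have "(\<lambda>k. x ^ k / fact k) \<longlonglongrightarrow> 0"
    using summable_LIMSEQ_zero[OF summable_exp[of x]] by (simp add: divide_inverse mult.commute)
  from tendsto_mult_left[OF this, of M] show ?thesis by simp
qed

lemma bounded_family:
  fixes y :: "nat \<Rightarrow> real \<Rightarrow> real"
  assumes y: "\<And>j. j < n \<Longrightarrow> continuous_on {0..b} (y j)"
  obtains M where "\<And>j s. j < n \<Longrightarrow> s \<in> {0..b} \<Longrightarrow> \<bar>y j s\<bar> \<le> M"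
proof -
  have "\<exists>M. \<forall>s\<in>{0..b}. \<bar>y j s\<bar> \<le> M" if "j < n" for j
    using compact_imp_bounded[OF compact_continuous_image[OF y[OF that] compact_Icc]]
    by (auto simp: bounded_iff)
  then obtain M where M: "\<And>j s. j < n \<Longrightarrow> s \<in> {0..b} \<Longrightarrow> \<bar>y j s\<bar> \<le> M j" by metis
  have "\<bar>y j s\<bar> \<le> (\<Sum>j<n. \<bar>M j\<bar>)" if "j < n" "s \<in> {0..b}" for j s
    using M[OF that] member_le_sum[of j "{..<n}" "\<lambda>j. \<bar>M j\<bar>"] that by auto
  then show ?thesis by (rule that)
qed

text \<open>
  A solution is reproduced by integration, so it satisfies the Picard estimates of every order, and
  these tend to zero.
\<close>

lemma homogeneous_solution_zero:
  assumes y: "\<And>j. j < n \<Longrightarrow> continuous_on {0..b} (y j)"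
    and eq: "\<And>i t. i < n \<Longrightarrow> t \<in> {0..b} \<Longrightarrow> y i t = integral {0..t} (homogeneous_rhs y i)"
    and i: "i < n" and t: "t \<in> {0..b}"
  shows "y i t = 0"
proof -
  obtain M where M: "\<And>j s. j < n \<Longrightarrow> s \<in> {0..b} \<Longrightarrow> \<bar>y j s\<bar> \<le> M" using bounded_family[of b y] y by blast
  have "j < n \<Longrightarrow> s \<in> {0..b} \<Longrightarrow> \<bar>y j s\<bar> \<le> M * (real n * L * s) ^ k / fact k" for j s k
  proof (induction k arbitrary: j s)
    case 0
    then show ?case using M by simp
  next
    case (Suc k)
    show ?case unfolding eq[OF Suc.prems] by (rule homogeneous_rhs_integral_bound[OF y Suc.prems Suc.IH])
  qed
  then have "\<bar>y i t\<bar> \<le> M * (real n * L * t) ^ k / fact k" for k using i t by blast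
  then have "\<bar>y i t\<bar> \<le> 0"
    by (intro LIMSEQ_le_const[OF power_over_fact_tendsto_0[of M "real n * L * t"]]) auto
  then show ?thesis by simp
qed

text \<open>
  The solution is the Picard series of iterated integrals of \<open>g\<close>. The Picard estimates make it
  converge uniformly on compact intervals, and dominated convergence allows passing to the limit under
  the integral.
\<close>

lemma integral_equation_solvable:
  assumes g: "\<And>i b. i < n \<Longrightarrow> continuous_on {0..b} (g i)"
  obtains x where "\<And>i b. i < n \<Longrightarrow> continuous_on {0..b} (x i)"
    "\<And>i t. i < n \<Longrightarrow> t \<ge> 0 \<Longrightarrow> x i t = g i t + integral {0..t} (homogeneous_rhs x i)"
proof -
  define K where "K y i t = integral {0..t} (homogeneous_rhs y i)" for y i t
  define d where "d k = (K ^^ k) g" for k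
  have d_Suc: "d (Suc k) i t = integral {0..t} (homogeneous_rhs (d k) i)" for k i t by (simp add: d_def K_def)
  have dc: "i < n \<Longrightarrow> continuous_on {0..b} (d k i)" for k i b
  proof (induction k arbitrary: i)
    case 0
    then show ?case using g by (simp add: d_def)
  next
    case (Suc k)
    have "continuous_on {0..b} (\<lambda>t. integral {0..t} (homogeneous_rhs (d k) i))"
      by (rule indefinite_integral_continuous_1) (rule homogeneous_rhs_integrable[OF Suc.IH Suc.prems order_refl])
    then show ?case by (simp add: d_Suc[abs_def])
  qed
  define x where "x i t = (\<Sum>k. d k i t)" for i t
  have db: "\<exists>M. \<forall>k i s. i < n \<longrightarrow> s \<in> {0..b} \<longrightarrow> \<bar>d k i s\<bar> \<le> M * (real n * L * b) ^ k / fact k" if "b \<ge> 0" for b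
  proof -
    obtain M where M: "\<And>j s. j < n \<Longrightarrow> s \<in> {0..b} \<Longrightarrow> \<bar>g j s\<bar> \<le> M" using bounded_family[of b g] g by blast
    have d1: "i < n \<Longrightarrow> s \<in> {0..b} \<Longrightarrow> \<bar>d k i s\<bar> \<le> M * (real n * L * s) ^ k / fact k" for k i s
    proof (induction k arbitrary: i s)
      case 0
      then show ?case using M by (simp add: d_def)
    next
      case (Suc k)
      show ?case unfolding d_Suc by (rule homogeneous_rhs_integral_bound[OF dc Suc.prems Suc.IH])
    qed
    have "\<bar>d k i s\<bar> \<le> M * (real n * L * b) ^ k / fact k" if isb: "i < n" "s \<in> {0..b}" for k i s
    proof -
      have "M \<ge> 0" using M[OF isb] by simp
      have "(real n * L * s) ^ k \<le> (real n * L * b) ^ k"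
        using isb L by (intro power_mono mult_left_mono) auto
      then have "M * (real n * L * s) ^ k / fact k \<le> M * (real n * L * b) ^ k / fact k"
        using \<open>M \<ge> 0\<close> by (intro divide_right_mono mult_left_mono) auto
      then show ?thesis using d1[OF isb, of k] by linarith
    qed
    then show ?thesis by blast
  qed
  have smb: "summable (\<lambda>k. M * c ^ k / fact k)" for M c :: real
    using summable_mult[OF summable_exp[of c], of M] by (simp add: divide_inverse mult_ac)
  have ul: "uniform_limit {0..b} (\<lambda>N t. \<Sum>k<N. d k i t) (x i) sequentially" if i: "i < n" and b: "b \<ge> 0" for i b
  proof -
    obtain M where M: "\<And>k i s. i < n \<Longrightarrow> s \<in> {0..b} \<Longrightarrow> \<bar>d k i s\<bar> \<le> M * (real n * L * b) ^ k / fact k"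
      using db[OF b] by blast
    show ?thesis unfolding x_def[abs_def]
      by (rule Weierstrass_m_test[OF _ smb]) (use M[OF i] in auto)
  qed
  have xc: "continuous_on {0..b} (x i)" if i: "i < n" for i b
  proof (cases "b \<ge> 0")
    case True
    show ?thesis
      by (rule uniform_limit_theorem[OF _ ul[OF i True]]) (use dc[OF i] in \<open>auto intro!: always_eventually continuous_on_sum\<close>)
  qed simp
  show ?thesis
  proof (rule that[OF xc])
    fix i and t :: real assume i: "i < n" and t: "t \<ge> 0"
    let ?S = "\<lambda>N j s. \<Sum>k<N. d k j s"
    obtain M where M: "\<And>k i s. i < n \<Longrightarrow> s \<in> {0..t} \<Longrightarrow> \<bar>d k i s\<bar> \<le> M * (real n * L * t) ^ k / fact k"
      using db[OF t] by blast
    define B where "B = (\<Sum>k. \<bar>M * (real n * L * t) ^ k / fact k\<bar>)"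
    have smabs: "summable (\<lambda>k. \<bar>M * (real n * L * t) ^ k / fact k\<bar>)"
      using smb[of "\<bar>M\<bar>" "\<bar>real n * L * t\<bar>"] by (simp add: abs_mult power_abs)
    have SB: "\<bar>?S N j s\<bar> \<le> B" if "j < n" "s \<in> {0..t}" for N j s
    proof -
      have "\<bar>?S N j s\<bar> \<le> (\<Sum>k<N. \<bar>M * (real n * L * t) ^ k / fact k\<bar>)"
        using M[OF that] by (intro order_trans[OF sum_abs] sum_mono) (meson abs_ge_self order_trans)
      also have "\<dots> \<le> B" unfolding B_def by (rule sum_le_suminf[OF smabs]) auto
      finally show ?thesis .
    qed
    have Slim: "(\<lambda>N. ?S N j s) \<longlonglongrightarrow> x j s" if "j < n" "s \<in> {0..t}" for j s
      using tendsto_uniform_limitI[OF ul[OF that(1) t] that(2)] .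
    have "(\<lambda>N. integral {0..t} (homogeneous_rhs (?S N) i)) \<longlonglongrightarrow> integral {0..t} (homogeneous_rhs x i)"
    proof (rule dominated_convergence(2))
      show "homogeneous_rhs (?S N) i integrable_on {0..t}" for N
        by (rule homogeneous_rhs_integrable[OF _ i order_refl]) (use dc in \<open>auto intro!: continuous_on_sum\<close>)
      show "(\<lambda>s. real n * (L * B)) integrable_on {0..t}" by (rule integrable_const_ivl)
      show "norm (homogeneous_rhs (?S N) i s) \<le> real n * (L * B)" if s: "s \<in> {0..t}" for N s
      proof -
        have "norm (homogeneous_rhs (?S N) i s) \<le> (\<Sum>j<n. L * B)" unfolding homogeneous_rhs_def
        proof (rule sum_norm_le)
          fix j assume "j \<in> {..<n}"
          then have "\<bar>a i j s\<bar> * \<bar>?S N j s\<bar> \<le> L * B"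
            using bound[OF i, of j s] SB[of j s N] s L by (intro mult_mono) auto
          then show "norm (a i j s * ?S N j s) \<le> L * B" by (simp add: abs_mult)
        qed
        then show ?thesis by simp
      qed
      show "(\<lambda>N. homogeneous_rhs (?S N) i s) \<longlonglongrightarrow> homogeneous_rhs x i s" if s: "s \<in> {0..t}" for s
        unfolding homogeneous_rhs_def by (intro tendsto_sum tendsto_mult_left Slim s) auto
    qed
    moreover have "integral {0..t} (homogeneous_rhs (?S N) i) = ?S (Suc N) i t - g i t" for N
    proof -
      have "homogeneous_rhs (?S N) i = (\<lambda>s. \<Sum>k<N. homogeneous_rhs (d k) i s)"
        by (rule ext) (simp add: homogeneous_rhs_def sum_distrib_left sum.swap[of _ "{..<n}"])
      then have "integral {0..t} (homogeneous_rhs (?S N) i) = (\<Sum>k<N. integral {0..t} (homogeneous_rhs (d k) i))"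
        using homogeneous_rhs_integrable[OF dc i order_refl] by (simp add: Henstock_Kurzweil_Integration.integral_sum)
      also have "\<dots> = (\<Sum>k<N. d (Suc k) i t)" by (simp only: d_Suc)
      also have "\<dots> = ?S (Suc N) i t - d 0 i t" by (simp only: sum.lessThan_Suc_shift)
      finally show ?thesis by (simp add: d_def)
    qed
    moreover have "(\<lambda>N. ?S (Suc N) i t - g i t) \<longlonglongrightarrow> x i t - g i t"
      using LIMSEQ_Suc[OF Slim[OF i, of t]] t by (intro tendsto_diff) auto
    ultimately have "integral {0..t} (homogeneous_rhs x i) = x i t - g i t" using LIMSEQ_unique by fastforce
    then show "x i t = g i t + integral {0..t} (homogeneous_rhs x i)" by simp
  qed
qed

end

section \<open>Trajectories in continuous time\<close>

text \<open>
  Away from finitely many points, a switching signal on a compact interval is locally constant, so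
  any function of it is continuous there.
\<close>

lemma switching_measurable:
  fixes g :: "nat \<Rightarrow> real"
  assumes q: "q \<in> ct_switching D"
  shows "(\<lambda>t. g (q t)) \<in> borel_measurable (lebesgue_on {0..b})"
proof (cases "b \<ge> 0")
  case False
  then show ?thesis by (intro integrable_imp_measurable) auto
next
  case True
  define F where "F = {t \<in> {0..b}. \<not> continuous (at t within {0..}) q}"
  have F: "finite F" using q True by (auto simp: ct_switching_def F_def)
  have qm: "\<And>t. t \<ge> 0 \<Longrightarrow> q t \<in> modes D"
  using q by (simp add: ct_switching_def)
  let ?T = "{0..b} - F"
  have T: "?T \<in> lmeasurable" using F by (simp add: negligible_finite negligible_imp_measurable fmeasurable.Diff)
  have "continuous_on ?T (\<lambda>t. g (q t))"
    unfolding continuous_on_def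
  proof
    fix t assume t: "t \<in> ?T"
    then have "(q \<longlongrightarrow> q t) (at t within {0..})" by (auto simp: F_def continuous_within)
    then have "(q \<longlongrightarrow> q t) (at t within ?T)" by (rule tendsto_within_subset) auto
    then have "\<forall>\<^sub>F s in at t within ?T. q s = q t" by (simp add: tendsto_discrete)
    then have "\<forall>\<^sub>F s in at t within ?T. g (q s) = g (q t)" by eventually_elim simp
    then show "((\<lambda>t. g (q t)) \<longlongrightarrow> g (q t)) (at t within ?T)" by (rule tendsto_eventually)
  qed
  then have "(\<lambda>t. g (q t)) \<in> borel_measurable (lebesgue_on ?T)"
    using T by (intro continuous_imp_measurable_on_sets_lebesgue) auto
  then have "(\<lambda>t. g (q t)) integrable_on ?T"
  proof (rule measurable_bounded_by_integrable_imp_integrable)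
    show "(\<lambda>t. \<Sum>i\<in>modes D. \<bar>g i\<bar>) integrable_on ?T" by (rule integrable_on_const[OF T])
    show "norm (g (q t)) \<le> (\<Sum>i\<in>modes D. \<bar>g i\<bar>)" if "t \<in> ?T" for t
      using that member_le_sum[of "q t" "modes D" "\<lambda>i. \<bar>g i\<bar>"] qm[of t] by auto
  qed (use T in auto)
  then have "(\<lambda>t. g (q t)) integrable_on {0..b}"
    by (rule integrable_spike_set) (auto intro!: negligible_subset[OF negligible_finite[OF F]])
  then show ?thesis by (rule integrable_imp_measurable)
qed

text \<open>
  Square integrable functions are integrable on bounded intervals because \<open>|x| \<le> 1 + x^2\<close>.
\<close>

lemma input_locally_integrable:
  assumes u: "u \<in> ct_inputs m" and k: "k < m"
  shows "(\<lambda>t. u t $ k) absolutely_integrable_on {0..b}"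
proof (rule measurable_bounded_by_integrable_imp_absolutely_integrable)
  have "(\<lambda>t. u t $ k) \<in> borel_measurable (lebesgue_on {0..})" using u k by (simp add: ct_inputs_def)
  then show "(\<lambda>t. u t $ k) \<in> borel_measurable (lebesgue_on {0..b})"
    by (rule measurable_restrict_mono) auto
  have "(\<lambda>t. u t \<bullet> u t) integrable_on {0..}" using u by (intro integrable_on_lebesgue_on) (auto simp: ct_inputs_def)
  then have "(\<lambda>t. u t \<bullet> u t) integrable_on {0..b}" by (rule integrable_on_subinterval) auto
  then show "(\<lambda>t. 1 + u t \<bullet> u t) integrable_on {0..b}" by (intro integrable_add integrable_const_ivl)
  fix t assume "t \<in> {0..b}"
  then have "u t \<in> carrier_vec m" using u by (auto simp: ct_inputs_def)
  then have "u t \<bullet> u t = (\<Sum>i<m. u t $ i * u t $ i)" by (simp add: scalar_prod_def atLeast0LessThan)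
  also have "\<dots> \<ge> u t $ k * u t $ k"
    using k member_le_sum[of k "{..<m}" "\<lambda>i. u t $ i * u t $ i"] by simp
  finally have "(u t $ k)\<^sup>2 \<le> u t \<bullet> u t" by (simp add: power2_eq_square)
  moreover have "\<bar>u t $ k\<bar> \<le> 1 + (u t $ k)\<^sup>2"
  proof -
    have "0 \<le> (\<bar>u t $ k\<bar> - 1)\<^sup>2 + \<bar>u t $ k\<bar>" by simp
    then show ?thesis by (simp add: power2_diff)
  qed
  ultimately show "norm (u t $ k) \<le> 1 + u t \<bullet> u t" by simp
qed auto

definition ct_rhs :: "lss \<Rightarrow> (real \<Rightarrow> real vec) \<Rightarrow> (real \<Rightarrow> nat) \<Rightarrow> (real \<Rightarrow> real vec) \<Rightarrow> nat \<Rightarrow> real \<Rightarrow> real" where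
  "ct_rhs S u q x i s = (lss_A S (q s) *\<^sub>v x s + lss_B S (q s) *\<^sub>v u s) $ i"

locale ct_data =
  fixes D m p :: nat and S :: lss and u :: "real \<Rightarrow> real vec" and q :: "real \<Rightarrow> nat"
  assumes S: "is_lss D m p S" and u: "u \<in> ct_inputs m" and q: "q \<in> ct_switching D"
begin

abbreviation "n \<equiv> lss_dim S"

definition coeff :: "nat \<Rightarrow> nat \<Rightarrow> real \<Rightarrow> real" where
  "coeff i j t = lss_A S (q t) $$ (i, j)"

definition forcing :: "nat \<Rightarrow> real \<Rightarrow> real" where
  "forcing i t = (lss_B S (q t) *\<^sub>v u t) $ i"

lemma mode: "t \<ge> 0 \<Longrightarrow> q t \<in> modes D"
  using q by (simp add: ct_switching_def)

lemma input_carrier: "t \<ge> 0 \<Longrightarrow> u t \<in> carrier_vec m"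
  using u by (simp add: ct_inputs_def)

lemma carriers: "t \<ge> 0 \<Longrightarrow> lss_A S (q t) \<in> carrier_mat n n" "t \<ge> 0 \<Longrightarrow> lss_B S (q t) \<in> carrier_mat n m"
  "t \<ge> 0 \<Longrightarrow> lss_C S (q t) \<in> carrier_mat p n"
  using S mode[of t] by (auto simp: is_lss_def)

lemma coefficients_bounded:
  obtains L where "L \<ge> 0" "\<And>i j t. i < n \<Longrightarrow> j < n \<Longrightarrow> t \<ge> 0 \<Longrightarrow> \<bar>coeff i j t\<bar> \<le> L"
proof -
  define X where "X = insert 0 ((\<lambda>(k, i, j). \<bar>lss_A S k $$ (i, j)\<bar>) ` (modes D \<times> {..<n} \<times> {..<n}))"
  have fin: "finite X" by (simp add: X_def)
  show ?thesis
  proof (rule that[of "Max X"])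
    show "Max X \<ge> 0" using fin by (intro Max_ge) (auto simp: X_def)
    show "\<bar>coeff i j t\<bar> \<le> Max X" if "i < n" "j < n" "t \<ge> 0" for i j t
    proof -
      have "(q t, i, j) \<in> modes D \<times> {..<n} \<times> {..<n}" using that mode[of t] by auto
      then have "\<bar>coeff i j t\<bar> \<in> X" unfolding X_def coeff_def by force
      then show ?thesis by (rule Max_ge[OF fin])
    qed
  qed
qed

lemma integral_equation_locale: "\<exists>L. linear_integral_equation n coeff L"
proof -
  obtain L where L: "L \<ge> 0" "\<And>i j t. i < n \<Longrightarrow> j < n \<Longrightarrow> t \<ge> 0 \<Longrightarrow> \<bar>coeff i j t\<bar> \<le> L"
    using coefficients_bounded by blast
  have "linear_integral_equation n coeff L"
    by unfold_locales (use L switching_measurable[OF q] in \<open>auto simp: coeff_def[abs_def]\<close>)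
  then show ?thesis by blast
qed

lemma forcing_integrable:
  assumes i: "i < n" shows "forcing i absolutely_integrable_on {0..b}"
proof -
  have "(\<lambda>t. \<Sum>k<m. lss_B S (q t) $$ (i, k) * u t $ k) absolutely_integrable_on {0..b}"
  proof (rule absolutely_integrable_sum)
    fix k assume "k \<in> {..<m}"
    then have k: "k < m" by simp
    show "(\<lambda>t. lss_B S (q t) $$ (i, k) * u t $ k) absolutely_integrable_on {0..b}"
    proof (rule absolutely_integrable_bounded_measurable_product_real)
      show "(\<lambda>t. lss_B S (q t) $$ (i, k)) \<in> borel_measurable (lebesgue_on {0..b})"
        by (rule switching_measurable[OF q])
      have "(\<lambda>t. lss_B S (q t) $$ (i, k)) ` {0..b} \<subseteq> (\<lambda>r. lss_B S r $$ (i, k)) ` modes D" using mode by fastforce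
      then show "bounded ((\<lambda>t. lss_B S (q t) $$ (i, k)) ` {0..b})"
        by (rule bounded_subset[rotated]) (simp add: finite_imp_bounded)
    qed (use input_locally_integrable[OF u k] in auto)
  qed simp
  moreover have "forcing i t = (\<Sum>k<m. lss_B S (q t) $$ (i, k) * u t $ k)" if "t \<in> {0..b}" for t
    using that carriers(2)[of t] input_carrier[of t] i
    by (auto simp: forcing_def scalar_prod_def atLeast0LessThan)
  ultimately show ?thesis
    by (rule absolutely_integrable_spike[OF _ negligible_empty]) auto
qed

lemma ct_rhs_eq:
  assumes "s \<ge> 0" "x s \<in> carrier_vec n" "i < n"
  shows "ct_rhs S u q x i s = (\<Sum>j<n. coeff i j s * x s $ j) + forcing i s"
  using carriers(1,2)[of s] input_carrier[of s] assms
  by (auto simp: ct_rhs_def coeff_def forcing_def scalar_prod_def atLeast0LessThan)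

lemma ct_rhs_integrable:
  assumes x: "\<And>t. t \<ge> 0 \<Longrightarrow> x t \<in> carrier_vec n" and c: "\<And>i. i < n \<Longrightarrow> continuous_on {0..b} (\<lambda>t. x t $ i)"
    and i: "i < n"
  shows "ct_rhs S u q x i absolutely_integrable_on {0..b}"
    and "t \<in> {0..b} \<Longrightarrow> integral {0..t} (ct_rhs S u q x i) =
      integral {0..t} (linear_integral_equation.homogeneous_rhs n coeff (\<lambda>j t. x t $ j) i) + integral {0..t} (forcing i)"
proof -
  obtain L where "linear_integral_equation n coeff L" using integral_equation_locale by blast
  then interpret linear_integral_equation n coeff L .
  let ?y = "\<lambda>j t. x t $ j"
  have eq: "ct_rhs S u q x i s = homogeneous_rhs ?y i s + forcing i s" if "s \<in> {0..b}" for s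
    using ct_rhs_eq[OF _ x i] that by (simp add: homogeneous_rhs_def)
  have "(\<lambda>s. homogeneous_rhs ?y i s + forcing i s) absolutely_integrable_on {0..b}"
    by (intro set_integral_add(1) homogeneous_rhs_absolutely_integrable[OF c i] forcing_integrable[OF i])
  then show "ct_rhs S u q x i absolutely_integrable_on {0..b}"
    by (rule absolutely_integrable_spike[OF _ negligible_empty]) (use eq in auto)
  show "integral {0..t} (ct_rhs S u q x i) = integral {0..t} (homogeneous_rhs ?y i) + integral {0..t} (forcing i)"
    if t: "t \<in> {0..b}"
  proof -
    have "integral {0..t} (ct_rhs S u q x i) = integral {0..t} (\<lambda>s. homogeneous_rhs ?y i s + forcing i s)"
      using eq t by (intro Henstock_Kurzweil_Integration.integral_cong) auto
    also have "\<dots> = integral {0..t} (homogeneous_rhs ?y i) + integral {0..t} (forcing i)"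
      using homogeneous_rhs_integrable[of b ?y i t] c i t forcing_integrable[OF i, of t]
      by (intro Henstock_Kurzweil_Integration.integral_add) (auto simp: absolutely_integrable_on_def)
    finally show ?thesis .
  qed
qed

text \<open>
  An absolutely continuous function is the integral of its derivative, and an indefinite integral is
  absolutely continuous and almost everywhere differentiable. The integral form is the one in which
  solutions can be constructed, compared and mapped linearly.
\<close>

lemma ct_solution_iff_integral_equation:
  "ct_solution S u q x \<longleftrightarrow> (\<forall>t\<ge>0. x t \<in> carrier_vec n) \<and> (\<forall>i<n. (\<forall>b. continuous_on {0..b} (\<lambda>t. x t $ i)) \<and>
     (\<forall>t\<ge>0. x t $ i = integral {0..t} (ct_rhs S u q x i)))"
proof safe
  assume sol: "ct_solution S u q x"
  then have AC: "\<And>b i. b \<ge> 0 \<Longrightarrow> i < n \<Longrightarrow> abs_continuous_on_interval (\<lambda>t. x t $ i) 0 b"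
    and x0: "x 0 = 0\<^sub>v n" and ae: "AE t in lebesgue_on {0..}. \<forall>i<n. ((\<lambda>s. x s $ i) has_real_derivative ct_rhs S u q x i t) (at t within {0..})"
    by (auto simp: ct_solution_def ct_rhs_def)
  show "x t \<in> carrier_vec n" if "t \<ge> 0" for t using sol that by (simp add: ct_solution_def)
  obtain N where N: "N \<in> null_sets lebesgue"
    "\<And>t. t \<ge> 0 \<Longrightarrow> t \<notin> N \<Longrightarrow> \<forall>i<n. ((\<lambda>s. x s $ i) has_real_derivative ct_rhs S u q x i t) (at t within {0..})"
  proof -
    have "AE t in lebesgue. t \<in> {0..} \<longrightarrow> (\<forall>i<n. ((\<lambda>s. x s $ i) has_real_derivative ct_rhs S u q x i t) (at t within {0..}))"
      using ae by (subst (asm) AE_restrict_space_iff) auto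
    then show ?thesis by (rule AE_E3) (use that in auto)
  qed
  fix i assume i: "i < n"
  show "continuous_on {0..b} (\<lambda>t. x t $ i)" for b
    using abs_continuous_imp_continuous_on[OF AC[OF _ i, of b]] by (cases "b \<ge> 0") auto
  fix t :: real assume t: "t \<ge> 0"
  have "(ct_rhs S u q x i has_integral x t $ i - x 0 $ i) {0..t}"
  proof (rule fundamental_theorem_abs_continuous[OF t AC[OF t i]])
    show "negligible N" using N(1) by (simp add: negligible_iff_null_sets)
    show "((\<lambda>t. x t $ i) has_real_derivative ct_rhs S u q x i s) (at s within {0..t})" if "s \<in> {0..t} - N" for s
      using N(2)[of s] that i by (auto intro: DERIV_subset)
  qed
  then show "x t $ i = integral {0..t} (ct_rhs S u q x i)" using x0 i by (simp add: integral_unique)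
next
  assume xc: "\<forall>t\<ge>0. x t \<in> carrier_vec n" and eq: "\<forall>i<n. (\<forall>b. continuous_on {0..b} (\<lambda>t. x t $ i)) \<and>
     (\<forall>t\<ge>0. x t $ i = integral {0..t} (ct_rhs S u q x i))"
  have int: "ct_rhs S u q x i absolutely_integrable_on {0..b}" if "i < n" for i b
    using ct_rhs_integrable(1)[of x b i] xc eq that by blast
  have "\<exists>N. negligible N \<and> (\<forall>t\<ge>0. t \<notin> N \<longrightarrow> ((\<lambda>s. x s $ i) has_real_derivative ct_rhs S u q x i t) (at t within {0..}))"
    if i: "i < n" for i
  proof -
    obtain N where N: "negligible N" "\<And>t. t \<ge> 0 \<Longrightarrow> t \<notin> N \<Longrightarrow>
        ((\<lambda>t. integral {0..t} (ct_rhs S u q x i)) has_real_derivative ct_rhs S u q x i t) (at t within {0..})"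
      using indefinite_integral_AE_derivative[of "ct_rhs S u q x i"] int[OF i]
      by (auto simp: absolutely_integrable_on_def)
    have "((\<lambda>s. x s $ i) has_real_derivative ct_rhs S u q x i t) (at t within {0..})" if "t \<ge> 0" "t \<notin> N" for t
      by (rule has_field_derivative_transform_within[OF N(2)[OF that], of 1]) (use eq i that in auto)
    then show ?thesis using N(1) by blast
  qed
  then obtain N where N: "\<And>i. i < n \<Longrightarrow> negligible (N i)" "\<And>i t. i < n \<Longrightarrow> t \<ge> 0 \<Longrightarrow> t \<notin> N i \<Longrightarrow>
      ((\<lambda>s. x s $ i) has_real_derivative ct_rhs S u q x i t) (at t within {0..})" by metis
  have "negligible (\<Union>i<n. N i)" using N(1) by (intro negligible_Union) auto
  then have null: "(\<Union>i<n. N i) \<in> null_sets lebesgue" by (simp add: negligible_iff_null_sets)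
  have ae: "AE t in lebesgue_on {0..}. \<forall>i<n. ((\<lambda>s. x s $ i) has_real_derivative ct_rhs S u q x i t) (at t within {0..})"
  proof (subst AE_restrict_space_iff)
    show "AE t in lebesgue. t \<in> {0..} \<longrightarrow> (\<forall>i<n. ((\<lambda>s. x s $ i) has_real_derivative ct_rhs S u q x i t) (at t within {0..}))"
      by (rule AE_I'[OF null]) (use N(2) in fastforce)
  qed simp
  have "x 0 = 0\<^sub>v n" using xc eq by (intro eq_vecI) (auto simp: carrier_vecD)
  moreover have "abs_continuous_on_interval (\<lambda>t. x t $ i) 0 b" if "i < n" "b \<ge> 0" for i b
    by (rule abs_continuous_on_interval_cong[OF abs_continuous_indefinite_integral[OF int[OF that(1)]]])
       (use eq that in auto)
  ultimately show "ct_solution S u q x" using xc ae unfolding ct_solution_def ct_rhs_def by blast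
qed

lemma ct_solution_exists: "\<exists>x. ct_solution S u q x"
proof -
  obtain L where "linear_integral_equation n coeff L" using integral_equation_locale by blast
  then interpret linear_integral_equation n coeff L .
  have "continuous_on {0..b} (\<lambda>t. integral {0..t} (forcing i))" if "i < n" for i b
    using forcing_integrable[OF that] by (intro indefinite_integral_continuous_1) (auto simp: absolutely_integrable_on_def)
  then obtain y where y: "\<And>i b. i < n \<Longrightarrow> continuous_on {0..b} (y i)"
    "\<And>i t. i < n \<Longrightarrow> t \<ge> 0 \<Longrightarrow> y i t = integral {0..t} (forcing i) + integral {0..t} (homogeneous_rhs y i)"
    using integral_equation_solvable[of "\<lambda>i t. integral {0..t} (forcing i)"] by blast
  define x where "x t = vec n (\<lambda>i. y i t)" for t
  have yx: "(\<lambda>t. x t $ i) = y i" if "i < n" for i using that by (auto simp: x_def)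
  have vfeq: "homogeneous_rhs (\<lambda>j t. x t $ j) i = homogeneous_rhs y i" for i by (rule ext) (auto simp: homogeneous_rhs_def x_def)
  have "x t $ i = integral {0..t} (ct_rhs S u q x i)" if "i < n" "t \<ge> 0" for i t
    using ct_rhs_integrable(2)[of x t i t] that y yx vfeq by (auto simp: x_def)
  then have "ct_solution S u q x"
    unfolding ct_solution_iff_integral_equation using y(1) yx by (auto simp: x_def)
  then show ?thesis by blast
qed

end

text \<open>
  The controls are only compared before time \<open>b\<close>, so that a continuation that starts at \<open>b\<close> has the
  same state at \<open>b\<close>. The difference of the two solutions solves the homogeneous integral equation.
\<close>

lemma ct_solution_unique_on:
  assumes S: "is_lss D m p S" and u: "u \<in> ct_inputs m" "u' \<in> ct_inputs m" and q: "q \<in> ct_switching D" "q' \<in> ct_switching D"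
    and agree: "\<And>s. 0 \<le> s \<Longrightarrow> s < b \<Longrightarrow> u s = u' s \<and> q s = q' s"
    and x: "ct_solution S u q x" "ct_solution S u' q' x'" and t: "t \<in> {0..b}"
  shows "x t = x' t"
proof -
  interpret d: ct_data D m p S u q by unfold_locales fact+
  interpret d': ct_data D m p S u' q' by unfold_locales fact+
  define n where "n = lss_dim S"
  obtain L where "linear_integral_equation n d.coeff L" using d.integral_equation_locale by (auto simp: n_def)
  then interpret linear_integral_equation n d.coeff L .
  note X = x(1)[unfolded d.ct_solution_iff_integral_equation, folded n_def]
  note X' = x(2)[unfolded d'.ct_solution_iff_integral_equation, folded n_def]
  have xc: "x s \<in> carrier_vec n" "x' s \<in> carrier_vec n" if "s \<ge> 0" for s using X X' that by auto
  have cont: "continuous_on {0..c} (\<lambda>t. x t $ i)" "continuous_on {0..c} (\<lambda>t. x' t $ i)" if "i < n" for i c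
    using X X' that by auto
  have int: "ct_rhs S u q x i integrable_on {0..c}" "ct_rhs S u' q' x' i integrable_on {0..c}" if "i < n" for i c
    using d.ct_rhs_integrable(1)[of x c i] d'.ct_rhs_integrable(1)[of x' c i] xc cont that
    by (auto simp: absolutely_integrable_on_def n_def)
  define y where "y i t = x t $ i - x' t $ i" for i t
  have yeq: "y i t = integral {0..t} (homogeneous_rhs y i)" if i: "i < n" and t: "t \<in> {0..b}" for i t
  proof -
    have "y i t = integral {0..t} (ct_rhs S u q x i) - integral {0..t} (ct_rhs S u' q' x' i)"
      using X X' i t by (simp add: y_def)
    also have "\<dots> = integral {0..t} (\<lambda>s. ct_rhs S u q x i s - ct_rhs S u' q' x' i s)"
      by (rule Henstock_Kurzweil_Integration.integral_diff[symmetric]) (use int[OF i] in auto)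
    also have "\<dots> = integral {0..t} (homogeneous_rhs y i)"
    proof (rule integral_spike)
      \<comment> \<open>the controls may differ at the end point\<close>
      show "negligible {b}" by simp
      fix s assume s: "s \<in> {0..t} - {b}"
      then have s0: "s \<ge> 0" "s < b" using t by auto
      have "ct_rhs S u' q' x' i s = (\<Sum>j<n. d.coeff i j s * x' s $ j) + d.forcing i s"
        using d'.ct_rhs_eq[of s x' i] s0 xc[of s] i agree[of s]
        by (simp add: n_def d.coeff_def d'.coeff_def d.forcing_def d'.forcing_def)
      moreover have "ct_rhs S u q x i s = (\<Sum>j<n. d.coeff i j s * x s $ j) + d.forcing i s"
        using d.ct_rhs_eq[of s x i] s0 xc[of s] i by (simp add: n_def)
      ultimately show "homogeneous_rhs y i s = ct_rhs S u q x i s - ct_rhs S u' q' x' i s"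
        by (simp add: homogeneous_rhs_def y_def right_diff_distrib sum_subtractf)
    qed
    finally show ?thesis .
  qed
  have yc: "continuous_on {0..b} (y i)" if "i < n" for i
  proof -
    have "y i = (\<lambda>t. x t $ i - x' t $ i)" by (rule ext) (simp add: y_def)
    then show ?thesis using cont[OF that] by (auto intro: continuous_on_diff)
  qed
  have "y i t = 0" if "i < n" for i
    by (rule homogeneous_solution_zero[OF yc yeq that t])
  then show ?thesis using xc[of t] t by (intro eq_vecI) (auto simp: y_def)
qed

text \<open>
  Uniqueness of solutions turns the definite description in the input-output map into the output of
  any solution at hand.
\<close>

lemma ct_io_map_eq:
  assumes S: "is_lss D m p S" and u: "u \<in> ct_inputs m" and q: "q \<in> ct_switching D" and x: "ct_solution S u q x"
  shows "ct_io_map D m S (u, q) = (\<lambda>t\<in>{0..}. lss_C S (q t) *\<^sub>v x t)"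
proof -
  have "(THE y. \<exists>x. ct_solution S u q x \<and> y = (\<lambda>t\<in>{0..}. lss_C S (q t) *\<^sub>v x t)) = (\<lambda>t\<in>{0..}. lss_C S (q t) *\<^sub>v x t)"
  proof (rule the_equality)
    fix y assume "\<exists>x. ct_solution S u q x \<and> y = (\<lambda>t\<in>{0..}. lss_C S (q t) *\<^sub>v x t)"
    then obtain x' where x': "ct_solution S u q x'" "y = (\<lambda>t\<in>{0..}. lss_C S (q t) *\<^sub>v x' t)" by blast
    have "x' t = x t" if "t \<ge> 0" for t
      using ct_solution_unique_on[OF S u u q q _ x'(1) x, of t t] that by auto
    then show "y = (\<lambda>t\<in>{0..}. lss_C S (q t) *\<^sub>v x t)" unfolding x'(2) by (intro restrict_ext) auto
  qed (use x in blast)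
  then show ?thesis using u q by (simp add: ct_io_map_def)
qed

lemma ct_morphism_solution:
  assumes S: "is_lss D m p S" and S': "is_lss D m p S'" and M: "lss_morphism D M S' S"
    and u: "u \<in> ct_inputs m" and q: "q \<in> ct_switching D" and x: "ct_solution S' u q x"
  shows "ct_solution S u q (\<lambda>t. M *\<^sub>v x t)"
proof -
  interpret d: ct_data D m p S u q by unfold_locales fact+
  interpret d': ct_data D m p S' u q by unfold_locales fact+
  define n n' where "n = lss_dim S" and "n' = lss_dim S'"
  note X = x[unfolded d'.ct_solution_iff_integral_equation, folded n'_def]
  have Mc: "M \<in> carrier_mat n n'" using M by (simp add: lss_morphism_def n_def n'_def)
  have xc: "x t \<in> carrier_vec n'" if "t \<ge> 0" for t using X that by auto
  have Mx: "(M *\<^sub>v y) $ i = (\<Sum>j<n'. M $$ (i, j) * y $ j)" if "y \<in> carrier_vec n'" "i < n" for y i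
    using Mc that by (auto simp: scalar_prod_def atLeast0LessThan)
  have rhs: "ct_rhs S u q (\<lambda>t. M *\<^sub>v x t) i s = (\<Sum>j<n'. M $$ (i, j) * ct_rhs S' u q x j s)"
    if s: "s \<ge> 0" and i: "i < n" for i s
  proof -
    have "ct_rhs S u q (\<lambda>t. M *\<^sub>v x t) i s = (M *\<^sub>v (lss_A S' (q s) *\<^sub>v x s + lss_B S' (q s) *\<^sub>v u s)) $ i"
      unfolding ct_rhs_def
      using lss_morphismD(1)[OF S S' M d.mode[OF s] xc[OF s, unfolded n'_def] d.input_carrier[OF s]] by simp
    also have "\<dots> = (\<Sum>j<n'. M $$ (i, j) * (lss_A S' (q s) *\<^sub>v x s + lss_B S' (q s) *\<^sub>v u s) $ j)"
      using d'.carriers[OF s] d.input_carrier[OF s] xc[OF s] i by (intro Mx) (auto simp: n'_def)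
    finally show ?thesis by (simp add: ct_rhs_def)
  qed
  have int: "ct_rhs S' u q x j integrable_on {0..t}" if "j < n'" for j t
    using d'.ct_rhs_integrable(1)[of x t j] X that by (auto simp: absolutely_integrable_on_def n'_def)
  have "continuous_on {0..b} (\<lambda>t. (M *\<^sub>v x t) $ i)" if i: "i < n" for i b
  proof -
    have "continuous_on {0..b} (\<lambda>t. \<Sum>j<n'. M $$ (i, j) * x t $ j)"
      using X by (intro continuous_on_sum continuous_on_mult_left) auto
    then show ?thesis by (rule continuous_on_eq) (use Mx[OF xc i] in auto)
  qed
  moreover have "(M *\<^sub>v x t) $ i = integral {0..t} (ct_rhs S u q (\<lambda>t. M *\<^sub>v x t) i)" if i: "i < n" and t: "t \<ge> 0" for i t
  proof -
    have "(M *\<^sub>v x t) $ i = (\<Sum>j<n'. M $$ (i, j) * integral {0..t} (ct_rhs S' u q x j))"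
      unfolding Mx[OF xc[OF t] i] using X t by (intro sum.cong) auto
    also have "\<dots> = integral {0..t} (\<lambda>s. \<Sum>j<n'. M $$ (i, j) * ct_rhs S' u q x j s)"
      using integrable_cmul[OF int, unfolded real_scaleR_def]
      by (subst Henstock_Kurzweil_Integration.integral_sum) auto
    also have "\<dots> = integral {0..t} (ct_rhs S u q (\<lambda>t. M *\<^sub>v x t) i)"
      by (intro Henstock_Kurzweil_Integration.integral_cong) (use rhs i in auto)
    finally show ?thesis .
  qed
  ultimately show ?thesis
    unfolding d.ct_solution_iff_integral_equation n_def[symmetric] using Mc xc by auto
qed

text \<open>
  A solution of the source exists, and its image is a solution of the target with the same output.
\<close>

lemma ct_morphism_equivalent:
  assumes S: "is_lss D m p S" and S': "is_lss D m p S'" and M: "lss_morphism D M S' S"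
  shows "ct_equivalent D m S' S"
proof -
  have "ct_io_map D m S' (u, q) = ct_io_map D m S (u, q)" if u: "u \<in> ct_inputs m" and q: "q \<in> ct_switching D" for u q
  proof -
    interpret d': ct_data D m p S' u q by unfold_locales fact+
    obtain x where x: "ct_solution S' u q x" using d'.ct_solution_exists by blast
    have c: "lss_C S (q t) *\<^sub>v (M *\<^sub>v x t) = lss_C S' (q t) *\<^sub>v x t" if "t \<ge> 0" for t
      using lss_morphismD(2)[OF S S' M d'.mode[OF that] _ d'.input_carrier[OF that]] x that
      by (simp add: ct_solution_def)
    show ?thesis
      unfolding ct_io_map_eq[OF S' u q x] ct_io_map_eq[OF S u q ct_morphism_solution[OF S S' M u q x]]
      by (rule restrict_ext) (use c in auto)
  qed
  then show ?thesis
    unfolding ct_equivalent_def by (intro ext) (auto simp: ct_io_map_def restrict_def)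
qed

section \<open>Continuing a trajectory in a prescribed mode\<close>

lemma input_splice:
  assumes u: "u \<in> ct_inputs m" and t0: "t0 \<ge> 0" and v: "v \<in> carrier_vec m"
  shows "(\<lambda>s. if s < t0 then u s else if s \<le> t0 + 1 then v else 0\<^sub>v m) \<in> ct_inputs m" (is "?w \<in> _")
proof -
  let ?M = "lebesgue_on {0..} :: real measure"
  have uc: "\<And>s. s \<ge> 0 \<Longrightarrow> u s \<in> carrier_vec m" using u by (simp add: ct_inputs_def)
  have sets: "{0..<t0} \<in> sets ?M" "{t0..t0 + 1} \<in> sets ?M"
    using t0 by (auto simp: sets_restrict_space_iff)
  have fin: "emeasure ?M {t0..t0 + 1} < \<infinity>"
    using t0 by (subst emeasure_restrict_space) auto
  have combine: "(\<lambda>s. indicator {0..<t0} s *\<^sub>R f s + indicator {t0..t0 + 1} s *\<^sub>R c) \<in> borel_measurable ?M"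
    if "f \<in> borel_measurable ?M" for f :: "real \<Rightarrow> real" and c
    by (intro borel_measurable_add borel_measurable_scaleR borel_measurable_indicator sets that borel_measurable_const)
  have "(\<lambda>s. ?w s $ i) \<in> borel_measurable ?M" if i: "i < m" for i
  proof -
    have "(\<lambda>s. u s $ i) \<in> borel_measurable ?M" using u i by (simp add: ct_inputs_def)
    from combine[OF this, of "v $ i"] show ?thesis
      by (rule measurable_cong[THEN iffD1, rotated]) (use i in \<open>auto simp: indicator_def\<close>)
  qed
  moreover have "integrable ?M (\<lambda>s. ?w s \<bullet> ?w s)"
  proof -
    have "integrable ?M (\<lambda>s. u s \<bullet> u s)" using u by (simp add: ct_inputs_def)
    then have "integrable ?M (\<lambda>s. indicator {0..<t0} s *\<^sub>R (u s \<bullet> u s) + indicator {t0..t0 + 1} s *\<^sub>R (v \<bullet> v))"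
      by (intro Bochner_Integration.integrable_add integrable_mult_indicator[OF sets(1)]
          integrable_scaleR_left integrable_real_indicator sets fin)
    then show ?thesis
      by (rule Bochner_Integration.integrable_cong[THEN iffD1, rotated 2]) (auto simp: indicator_def)
  qed
  ultimately show ?thesis using uc v by (auto simp: ct_inputs_def)
qed

lemma switching_splice:
  assumes q: "q \<in> ct_switching D" and t0: "t0 \<ge> 0" and q0: "q0 \<in> modes D"
  shows "(\<lambda>s. if s < t0 then q s else q0) \<in> ct_switching D" (is "?w \<in> _")
proof -
  have before: "(?w \<longlongrightarrow> c) F \<longleftrightarrow> (q \<longlongrightarrow> c) F" if "\<forall>\<^sub>F s in F. s < t0" for F c
    using that by (intro tendsto_cong) (auto elim: eventually_mono)
  have after: "(?w \<longlongrightarrow> q0) F" if "\<forall>\<^sub>F s in F. s > t0" for F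
    using that by (intro tendsto_eventually) (auto elim: eventually_mono)
  have "continuous (at t within {0..}) ?w" if "t \<noteq> t0" "continuous (at t within {0..}) q" for t
  proof (cases "t < t0")
    case True
    have "\<forall>\<^sub>F s in at t within {0..}. s < t0"
      using True by (intro order_tendstoD(2)[OF tendsto_ident_at])
    from before[OF this] show ?thesis using that True by (simp add: continuous_within)
  next
    case False
    then have "\<forall>\<^sub>F s in at t within {0..}. s > t0"
      using that by (intro order_tendstoD(1)[OF tendsto_ident_at]) auto
    from after[OF this] show ?thesis using False by (simp add: continuous_within)
  qed
  then have "{t \<in> {0..b}. \<not> continuous (at t within {0..}) ?w} \<subseteq> insert t0 {t \<in> {0..b}. \<not> continuous (at t within {0..}) q}" for b
    by auto
  moreover have "finite (insert t0 {t \<in> {0..b}. \<not> continuous (at t within {0..}) q})" if "b \<ge> 0" for b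
    using q that by (simp add: ct_switching_def)
  ultimately have fin: "finite {t \<in> {0..b}. \<not> continuous (at t within {0..}) ?w}" if "b \<ge> 0" for b
    using that finite_subset by blast
  have right: "\<exists>l. (?w \<longlongrightarrow> l) (at_right t)" if t: "t \<ge> 0" for t
  proof (cases "t < t0")
    case True
    obtain l where "(q \<longlongrightarrow> l) (at_right t)" using q t by (auto simp: ct_switching_def)
    moreover have "\<forall>\<^sub>F s in at_right t. s < t0" using True by (intro order_tendstoD(2)[OF tendsto_ident_at])
    ultimately show ?thesis using before by blast
  next
    case False
    have "\<forall>\<^sub>F s in at_right t. s > t0"
      using eventually_at_right_less[of t] False by (auto elim: eventually_mono)
    then show ?thesis using after by blast
  qed
  have left: "\<exists>l. (?w \<longlongrightarrow> l) (at_left t)" if t: "t > 0" for t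
  proof (cases "t \<le> t0")
    case True
    obtain l where "(q \<longlongrightarrow> l) (at_left t)" using q t by (auto simp: ct_switching_def)
    moreover have "\<forall>\<^sub>F s in at_left t. s < t0"
      using True by (auto simp: eventually_at_filter)
    ultimately show ?thesis using before by blast
  next
    case False
    then have "\<forall>\<^sub>F s in at_left t. s > t0" by (intro order_tendstoD(1)[OF tendsto_ident_at]) auto
    then show ?thesis using after by blast
  qed
  show ?thesis using q q0 fin right left by (auto simp: ct_switching_def)
qed

text \<open>
  While mode and input are constant, the right-hand side of the integral equation is continuous, so
  the solution has a genuine one-sided derivative where this interval begins.
\<close>

lemma ct_solution_right_derivative:
  assumes S: "is_lss D m p S" and u: "u \<in> ct_inputs m" and q: "q \<in> ct_switching D" and x: "ct_solution S u q x"
    and t0: "t0 \<ge> 0" and const: "\<And>s. s \<in> {t0..t0 + 1} \<Longrightarrow> u s = v \<and> q s = q0" and l: "l \<in> carrier_vec (lss_dim S)"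
  shows "((\<lambda>t. l \<bullet> x t) has_real_derivative l \<bullet> (lss_A S q0 *\<^sub>v x t0 + lss_B S q0 *\<^sub>v v)) (at t0 within {t0..t0 + 1})"
proof -
  interpret ct_data D m p S u q by unfold_locales fact+
  note X = x[unfolded ct_solution_iff_integral_equation]
  have xc: "x t \<in> carrier_vec n" if "t \<ge> 0" for t using X that by auto
  have c: "lss_A S q0 \<in> carrier_mat n n" "lss_B S q0 \<in> carrier_mat n m" "v \<in> carrier_vec m"
    using carriers[OF t0] input_carrier[OF t0] const[of t0] by auto
  have coord: "((\<lambda>t. x t $ i) has_real_derivative (lss_A S q0 *\<^sub>v x t0 + lss_B S q0 *\<^sub>v v) $ i) (at t0 within {t0..t0 + 1})"
    if i: "i < n" for i
  proof -
    let ?r = "ct_rhs S u q x i"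
    have int: "?r integrable_on {0..b}" for b
      using ct_rhs_integrable(1)[of x b i] X i by (auto simp: absolutely_integrable_on_def)
    have r: "?r s = (\<Sum>j<n. lss_A S q0 $$ (i, j) * x s $ j) + (lss_B S q0 *\<^sub>v v) $ i" if "s \<in> {t0..t0 + 1}" for s
      using that const[OF that] t0 c xc[of s] i by (auto simp: ct_rhs_def scalar_prod_def atLeast0LessThan)
    have "continuous_on {t0..t0 + 1} (\<lambda>s. (\<Sum>j<n. lss_A S q0 $$ (i, j) * x s $ j) + (lss_B S q0 *\<^sub>v v) $ i)"
    proof (intro continuous_on_add continuous_on_sum continuous_on_mult_left continuous_on_const)
      fix j assume "j \<in> {..<n}"
      then have "continuous_on {0..t0 + 1} (\<lambda>t. x t $ j)" using X by auto
      then show "continuous_on {t0..t0 + 1} (\<lambda>t. x t $ j)" by (rule continuous_on_subset) (use t0 in auto)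
    qed
    then have "continuous_on {t0..t0 + 1} ?r" by (rule continuous_on_eq) (use r in auto)
    then have "((\<lambda>t. integral {t0..t} ?r) has_real_derivative ?r t0) (at t0 within {t0..t0 + 1})"
      by (rule integral_has_real_derivative) auto
    then have "((\<lambda>t. x t0 $ i + integral {t0..t} ?r) has_real_derivative ?r t0) (at t0 within {t0..t0 + 1})"
      by (auto intro!: derivative_eq_intros)
    then have "((\<lambda>t. x t $ i) has_real_derivative ?r t0) (at t0 within {t0..t0 + 1})"
    proof (rule has_field_derivative_transform_within[of _ _ _ _ 1])
      fix t assume t: "t \<in> {t0..t0 + 1}"
      have "integral {0..t0} ?r + integral {t0..t} ?r = integral {0..t} ?r"
        by (rule Henstock_Kurzweil_Integration.integral_combine) (use t t0 int in auto)
      then show "x t0 $ i + integral {t0..t} ?r = x t $ i" using X i t t0 by simp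
    qed auto
    then show ?thesis using const[of t0] by (simp add: ct_rhs_def)
  qed
  have sum: "l \<bullet> y = (\<Sum>i<n. l $ i * y $ i)" if "y \<in> carrier_vec n" for y
    using l that by (simp add: scalar_prod_def atLeast0LessThan)
  have d: "lss_A S q0 *\<^sub>v x t0 + lss_B S q0 *\<^sub>v v \<in> carrier_vec n" using c xc[OF t0] by auto
  have "((\<lambda>t. \<Sum>i<n. l $ i * x t $ i) has_real_derivative
      (\<Sum>i<n. l $ i * (lss_A S q0 *\<^sub>v x t0 + lss_B S q0 *\<^sub>v v) $ i)) (at t0 within {t0..t0 + 1})"
    by (intro DERIV_sum DERIV_cmult coord) auto
  then show ?thesis
    unfolding sum[OF d] by (rule has_field_derivative_transform_within[of _ _ _ _ 1]) (use sum xc t0 in auto)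
qed

section \<open>The gain bound of a minimal system\<close>

text \<open>
  As in discrete time, the relation is the span of the jointly reachable pairs of states. If a
  functional vanishes on all of them, it vanishes along every continuation of a trajectory with
  constant mode and input. Its right derivative at the start of the continuation is then zero, and
  this derivative is the functional applied to the two velocities. In this way infinitesimal
  invariance follows without computing matrix exponentials or Markov parameters.
\<close>

lemma ct_equivalent_simulation:
  assumes S: "is_lss D m p S" and S': "is_lss D m p S'" and eq: "ct_equivalent D m S S'" and D: "D \<ge> 1"
  shows "\<exists>W. simulation_relation D m S S' W"
proof -
  define R where "R = {(x t, z t) | u q x z t. u \<in> ct_inputs m \<and> q \<in> ct_switching D \<and>
     ct_solution S u q x \<and> ct_solution S' u q z \<and> (t::real) \<ge> 0}"
  have continue: "\<exists>u' q' x' z'. u' \<in> ct_inputs m \<and> q' \<in> ct_switching D \<and> ct_solution S u' q' x' \<and> ct_solution S' u' q' z' \<and>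
      x' t = x t \<and> z' t = z t \<and> (\<forall>s\<in>{t..t + 1}. u' s = v \<and> q' s = q0)"
    if u: "u \<in> ct_inputs m" and q: "q \<in> ct_switching D" and x: "ct_solution S u q x" and z: "ct_solution S' u q z"
      and t: "t \<ge> 0" and q0: "q0 \<in> modes D" and v: "v \<in> carrier_vec m" for u q x z t q0 v
  proof -
    let ?u = "\<lambda>s. if s < t then u s else if s \<le> t + 1 then v else 0\<^sub>v m"
    let ?q = "\<lambda>s. if s < t then q s else q0"
    have u': "?u \<in> ct_inputs m" by (rule input_splice[OF u t v])
    have q': "?q \<in> ct_switching D" by (rule switching_splice[OF q t q0])
    interpret d: ct_data D m p S ?u ?q by (rule ct_data.intro[OF S u' q'])
    interpret d': ct_data D m p S' ?u ?q by (rule ct_data.intro[OF S' u' q'])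
    obtain x' where x': "ct_solution S ?u ?q x'" using d.ct_solution_exists by blast
    obtain z' where z': "ct_solution S' ?u ?q z'" using d'.ct_solution_exists by blast
    have "x' t = x t" by (rule ct_solution_unique_on[OF S u' u q' q _ x' x, of t]) (use t in auto)
    moreover have "z' t = z t" by (rule ct_solution_unique_on[OF S' u' u q' q _ z' z, of t]) (use t in auto)
    moreover have "\<forall>s\<in>{t..t + 1}. ?u s = v \<and> ?q s = q0" by auto
    ultimately show ?thesis using u' q' x' z' by blast
  qed
  have "simulation_relation D m S S' (biannihilator (lss_dim S) (lss_dim S') R)"
  proof (rule biannihilator_simulation[OF S S'])
    show "R \<subseteq> carrier_vec (lss_dim S) \<times> carrier_vec (lss_dim S')"
      by (auto simp: R_def ct_solution_def)
    have u: "(\<lambda>t. 0\<^sub>v m) \<in> ct_inputs m" and q: "(\<lambda>t. 1) \<in> ct_switching D"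
      using D by (auto simp: ct_inputs_def ct_switching_def)
    interpret d: ct_data D m p S "\<lambda>t. 0\<^sub>v m" "\<lambda>t. 1" by (rule ct_data.intro[OF S u q])
    interpret d': ct_data D m p S' "\<lambda>t. 0\<^sub>v m" "\<lambda>t. 1" by (rule ct_data.intro[OF S' u q])
    obtain x where x: "ct_solution S (\<lambda>t. 0\<^sub>v m) (\<lambda>t. 1) x" using d.ct_solution_exists by blast
    obtain z where z: "ct_solution S' (\<lambda>t. 0\<^sub>v m) (\<lambda>t. 1) z" using d'.ct_solution_exists by blast
    have "(x 0, z 0) \<in> R" unfolding R_def using u q x z by blast
    moreover have "x 0 = 0\<^sub>v (lss_dim S)" "z 0 = 0\<^sub>v (lss_dim S')" using x z by (auto simp: ct_solution_def)
    ultimately show "(0\<^sub>v (lss_dim S), 0\<^sub>v (lss_dim S')) \<in> R" by simp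
  next
    fix l k a b v :: "real vec" and q0
    assume ann: "annihilates l k R" and l: "l \<in> carrier_vec (lss_dim S)" and k: "k \<in> carrier_vec (lss_dim S')"
      and q0: "q0 \<in> modes D" and ab: "(a, b) \<in> R" and v: "v \<in> carrier_vec m"
    obtain u q x z t where uq: "u \<in> ct_inputs m" "q \<in> ct_switching D" "ct_solution S u q x" "ct_solution S' u q z" "t \<ge> 0"
      and ab_eq: "a = x t" "b = z t" using ab unfolding R_def by blast
    obtain u' q' x' z' where c: "u' \<in> ct_inputs m" "q' \<in> ct_switching D" "ct_solution S u' q' x'" "ct_solution S' u' q' z'"
      "x' t = x t" "z' t = z t" and const: "\<forall>s\<in>{t..t + 1}. u' s = v \<and> q' s = q0"
      using continue[OF uq q0 v] by blast
    define \<psi> where "\<psi> s = l \<bullet> x' s + k \<bullet> z' s" for s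
    define d where "d = l \<bullet> (lss_A S q0 *\<^sub>v a + lss_B S q0 *\<^sub>v v) + k \<bullet> (lss_A S' q0 *\<^sub>v b + lss_B S' q0 *\<^sub>v v)"
    note deriv = ct_solution_right_derivative[OF S c(1,2,3) uq(5) const[rule_format] l]
      ct_solution_right_derivative[OF S' c(1,2,4) uq(5) const[rule_format] k]
    have slope: "(\<psi> has_real_derivative d) (at t within {t..t + 1})"
      using DERIV_add[OF deriv] unfolding \<psi>_def[abs_def] d_def ab_eq c(5,6) by simp
    have zero: "\<psi> s = 0" if "s \<ge> t" for s
    proof -
      have "(x' s, z' s) \<in> R" unfolding R_def using c uq(5) that by force
      then show ?thesis using ann by (auto simp: annihilates_def \<psi>_def)
    qed
    \<comment> \<open>\<open>\<psi>\<close> vanishes on the whole continuation, since all its states are jointly reached\<close>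
    have flat: "(\<psi> has_real_derivative 0) (at t within {t..t + 1})"
      by (rule has_field_derivative_transform_within[of "\<lambda>_. 0" _ _ _ 1]) (use zero in auto)
    have "at t within {t..t + 1} \<noteq> bot" by (simp add: at_within_Icc_at_right)
    then have "d = 0"
      using slope flat unfolding has_field_derivative_iff by (rule tendsto_unique)
    then show "l \<bullet> (lss_A S q0 *\<^sub>v a + lss_B S q0 *\<^sub>v v) + k \<bullet> (lss_A S' q0 *\<^sub>v b + lss_B S' q0 *\<^sub>v v) = 0"
      by (simp add: d_def)
  next
    fix q0 and a b :: "real vec" assume q0: "q0 \<in> modes D" and ab: "(a, b) \<in> R"
    obtain u q x z t where uq: "u \<in> ct_inputs m" "q \<in> ct_switching D" "ct_solution S u q x" "ct_solution S' u q z" "t \<ge> 0"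
      and ab_eq: "a = x t" "b = z t" using ab unfolding R_def by blast
    obtain u' q' x' z' where c: "u' \<in> ct_inputs m" "q' \<in> ct_switching D" "ct_solution S u' q' x'" "ct_solution S' u' q' z'"
      "x' t = x t" "z' t = z t" and const: "\<forall>s\<in>{t..t + 1}. u' s = 0\<^sub>v m \<and> q' s = q0"
      using continue[OF uq q0 zero_carrier_vec] by blast
    have "ct_io_map D m S (u', q') t = ct_io_map D m S' (u', q') t" using eq by (simp add: ct_equivalent_def)
    then show "lss_C S q0 *\<^sub>v a = lss_C S' q0 *\<^sub>v b"
      unfolding ct_io_map_eq[OF S c(1,2,3)] ct_io_map_eq[OF S' c(1,2,4)] using c(5,6) const uq(5) ab_eq by simp
  qed
  then show ?thesis by blast
qed

text \<open>
  Morphisms preserve the input-output map, so a minimal system admits none to or from a smaller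
  one.
\<close>

lemma ct_minimal_gamma_le:
  assumes D: "D \<ge> 1" and S: "is_lss D m p S" and Sm: "ct_minimal D m p Sm" and eq: "ct_equivalent D m Sm S"
  shows "ct_gamma D m Sm \<le> ct_gamma D m S"
proof -
  have Sm': "is_lss D m p Sm" using Sm by (simp add: ct_minimal_def)
  have "ct_equivalent D m S Sm" using eq by (simp add: ct_equivalent_def)
  then obtain W where W: "simulation_relation D m S Sm W" using ct_equivalent_simulation[OF S Sm' _ D] by blast
  have "lss_dim Sm \<le> lss_dim T" if T: "is_lss D m p T" and M: "lss_morphism D M T Sm \<or> lss_morphism D M Sm T" for T M
  proof -
    have "ct_equivalent D m T Sm"
      using M ct_morphism_equivalent[OF Sm' T] ct_morphism_equivalent[OF T Sm'] by (auto simp: ct_equivalent_def)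
    then show ?thesis using Sm T by (simp add: ct_minimal_def)
  qed
  then show ?thesis by (rule gamma_le_by_simulation(1)[OF S Sm' W])
qed

theorem corollary2:
  fixes D m p :: nat
  assumes "D \<ge> 1"
  shows
    "((\<forall>S Sm. is_lss D m p S \<and> ct_minimal D m p Sm \<and> ct_equivalent D m Sm S \<longrightarrow>
         ct_gamma D m Sm \<le> ct_gamma D m S) \<and>
      (\<forall>S1 S2. ct_minimal D m p S1 \<and> ct_minimal D m p S2 \<and> ct_equivalent D m S1 S2 \<longrightarrow>
         ct_gamma D m S1 = ct_gamma D m S2)) \<and>
     ((\<forall>S Sm. is_lss D m p S \<and> dt_minimal D m p Sm \<and> dt_equivalent D m Sm S \<longrightarrow>
         dt_gamma D m Sm \<le> dt_gamma D m S) \<and>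
      (\<forall>S1 S2. dt_minimal D m p S1 \<and> dt_minimal D m p S2 \<and> dt_equivalent D m S1 S2 \<longrightarrow>
         dt_gamma D m S1 = dt_gamma D m S2))"
proof (intro conjI allI impI)
  fix S Sm assume "is_lss D m p S \<and> ct_minimal D m p Sm \<and> ct_equivalent D m Sm S"
  then show "ct_gamma D m Sm \<le> ct_gamma D m S" using ct_minimal_gamma_le[OF assms] by blast
next
  fix S1 S2 assume a: "ct_minimal D m p S1 \<and> ct_minimal D m p S2 \<and> ct_equivalent D m S1 S2"
  then have "is_lss D m p S1" "is_lss D m p S2" "ct_equivalent D m S2 S1"
    by (auto simp: ct_minimal_def ct_equivalent_def)
  then show "ct_gamma D m S1 = ct_gamma D m S2"
    using a ct_minimal_gamma_le[OF assms] by (intro antisym) blast+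
next
  fix S Sm assume "is_lss D m p S \<and> dt_minimal D m p Sm \<and> dt_equivalent D m Sm S"
  then show "dt_gamma D m Sm \<le> dt_gamma D m S" using dt_minimal_gamma_le[OF assms] by blast
next
  fix S1 S2 assume a: "dt_minimal D m p S1 \<and> dt_minimal D m p S2 \<and> dt_equivalent D m S1 S2"
  then have "is_lss D m p S1" "is_lss D m p S2" "dt_equivalent D m S2 S1"
    by (auto simp: dt_minimal_def dt_equivalent_def)
  then show "dt_gamma D m S1 = dt_gamma D m S2"
    using a dt_minimal_gamma_le[OF assms] by (intro antisym) blast+
qed

end
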